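(* Let $n=n(k)$ be a positive integer valued function of $k$ with $n/\sqrt{k}\to\infty$ and $n=o(k\sqrt{k})$ as $k\to\infty$, and let $G$ be chosen according to $\Sigma(K_{n,n};k)$. Then for every $0<\xi\le1$ there is a constant $k_0=k_0(\xi)$ such that for all $k>k_0$, \[\Pr\big[R(G)\le(1-\xi)2n/\sqrt{k}\big]\le 2e^{-\frac{1}{10}\xi^2 2n/\sqrt{k}}.\]
   Context: Random word model $\Sigma(K_{n,n};k)$: $K_{n,n}$ has sides $A=\{a_1,\ldots,a_n\}$, $B=\{b_1,\ldots,b_n\}$; each vertex independently receives a uniform symbol from $[k]$, and one keeps exactly the edges $a_ib_j$ whose endpoints have the same symbol (the symbol associated to the edge). Edges $a_ib_j$, $a_{i'}b_{j'}$ are noncrossing if ($i<i'$ and $j<j'$) or ($i'<i$ and $j'<j$); a matching is noncrossing if its edges are pairwise noncrossing and repetition-free if the symbols of its edges are pairwise distinct; $R(G)$ is the maximum size of a repetition-free noncrossing matching of $G$ (equivalently, the maximum length of a common subsequence without repeated symbols of the two random length-$n$ symbol sequences on the two sides). Integrality issues are ignored, as in the paper. *)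

theory Defs
  imports "HOL-Probability.Probability" "HOL-Probability.Product_PMF" "HOL-Library.Landau_Symbols"
begin

datatype vertex = A nat | B nat

definition Knn_vertices :: "nat \<Rightarrow> vertex set" where
  "Knn_vertices n = A ` {1..n} \<union> B ` {1..n}"

(* A subgraph of K_{n,n} with symbols on its edges is a partial map G on index pairs:
   the edges are dom G, the pair (i, j) stands for the edge a_i b_j, and
   G (i, j) = Some s means that this edge carries the symbol s. *)
type_synonym word_graph = "nat \<times> nat \<Rightarrow> nat option"

definition kept_edges :: "nat \<Rightarrow> (vertex \<Rightarrow> nat) \<Rightarrow> word_graph" where
  "kept_edges n \<sigma> = (\<lambda>(i, j).
     if i \<in> {1..n} \<and> j \<in> {1..n} \<and> \<sigma> (A i) = \<sigma> (B j) then Some (\<sigma> (A i)) else None)"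

(* Meaningful only for k > 0. The argument 0 of Pi_pmf is the dummy value
   outside the vertex set. *)
definition Sigma_Knn :: "nat \<Rightarrow> nat \<Rightarrow> word_graph pmf" where
  "Sigma_Knn n k =
     map_pmf (kept_edges n) (Pi_pmf (Knn_vertices n) 0 (\<lambda>_. pmf_of_set {1..k}))"

definition matching :: "(nat \<times> nat) set \<Rightarrow> bool" where
  "matching M \<longleftrightarrow> pairwise (\<lambda>e e'. fst e \<noteq> fst e' \<and> snd e \<noteq> snd e') M"

definition noncrossing :: "(nat \<times> nat) set \<Rightarrow> bool" where
  "noncrossing M \<longleftrightarrow> pairwise (\<lambda>(i, j) (i', j'). (i < i' \<and> j < j') \<or> (i' < i \<and> j' < j)) M"

definition repetition_free :: "word_graph \<Rightarrow> (nat \<times> nat) set \<Rightarrow> bool" where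
  "repetition_free G M \<longleftrightarrow> pairwise (\<lambda>e e'. G e \<noteq> G e') M"

(* Intended for finite dom G, so that the maximum is over a finite set
   (nonempty because of the empty matching). *)
definition R :: "word_graph \<Rightarrow> nat" where
  "R G = Max {card M | M. M \<subseteq> dom G \<and> matching M \<and> noncrossing M \<and> repetition_free G M}"

end

theory Submission imports Defs begin

text \<open>
  Changing one symbol changes \<open>R\<close> by at most one, and \<open>R \<ge> b\<close> is certified by \<open>2 * b\<close> symbols, so
  Talagrand's inequality gives the claimed tail as soon as \<open>R\<close> exceeds \<open>(1 - \<xi>/10) 2n/\<surd>k\<close> with
  probability at least one half.

  For the latter, cut both words into blocks of length \<open>N \<approx> T \<surd>k\<close> with a large constant \<open>T\<close> and treat
  the diagonal blocks one after the other, forbidding the symbols that were already used; these are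
  \<open>O(n/\<surd>k) = o(k)\<close> many, hence negligible. Inside a block the graph of equal symbols is close to a
  matrix of independent Bernoulli(\<open>1/k\<close>) cells: both concentrate on matchings, and each single matching
  has almost the same probability in the two models.

  It remains to see that an \<open>N \<times> N\<close> Bernoulli matrix has an increasing chain of length about \<open>2T\<close>
  (Cator and Groeneboom's argument for Hammersley's process, in Seppalainen's lattice version).
  With Bernoulli sources and sinks of suitable densities on the boundary the growth process is stationary,
  so its passage time is a sum of two binomial variables with mean about \<open>T\<close> each. A path that collects
  many sources would become too long for a slightly higher density of sources; so the
  longest path leaves the boundary early, and what remains of it is a chain inside the matrix.
\<close>

text \<open>The comparison with independent cells costs an error of order N^3/k^2, the expected
  number of pairs of ones in a common row or column. For N = n this may be unbounded; for blocks of
  length about T sqrt k it vanishes. A set U of forbidden symbols costs N^2 |U| / k^2; with |U| at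
  most 2n / sqrt k this is of order n / (k sqrt k), and here the upper bound on n enters. The lower
  bound on n makes room for many blocks.

  A block succeeds only with probability 1 - \<delta> for a fixed \<delta>, so concatenation
  controls just an expectation. Since the number of collected edges is capped at its greatest
  intended value, an expectation close to the cap forces probability one half. The exponential tail
  is left entirely to Talagrand's inequality; second moments and union bounds suffice
  elsewhere.\<close>

section \<open>Expectations over finitely supported distributions\<close>

lemma expectation_bind_finite:
  fixes f :: "'b \<Rightarrow> real"
  assumes "finite (set_pmf M)" "\<And>x. x \<in> set_pmf M \<Longrightarrow> finite (set_pmf (N x))"
  shows "measure_pmf.expectation (bind_pmf M N) f =
    measure_pmf.expectation M (\<lambda>x. measure_pmf.expectation (N x) f)"
proof -
  have "measure_pmf.expectation (bind_pmf M N) f =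
     (\<Sum>a\<in>set_pmf M. pmf M a *\<^sub>R measure_pmf.expectation (N a) f)"
    using assms by (intro pmf_expectation_bind) auto
  also have "\<dots> = measure_pmf.expectation M (\<lambda>x. measure_pmf.expectation (N x) f)"
    by (rule integral_measure_pmf[symmetric]) (use assms in auto)
  finally show ?thesis .
qed

lemma prob_bind_finite:
  assumes "finite (set_pmf M)"
  shows "measure_pmf.prob (bind_pmf M N) S = measure_pmf.expectation M (\<lambda>x. measure_pmf.prob (N x) S)"
proof -
  have "ennreal (measure_pmf.prob (bind_pmf M N) S) = (\<integral>\<^sup>+x. ennreal (measure_pmf.prob (N x) S) \<partial>M)"
    by (simp add: measure_pmf.emeasure_eq_measure[symmetric])
  also have "\<dots> = ennreal (measure_pmf.expectation M (\<lambda>x. measure_pmf.prob (N x) S))"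
    by (intro nn_integral_eq_integral integrable_measure_pmf_finite assms) auto
  finally show ?thesis
    by (simp add: integral_nonneg_AE)
qed

lemma expectation_mono_finite:
  fixes f g :: "'a \<Rightarrow> real"
  assumes "finite (set_pmf M)" "\<And>x. x \<in> set_pmf M \<Longrightarrow> f x \<le> g x"
  shows "measure_pmf.expectation M f \<le> measure_pmf.expectation M g"
  using assms by (intro integral_mono_AE integrable_measure_pmf_finite) (auto simp: AE_measure_pmf_iff)

lemma finite_set_Pi_pmf:
  assumes "finite I" "\<And>i. i \<in> I \<Longrightarrow> finite (set_pmf (p i))"
  shows "finite (set_pmf (Pi_pmf I d p))"
  using assms by (simp add: set_Pi_pmf finite_PiE_dflt)

section \<open>Talagrand's inequality\<close>

text \<open>Talagrand's convex distance from \<open>x\<close> to \<open>S\<close> is the least Euclidean norm of a vector in this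
  (upward closed) convex hull of the mismatch vectors.\<close>

inductive mismatch_hull :: "('a \<Rightarrow> 'b) set \<Rightarrow> ('a \<Rightarrow> 'b) \<Rightarrow> ('a \<Rightarrow> real) \<Rightarrow> bool"
  for S :: "('a \<Rightarrow> 'b) set" and x :: "'a \<Rightarrow> 'b" where
  base: "y \<in> S \<Longrightarrow> (\<And>i. of_bool (x i \<noteq> y i) \<le> v i) \<Longrightarrow> mismatch_hull S x v"
| mix: "mismatch_hull S x v \<Longrightarrow> mismatch_hull S x w \<Longrightarrow> 0 \<le> t \<Longrightarrow> t \<le> 1 \<Longrightarrow> mismatch_hull S x (\<lambda>i. t * v i + (1 - t) * w i)"

text \<open>A coordinate sum that is at least \<open>c\<close> on every mismatch vector stays so
  when coordinates grow and under convex combinations. Summing over a certificate, this bounds the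
  convex distance from below.\<close>

lemma mismatch_hull_sum_ge:
  assumes "mismatch_hull S x v" and "\<And>y. y \<in> S \<Longrightarrow> c \<le> (\<Sum>i\<in>I. of_bool (x i \<noteq> y i))"
  shows "c \<le> (\<Sum>i\<in>I. v i)"
  using assms(1)
proof induction
  case (base y v)
  have "c \<le> (\<Sum>i\<in>I. of_bool (x i \<noteq> y i))" using base assms(2) by blast
  also have "\<dots> \<le> (\<Sum>i\<in>I. v i)" using base by (intro sum_mono) auto
  finally show ?case .
next
  case (mix v w t)
  have "c = t * c + (1 - t) * c" by (simp add: algebra_simps)
  also have "\<dots> \<le> t * (\<Sum>i\<in>I. v i) + (1 - t) * (\<Sum>i\<in>I. w i)"
    using mix by (intro add_mono mult_left_mono) auto
  finally show ?case by (simp add: sum.distrib sum_distrib_left)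
qed

text \<open>First of two ways to reach \<open>S\<close> in the induction over coordinates: keep the
  value at \<open>j\<close>, at cost 0 there. The value \<open>d\<close> stands for the removed
  coordinate, since \<open>Pi_pmf\<close> over the smaller index set puts its default there.\<close>

lemma mismatch_hull_section:
  assumes "mismatch_hull {f. f(j := x j) \<in> S} (x(j := d)) v"
  shows "mismatch_hull S x (v(j := 0))"
  using assms
proof induction
  case (base y v)
  have "of_bool (x i \<noteq> (y(j := x j)) i) \<le> (v(j := 0)) i" for i
    using base(2)[of i] by (cases "i = j") auto
  then show ?case using base(1) by (intro mismatch_hull.base[of "y(j := x j)"]) auto
next
  case (mix v w t)
  have *: "(\<lambda>i. t * (v(j := 0)) i + (1 - t) * (w(j := 0)) i) = (\<lambda>i. t * v i + (1 - t) * w i)(j := 0)"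
    by auto
  show ?case using mismatch_hull.mix[OF mix(5,6,3,4)] unfolding * .
qed

text \<open>The second way: change the value at \<open>j\<close>, at cost 1, and in return aim at
  the larger projection of \<open>S\<close>.\<close>

lemma mismatch_hull_projection:
  assumes "mismatch_hull {f. \<exists>a. f(j := a) \<in> S} (x(j := d)) v"
  shows "mismatch_hull S x (v(j := 1))"
  using assms
proof induction
  case (base y v)
  then obtain a where "y(j := a) \<in> S" by blast
  moreover have "of_bool (x i \<noteq> (y(j := a)) i) \<le> (v(j := 1)) i" for i
    using base(2)[of i] by (cases "i = j") auto
  ultimately show ?case by (rule mismatch_hull.base)
next
  case (mix v w t)
  have *: "(\<lambda>i. t * (v(j := 1)) i + (1 - t) * (w(j := 1)) i) = (\<lambda>i. t * v i + (1 - t) * w i)(j := 1)"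
    by auto
  show ?case using mismatch_hull.mix[OF mix(5,6,3,4)] unfolding * .
qed

text \<open>The right-hand side vanishes at \<open>r = 1\<close> and is nonincreasing in
  \<open>r\<close>. It is what \<open>talagrand_weight\<close> requires, after taking logarithms,
  for the weight \<open>1 + 2 * ln r\<close>.\<close>

lemma two_minus_ln_ineq:
  fixes r :: real
  assumes "0 < r" "r \<le> 1"
  shows "0 \<le> ln (2 - r) + ln r + (ln r)\<^sup>2"
proof -
  define g where "g = (\<lambda>r::real. ln (2 - r) + ln r + (ln r)\<^sup>2)"
  have "g 1 \<le> g r"
  proof (rule DERIV_nonpos_imp_nonincreasing[OF assms(2)])
    fix s :: real assume s: "r \<le> s" "s \<le> 1"
    with assms have s0: "0 < s" by simp
    have "(g has_real_derivative (-1 / (2 - s) + 1 / s + 2 * ln s * (1 / s))) (at s)"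
      unfolding g_def using s s0 by (auto intro!: derivative_eq_intros simp: field_simps)
    moreover have "-1 / (2 - s) + 1 / s + 2 * ln s * (1 / s) \<le> 0"
    proof -
      have "ln s \<le> s - 1" using s0 by (rule ln_le_minus_one)
      also have "s - 1 \<le> (s - 1) / (2 - s)"
      proof -
        have "(s - 1) * (2 - s) \<le> s - 1" using s
          zero_le_square[of "s - 1"] by (simp add: algebra_simps)
        then show ?thesis using s by (simp add: pos_le_divide_eq)
      qed
      finally have "2 * ln s * (1 / s) \<le> 2 * ((s - 1) / (2 - s)) * (1 / s)"
        using s0 by (intro mult_right_mono mult_left_mono) auto
      also have "\<dots> = 1 / (2 - s) - 1 / s" using s s0 by (simp add: field_simps)
      finally show ?thesis by simp
    qed
    ultimately show "\<exists>y. (g has_real_derivative y) (at s) \<and> y \<le> 0" by blast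
  qed
  then show ?thesis by (simp add: g_def)
qed

text \<open>The optimal weight is \<open>1 + 2 ln r\<close>, as long as it is nonnegative.\<close>

lemma talagrand_weight:
  fixes r :: real
  assumes "0 \<le> r" "r \<le> 1"
  shows "\<exists>t. 0 \<le> t \<and> t \<le> 1 \<and> (r = 0 \<longrightarrow> t = 0) \<and> exp ((1 - t)\<^sup>2 / 4 - t * ln r) \<le> 2 - r"
proof (cases "exp (-1/2) \<le> r")
  case True
  have r0: "0 < r" using True by (meson exp_gt_zero less_le_trans)
  have ln: "-1/2 \<le> ln r" using True r0 by (simp add: ln_ge_iff)
  have "(1 - (1 + 2 * ln r))\<^sup>2 / 4 - (1 + 2 * ln r) * ln r = - ln r - (ln r)\<^sup>2"
    by (simp add: power2_eq_square algebra_simps)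
  also have "\<dots> \<le> ln (2 - r)" using two_minus_ln_ineq[OF r0 assms(2)] by simp
  finally have "exp ((1 - (1 + 2 * ln r))\<^sup>2 / 4 - (1 + 2 * ln r) * ln r) \<le> 2 - r"
    using assms by (simp add: ln_ge_iff[symmetric])
  then show ?thesis using ln r0 assms by (intro exI[of _ "1 + 2 * ln r"]) auto
next
  case False
  \<comment> \<open>Below \<open>exp (-1/2)\<close> the optimal weight would be negative. With
    weight 0 the claim is \<open>exp (1/4) \<le> 2 - r\<close>, and 1.3125 is less than 2 -
    8/13.\<close>
  have "exp (1/4::real) \<le> 1 + 1/4 + (1/4)\<^sup>2" by (rule exp_bound) auto
  moreover have "1 + 1/2 + (1/2)\<^sup>2/2 \<le> exp (1/2::real)" by (rule exp_lower_Taylor_quadratic) auto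
  then have "exp (-1/2::real) \<le> 8/13" by (simp add: exp_minus field_simps power2_eq_square)
  ultimately have "exp (1/4) \<le> 2 - r" using False by (simp add: power2_eq_square)
  then show ?thesis by (intro exI[of _ 0]) auto
qed

lemma square_mix_le:
  fixes a b t :: real
  assumes "0 \<le> t" "t \<le> 1"
  shows "(t * a + (1 - t) * b)\<^sup>2 \<le> t * a\<^sup>2 + (1 - t) * b\<^sup>2"
proof -
  have "t * a\<^sup>2 + (1 - t) * b\<^sup>2 - (t * a + (1 - t) * b)\<^sup>2 = t * (1 - t) * (a - b)\<^sup>2"
    by (simp add: power2_eq_square algebra_simps)
  moreover have "0 \<le> t * (1 - t) * (a - b)\<^sup>2" using assms by simp
  ultimately show ?thesis by linarith
qed

lemma exp_mix_le:
  fixes a b t :: real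
  assumes "0 \<le> t" "t \<le> 1"
  shows "exp (t * a + (1 - t) * b) \<le> t * exp a + (1 - t) * exp b"
  using assms convex_onD[OF exp_convex, of "1 - t" a b] by simp

text \<open>Induction on the coordinates; an explicit \<open>w x\<close> replaces a minimiser of the
  norm over the hull. With \<open>a = x j\<close> it mixes a vector for the section
  \<open>SA a\<close> and one for the projection \<open>SB\<close>, with a weight that depends on
  \<open>r a / b\<close> as in \<open>talagrand_weight\<close>. Averaging over \<open>a\<close>
  leaves (2 - y) y \<le> 1 for y = s / b.\<close>

lemma talagrand:
  assumes "finite I" "\<And>i. i \<in> I \<Longrightarrow> finite (set_pmf (p i))"
    and "measure_pmf.prob (Pi_pmf I d p) S > 0"
  shows "\<exists>w. (\<forall>x. mismatch_hull S x (w x)) \<and>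
    measure_pmf.expectation (Pi_pmf I d p) (\<lambda>x. exp ((\<Sum>i\<in>I. (w x i)\<^sup>2) / 4)) *
      measure_pmf.prob (Pi_pmf I d p) S \<le> 1"
  using assms
proof (induction I arbitrary: S rule: finite_induct)
  case empty
  then have "(\<lambda>_. d) \<in> S" by (auto simp: indicator_def split: if_splits)
  then have "mismatch_hull S x (\<lambda>_. 1)" for x by (rule mismatch_hull.base) auto
  then show ?case by (intro exI[of _ "\<lambda>_ _. 1"]) auto
next
  case (insert j I)
  define Q where "Q = Pi_pmf I d p"
  define SA where "SA a = {f. f(j := a) \<in> S}" for a
  define SB where "SB = {f. \<exists>a. f(j := a) \<in> S}"
  define r where "r a = measure_pmf.prob Q (SA a)" for a
  define b where "b = measure_pmf.prob Q SB"
  have finQ: "finite (set_pmf Q)" unfolding Q_def using insert by (intro finite_set_Pi_pmf) auto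
  have finp: "finite (set_pmf (p j))" using insert by auto
  have P: "Pi_pmf (insert j I) d p = bind_pmf (p j) (\<lambda>a. map_pmf (\<lambda>f. f(j := a)) Q)"
    unfolding Q_def using insert by (simp add: Pi_pmf_insert' map_pmf_def)
  have rb: "r a \<le> b" for a
    unfolding r_def b_def by (rule measure_pmf.finite_measure_mono) (auto simp: SA_def SB_def)
  have prS: "measure_pmf.prob (Pi_pmf (insert j I) d p) S = measure_pmf.expectation (p j) r"
    unfolding P by (subst prob_bind_finite[OF finp]) (simp add: r_def[abs_def] SA_def vimage_def)
  have r_nonneg: "0 \<le> r a" for a by (simp add: r_def)
  have b_pos: "0 < b"
  proof (rule ccontr)
    assume "\<not> 0 < b"
    then have "r a = 0" for a using rb[of a] r_nonneg[of a] by linarith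
    then have "r = (\<lambda>_. 0)" by (intro ext)
    then show False using insert.prems(2) by (simp add: prS)
  qed
  have IH: "measure_pmf.prob Q X > 0 \<Longrightarrow> \<exists>w. (\<forall>x. mismatch_hull X x (w x)) \<and>
    measure_pmf.expectation Q (\<lambda>x. exp ((\<Sum>i\<in>I. (w x i)\<^sup>2) / 4)) * measure_pmf.prob Q X \<le> 1" for X
    unfolding Q_def by (rule insert.IH) (use insert.prems in auto)
  obtain wB where wB: "\<And>x. mismatch_hull SB x (wB x)"
    "measure_pmf.expectation Q (\<lambda>x. exp ((\<Sum>i\<in>I. (wB x i)\<^sup>2) / 4)) * b \<le> 1"
    using IH[of SB] b_pos unfolding b_def by blast
  have "\<forall>a. \<exists>w. r a > 0 \<longrightarrow> (\<forall>x. mismatch_hull (SA a) x (w x)) \<and>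
      measure_pmf.expectation Q (\<lambda>x. exp ((\<Sum>i\<in>I. (w x i)\<^sup>2) / 4)) * r a \<le> 1"
    using IH[of "SA _"] unfolding r_def by blast
  then obtain wA where wA: "\<And>a x. r a > 0 \<Longrightarrow> mismatch_hull (SA a) x (wA a x)"
    "\<And>a. r a > 0 \<Longrightarrow> measure_pmf.expectation Q (\<lambda>x. exp ((\<Sum>i\<in>I. (wA a x i)\<^sup>2) / 4)) * r a \<le> 1"
    by metis
  have "\<forall>a. \<exists>t. 0 \<le> t \<and> t \<le> 1 \<and> (r a / b = 0 \<longrightarrow> t = 0) \<and>
      exp ((1 - t)\<^sup>2 / 4 - t * ln (r a / b)) \<le> 2 - r a / b"
    using rb r_nonneg b_pos by (intro allI talagrand_weight) auto
  then obtain t where t: "\<And>a. 0 \<le> t a" "\<And>a. t a \<le> 1" "\<And>a. r a / b = 0 \<Longrightarrow> t a = 0"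
      "\<And>a. exp ((1 - t a)\<^sup>2 / 4 - t a * ln (r a / b)) \<le> 2 - r a / b"
    by metis
  \<comment> \<open>\<open>x(j := d)\<close> recovers the draw of \<open>Q\<close>, whose coordinate
    \<open>j\<close> carries the default value \<open>d\<close>.\<close>
  define w where "w x = (let a = x j; f = x(j := d) in
     (\<lambda>i. t a * ((wA a f)(j := 0)) i + (1 - t a) * ((wB f)(j := 1)) i))" for x
  have hullw: "mismatch_hull S x (w x)" for x
  proof -
    have hB: "mismatch_hull S x ((wB (x(j := d)))(j := 1))"
      by (rule mismatch_hull_projection[where d = d]) (use wB(1) in \<open>simp add: SB_def\<close>)
    show ?thesis
    proof (cases "r (x j) > 0")
      case True
      have "mismatch_hull S x ((wA (x j) (x(j := d)))(j := 0))"
        by (rule mismatch_hull_section[where d = d]) (use wA(1)[OF True] in \<open>simp add: SA_def\<close>)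
      then show ?thesis unfolding w_def Let_def using mismatch_hull.mix[OF _ hB t(1,2)] by blast
    next
      case False
      \<comment> \<open>A null section supplies no hull vector; this is why
        \<open>talagrand_weight\<close> forces the weight 0 at ratio 0.\<close>
      then have "t (x j) = 0" using r_nonneg[of "x j"] t(3) by simp
      then have "w x = (wB (x(j := d)))(j := 1)" by (simp add: w_def Let_def fun_eq_iff)
      then show ?thesis using hB by (simp only:)
    qed
  qed
  have outside: "f j = d" if "f \<in> set_pmf Q" for f
    using that insert.hyps subsetD[OF set_Pi_pmf_subset[OF insert.hyps(1)], of f d p] unfolding Q_def by simp
  have sum_le: "(\<Sum>i\<in>insert j I. (w (f(j := a)) i)\<^sup>2) \<le>
      (1 - t a)\<^sup>2 + t a * (\<Sum>i\<in>I. (wA a f i)\<^sup>2) + (1 - t a) * (\<Sum>i\<in>I. (wB f i)\<^sup>2)"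
    if "f j = d" for f a
  proof -
    have f: "f(j := d) = f" using that by auto
    have "(\<Sum>i\<in>insert j I. (w (f(j := a)) i)\<^sup>2) =
        (1 - t a)\<^sup>2 + (\<Sum>i\<in>I. (t a * wA a f i + (1 - t a) * wB f i)\<^sup>2)"
      using insert.hyps f by (auto simp: w_def Let_def intro!: sum.cong)
    also have "(\<Sum>i\<in>I. (t a * wA a f i + (1 - t a) * wB f i)\<^sup>2) \<le>
       (\<Sum>i\<in>I. t a * (wA a f i)\<^sup>2 + (1 - t a) * (wB f i)\<^sup>2)"
      using t by (intro sum_mono square_mix_le) auto
    finally show ?thesis by (simp add: sum.distrib sum_distrib_left)
  qed
  have E_le: "measure_pmf.expectation Q (\<lambda>f. exp ((\<Sum>i\<in>insert j I. (w (f(j := a)) i)\<^sup>2) / 4))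
      \<le> (2 - r a / b) / b" for a
  proof -
    define X where "X f = (\<Sum>i\<in>I. (wA a f i)\<^sup>2) / 4" for f
    define Y where "Y f = (\<Sum>i\<in>I. (wB f i)\<^sup>2) / 4" for f
    define c where "c = exp ((1 - t a)\<^sup>2 / 4 - t a * ln (r a / b))"
    have pt: "exp ((\<Sum>i\<in>insert j I. (w (f(j := a)) i)\<^sup>2) / 4)
       \<le> c / b * (t a * (r a * exp (X f)) + (1 - t a) * (b * exp (Y f)))" if "f \<in> set_pmf Q" for f
    proof -
      have "exp ((\<Sum>i\<in>insert j I. (w (f(j := a)) i)\<^sup>2) / 4) \<le>
            exp ((1 - t a)\<^sup>2 / 4 + (t a * X f + (1 - t a) * Y f))"
        using sum_le[of f a] outside[OF that] by (simp add: X_def Y_def field_simps)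
      also have "\<dots> \<le> c / b * (t a * (r a * exp (X f)) + (1 - t a) * (b * exp (Y f)))"
      proof (cases "r a = 0")
        case True
        then have "t a = 0" using t(3) by simp
        then show ?thesis using b_pos True by (simp add: c_def exp_add)
      next
        case False
        then have r0: "r a > 0" using r_nonneg[of a] by simp
        \<comment> \<open>Hoelder's inequality in pointwise form: weighted arithmetic and geometric
          means of \<open>r a * exp (X f)\<close> and \<open>b * exp (Y f)\<close>, both of which
          have expectation at most 1 by induction.\<close>
        have "exp ((1 - t a)\<^sup>2 / 4 + (t a * X f + (1 - t a) * Y f)) =
           c * exp (- ln b) * exp (t a * (ln (r a) + X f) + (1 - t a) * (ln b + Y f))"
          using r0 b_pos by (simp add: c_def exp_add[symmetric] ln_div algebra_simps)
        also have "\<dots> \<le> c * exp (- ln b) * (t a * exp (ln (r a) + X f) + (1 - t a) * exp (ln b + Y f))"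
          using t by (intro mult_left_mono exp_mix_le) (auto simp: c_def)
        also have "\<dots> = c / b * (t a * (r a * exp (X f)) + (1 - t a) * (b * exp (Y f)))"
          using r0 b_pos by (simp add: exp_add exp_minus field_simps)
        finally show ?thesis .
      qed
      finally show ?thesis .
    qed
    have int: "integrable (measure_pmf Q) h" for h :: "_ \<Rightarrow> real"
      using finQ by (rule integrable_measure_pmf_finite)
    have "measure_pmf.expectation Q (\<lambda>f. exp ((\<Sum>i\<in>insert j I. (w (f(j := a)) i)\<^sup>2) / 4))
       \<le> measure_pmf.expectation Q (\<lambda>f. c / b * (t a * (r a * exp (X f)) + (1 - t a) * (b * exp (Y f))))"
      using finQ pt by (rule expectation_mono_finite)
    also have "\<dots> = c / b * (t a * (measure_pmf.expectation Q (\<lambda>f. exp (X f)) * r a) +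
          (1 - t a) * (measure_pmf.expectation Q (\<lambda>f. exp (Y f)) * b))"
      by (subst integral_mult_right_zero, subst Bochner_Integration.integral_add[OF int int]) (simp add: mult_ac)
    also have "\<dots> \<le> c / b * (t a * 1 + (1 - t a) * 1)"
    proof -
      have "t a * (measure_pmf.expectation Q (\<lambda>f. exp (X f)) * r a) \<le> t a * 1"
      proof (cases "r a > 0")
        case True then show ?thesis using wA(2)[OF True] t by (intro mult_left_mono) (auto simp: X_def)
      next
        case False then show ?thesis using r_nonneg[of a] t(3) t(1)[of a] by simp
      qed
      moreover have "(1 - t a) * (measure_pmf.expectation Q (\<lambda>f. exp (Y f)) * b) \<le> (1 - t a) * 1"
        using wB(2) t by (intro mult_left_mono) (auto simp: Y_def)
      moreover have "0 \<le> c / b" using b_pos by (simp add: c_def)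
      ultimately show ?thesis by (intro mult_left_mono[OF add_mono])
    qed
    also have "\<dots> \<le> (2 - r a / b) / b" using t(4)[of a] b_pos by (simp add: c_def divide_right_mono)
    finally show ?thesis .
  qed
  define s where "s = measure_pmf.prob (Pi_pmf (insert j I) d p) S"
  have "measure_pmf.expectation (Pi_pmf (insert j I) d p) (\<lambda>x. exp ((\<Sum>i\<in>insert j I. (w x i)\<^sup>2) / 4))
     = measure_pmf.expectation (p j) (\<lambda>a. measure_pmf.expectation Q (\<lambda>f. exp ((\<Sum>i\<in>insert j I. (w (f(j := a)) i)\<^sup>2) / 4)))"
    unfolding P using finQ finp by (subst expectation_bind_finite) auto
  also have "\<dots> \<le> measure_pmf.expectation (p j) (\<lambda>a. (2 - r a / b) / b)"
    using finp E_le by (rule expectation_mono_finite)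
  also have "\<dots> = (2 - s / b) / b"
  proof -
    have int: "integrable (measure_pmf (p j)) h" for h :: "_ \<Rightarrow> real"
      using finp by (rule integrable_measure_pmf_finite)
    have "measure_pmf.expectation (p j) (\<lambda>a. 2 - r a / b) = 2 - measure_pmf.expectation (p j) r / b"
      by (subst Bochner_Integration.integral_diff[OF int int]) simp
    then show ?thesis unfolding s_def prS by simp
  qed
  finally have "measure_pmf.expectation (Pi_pmf (insert j I) d p) (\<lambda>x. exp ((\<Sum>i\<in>insert j I. (w x i)\<^sup>2) / 4)) * s
     \<le> (2 - s / b) / b * s"
    by (intro mult_right_mono) (auto simp: s_def)
  also have "\<dots> = 1 - (1 - s / b)\<^sup>2" using b_pos by (simp add: field_simps power2_eq_square)
  also have "\<dots> \<le> 1" by simp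
  finally show ?case using hullw unfolding s_def by blast
qed

text \<open>On the certificate \<open>J\<close> every hull vector sums to at least \<open>c\<close>,
  so by Cauchy-Schwarz its squared norm is at least c^2 / D. Markov's inequality for the exponential
  moment of \<open>talagrand\<close> then gives the product bound.\<close>

lemma talagrand_certifiable:
  assumes "finite I" "\<And>i. i \<in> I \<Longrightarrow> finite (set_pmf (p i))" and "c > 0" "D > 0"
    and cert: "\<And>x. x \<in> T \<Longrightarrow> \<exists>J\<subseteq>I. real (card J) \<le> D \<and> (\<forall>y\<in>S. c \<le> (\<Sum>i\<in>J. of_bool (x i \<noteq> y i)))"
  shows "measure_pmf.prob (Pi_pmf I d p) T * measure_pmf.prob (Pi_pmf I d p) S \<le> exp (- c\<^sup>2 / (4 * D))"
proof (cases "measure_pmf.prob (Pi_pmf I d p) S > 0")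
  case False
  then have "measure_pmf.prob (Pi_pmf I d p) S = 0" by (simp add: zero_less_measure_iff)
  then show ?thesis by simp
next
  case True
  define P where "P = Pi_pmf I d p"
  have fin: "finite (set_pmf P)" unfolding P_def using assms by (intro finite_set_Pi_pmf) auto
  have "\<exists>w. (\<forall>x. mismatch_hull S x (w x)) \<and>
    measure_pmf.expectation P (\<lambda>x. exp ((\<Sum>i\<in>I. (w x i)\<^sup>2) / 4)) * measure_pmf.prob P S \<le> 1"
    unfolding P_def by (rule talagrand) (use assms True in auto)
  then obtain w where w: "\<forall>x. mismatch_hull S x (w x)"
    "measure_pmf.expectation P (\<lambda>x. exp ((\<Sum>i\<in>I. (w x i)\<^sup>2) / 4)) * measure_pmf.prob P S \<le> 1"
    by (elim exE conjE)
  have lower: "c\<^sup>2 / D \<le> (\<Sum>i\<in>I. (w x i)\<^sup>2)" if xT: "x \<in> T" for x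
  proof -
    from cert[OF xT] obtain J where J: "J \<subseteq> I" "real (card J) \<le> D"
      "\<forall>y\<in>S. c \<le> (\<Sum>i\<in>J. of_bool (x i \<noteq> y i))"
      by (elim exE conjE)
    have "c \<le> (\<Sum>i\<in>J. w x i)"
      by (rule mismatch_hull_sum_ge[OF w(1)[THEN spec]]) (use J(3) in simp)
    then have "c\<^sup>2 \<le> (\<Sum>i\<in>J. w x i * 1)\<^sup>2" using assms(3) by (simp add: power_mono)
    also have "\<dots> \<le> (\<Sum>i\<in>J. (w x i)\<^sup>2) * (\<Sum>i\<in>J. 1\<^sup>2)" by (rule Cauchy_Schwarz_ineq_sum)
    also have "\<dots> \<le> (\<Sum>i\<in>J. (w x i)\<^sup>2) * D" using J(2) by (intro mult_left_mono sum_nonneg) auto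
    also have "\<dots> \<le> (\<Sum>i\<in>I. (w x i)\<^sup>2) * D"
      using J(1) assms by (intro mult_right_mono sum_mono2) auto
    finally show ?thesis using assms(4) by (simp add: pos_divide_le_eq)
  qed
  have "exp (c\<^sup>2 / (4 * D)) * measure_pmf.prob P T = measure_pmf.expectation P (\<lambda>x. exp (c\<^sup>2 / (4 * D)) * indicator T x)"
    by simp
  also have "\<dots> \<le> measure_pmf.expectation P (\<lambda>x. exp ((\<Sum>i\<in>I. (w x i)\<^sup>2) / 4))"
    using lower by (intro expectation_mono_finite[OF fin]) (auto simp: indicator_def field_simps)
  finally have "exp (c\<^sup>2 / (4 * D)) * measure_pmf.prob P T * measure_pmf.prob P S \<le> 1"
    using w(2) by (meson measure_nonneg mult_right_mono order_trans)
  then show ?thesis by (simp add: exp_minus field_simps P_def)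
qed

section \<open>Concentration of the repetition-free matching number\<close>

text \<open>The sets that \<open>R\<close> maximises over, read off the words instead of the kept
  graph. Being a matching is contained in the strict inequalities of
  \<open>noncrossing\<close>.\<close>

definition rfm :: "nat \<Rightarrow> (vertex \<Rightarrow> nat) \<Rightarrow> (nat \<times> nat) set \<Rightarrow> bool" where
  "rfm n \<sigma> M \<longleftrightarrow> M \<subseteq> {1..n} \<times> {1..n} \<and> (\<forall>e\<in>M. \<sigma> (A (fst e)) = \<sigma> (B (snd e))) \<and> noncrossing M \<and>
     inj_on (\<lambda>e. \<sigma> (A (fst e))) M"

lemma noncrossing_subset: "noncrossing M \<Longrightarrow> M' \<subseteq> M \<Longrightarrow> noncrossing M'"
  unfolding noncrossing_def by (rule pairwise_subset)

lemma noncrossingD: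
  assumes "noncrossing M" "e \<in> M" "e' \<in> M" "e \<noteq> e'"
  shows "(fst e < fst e' \<and> snd e < snd e') \<or> (fst e' < fst e \<and> snd e' < snd e)"
  using pairwiseD[OF assms(1)[unfolded noncrossing_def] assms(2-4)] by (simp add: case_prod_beta)

lemma noncrossingI:
  assumes "\<And>e e'. e \<in> M \<Longrightarrow> e' \<in> M \<Longrightarrow> e \<noteq> e' \<Longrightarrow>
    (fst e < fst e' \<and> snd e < snd e') \<or> (fst e' < fst e \<and> snd e' < snd e)"
  shows "noncrossing M"
  unfolding noncrossing_def by (rule pairwiseI) (use assms in \<open>simp add: case_prod_beta\<close>)

lemma noncrossing_matching:
  assumes "noncrossing M"
  shows "matching M"
  unfolding matching_def
proof (rule pairwiseI)
  fix e e' assume "e \<in> M" "e' \<in> M" "e \<noteq> e'"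
  then show "fst e \<noteq> fst e' \<and> snd e \<noteq> snd e'" using noncrossingD[OF assms, of e e'] by auto
qed

lemma rfm_subset:
  assumes "rfm n \<sigma> M" "M' \<subseteq> M"
  shows "rfm n \<sigma> M'"
  unfolding rfm_def
proof (intro conjI)
  show "M' \<subseteq> {1..n} \<times> {1..n}" "\<forall>e\<in>M'. \<sigma> (A (fst e)) = \<sigma> (B (snd e))"
    using assms unfolding rfm_def by blast+
  show "noncrossing M'" using assms noncrossing_subset unfolding rfm_def by metis
  show "inj_on (\<lambda>e. \<sigma> (A (fst e))) M'" using assms inj_on_subset unfolding rfm_def by metis
qed

lemma rfm_finite:
  assumes "rfm n \<sigma> M"
  shows "finite M"
proof (rule finite_subset)
  show "M \<subseteq> {1..n} \<times> {1..n}" using assms unfolding rfm_def by metis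
qed simp

lemma rfm_iff:
  "M \<subseteq> dom (kept_edges n \<sigma>) \<and> matching M \<and> noncrossing M \<and> repetition_free (kept_edges n \<sigma>) M \<longleftrightarrow> rfm n \<sigma> M"
proof -
  have dom: "dom (kept_edges n \<sigma>) = {e \<in> {1..n} \<times> {1..n}. \<sigma> (A (fst e)) = \<sigma> (B (snd e))}"
    by (auto simp: kept_edges_def dom_def split: if_splits)
  have rep: "repetition_free (kept_edges n \<sigma>) M \<longleftrightarrow> inj_on (\<lambda>e. \<sigma> (A (fst e))) M"
    if "M \<subseteq> dom (kept_edges n \<sigma>)"
  proof -
    have "kept_edges n \<sigma> e = Some (\<sigma> (A (fst e)))" if "e \<in> M" for e
      using that \<open>M \<subseteq> _\<close> unfolding dom by (cases e) (auto simp: kept_edges_def)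
    then show ?thesis by (auto simp: repetition_free_def inj_on_def pairwise_def)
  qed
  have sub: "M \<subseteq> dom (kept_edges n \<sigma>) \<longleftrightarrow>
      M \<subseteq> {1..n} \<times> {1..n} \<and> (\<forall>e\<in>M. \<sigma> (A (fst e)) = \<sigma> (B (snd e)))"
    unfolding dom by (simp add: subset_iff Ball_def) metis
  show ?thesis unfolding rfm_def using noncrossing_matching[of M] rep sub by metis
qed

lemma R_alt: "R (kept_edges n \<sigma>) = Max {card M | M. rfm n \<sigma> M}"
  unfolding R_def rfm_iff ..

lemma finite_rfm: "finite {card M | M. rfm n \<sigma> M}"
proof -
  have "{card M | M. rfm n \<sigma> M} \<subseteq> card ` Pow ({1..n} \<times> {1..n})" unfolding rfm_def by blast
  then show ?thesis by (rule finite_subset) simp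
qed

lemma card_rfm_le: "rfm n \<sigma> M \<Longrightarrow> card M \<le> R (kept_edges n \<sigma>)"
  unfolding R_alt by (intro Max_ge finite_rfm) auto

lemma R_attained: "\<exists>M. rfm n \<sigma> M \<and> card M = R (kept_edges n \<sigma>)"
proof -
  have "rfm n \<sigma> {}" by (simp add: rfm_def noncrossing_def)
  then have "Max {card M | M. rfm n \<sigma> M} \<in> {card M | M. rfm n \<sigma> M}"
    by (intro Max_in finite_rfm) auto
  then show ?thesis unfolding R_alt by force
qed

text \<open>\<open>J\<close> consists of the endpoints of \<open>b\<close> edges of an optimal
  matching for \<open>x\<close>. The edges with unchanged endpoints remain valid for
  \<open>y\<close>. Each lost edge has a changed endpoint, and edges of a matching share no
  endpoints, so the lost edges inject into the changed positions of \<open>J\<close>.\<close>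

lemma R_certificate:
  assumes "b \<le> R (kept_edges n x)"
  shows "\<exists>J\<subseteq>Knn_vertices n. card J \<le> 2 * b \<and>
    (\<forall>y. real b - real (R (kept_edges n y)) \<le> (\<Sum>i\<in>J. of_bool (x i \<noteq> y i)))"
proof -
  obtain M0 where M0: "rfm n x M0" "card M0 = R (kept_edges n x)" using R_attained by blast
  then obtain M where "M \<subseteq> M0" and b: "card M = b" using assms obtain_subset_with_card_n by metis
  then have M: "rfm n x M" using M0 rfm_subset by blast
  have finM: "finite M" using M by (rule rfm_finite)
  have match: "matching M" using M noncrossing_matching by (simp add: rfm_def)
  define J where "J = A ` fst ` M \<union> B ` snd ` M"
  have "card J \<le> card (A ` fst ` M) + card (B ` snd ` M)" unfolding J_def by (rule card_Un_le)
  also have "\<dots> \<le> card (fst ` M) + card (snd ` M)"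
    using finM by (intro add_mono card_image_le) auto
  also have "\<dots> \<le> card M + card M" using finM by (intro add_mono card_image_le)
  finally have "card J \<le> card M + card M" .
  moreover have "J \<subseteq> Knn_vertices n" using M by (auto simp: J_def rfm_def Knn_vertices_def)
  moreover have "real b - real (R (kept_edges n y)) \<le> (\<Sum>i\<in>J. of_bool (x i \<noteq> y i))" for y
  proof -
    define G where "G = {e \<in> M. x (A (fst e)) = y (A (fst e)) \<and> x (B (snd e)) = y (B (snd e))}"
    have GM: "G \<subseteq> M" by (auto simp: G_def)
    have "rfm n x G" using M GM by (rule rfm_subset)
    moreover have "inj_on (\<lambda>e. y (A (fst e))) G \<longleftrightarrow> inj_on (\<lambda>e. x (A (fst e))) G"
      by (rule inj_on_cong) (auto simp: G_def)
    ultimately have "rfm n y G" by (auto simp: rfm_def G_def)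
    then have G_le: "card G \<le> R (kept_edges n y)" by (rule card_rfm_le)
    define h where "h e = (if x (A (fst e)) \<noteq> y (A (fst e)) then A (fst e) else B (snd e))" for e
    have "inj_on h (M - G)"
      using match by (auto simp: inj_on_def h_def matching_def pairwise_def split: if_splits)
    moreover have "h ` (M - G) \<subseteq> {i \<in> J. x i \<noteq> y i}" by (auto simp: h_def J_def G_def)
    moreover have "finite J" using finM by (simp add: J_def)
    ultimately have "card (M - G) \<le> card {i \<in> J. x i \<noteq> y i}" by (intro card_inj_on_le[of h]) auto
    also have "real (card {i \<in> J. x i \<noteq> y i}) = (\<Sum>i\<in>J. of_bool (x i \<noteq> y i))"
      using \<open>finite J\<close> by (simp add: Int_def)
    finally have "real (card (M - G)) \<le> (\<Sum>i\<in>J. of_bool (x i \<noteq> y i))" by simp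
    moreover have "card (M - G) = b - card G" "card G \<le> b"
      using GM finM b by (auto simp: card_Diff_subset finite_subset intro: card_mono)
    ultimately show ?thesis using G_le by (simp add: of_nat_diff)
  qed
  ultimately show ?thesis using b by (intro exI[of _ J]) auto
qed

abbreviation words :: "nat \<Rightarrow> vertex set \<Rightarrow> (vertex \<Rightarrow> nat) pmf" where
  "words k V \<equiv> Pi_pmf V 0 (\<lambda>_. pmf_of_set {1..k})"

text \<open>The 8 is the 4 of Talagrand's inequality times the two endpoints per certified
  edge.\<close>

lemma R_concentration:
  assumes "k > 0" "a < real b"
  shows "measure_pmf.prob (words k (Knn_vertices n)) {\<sigma>. b \<le> R (kept_edges n \<sigma>)} *
    measure_pmf.prob (words k (Knn_vertices n)) {\<sigma>. real (R (kept_edges n \<sigma>)) \<le> a}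
    \<le> exp (- (real b - a)\<^sup>2 / (8 * real b))"
proof (cases "b = 0")
  case True
  \<comment> \<open>The exponent divides by 0 here, hence is 0, and the bound is 1.\<close>
  then show ?thesis by (auto intro!: mult_le_one)
next
  case False
  have "measure_pmf.prob (words k (Knn_vertices n)) {\<sigma>. b \<le> R (kept_edges n \<sigma>)} *
    measure_pmf.prob (words k (Knn_vertices n)) {\<sigma>. real (R (kept_edges n \<sigma>)) \<le> a}
    \<le> exp (- (real b - a)\<^sup>2 / (4 * (2 * real b)))"
  proof (rule talagrand_certifiable)
    fix x assume "x \<in> {\<sigma>. b \<le> R (kept_edges n \<sigma>)}"
    then obtain J where J: "J \<subseteq> Knn_vertices n" "card J \<le> 2 * b"
      "\<And>y. real b - real (R (kept_edges n y)) \<le> (\<Sum>i\<in>J. of_bool (x i \<noteq> y i))"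
      using R_certificate by (metis mem_Collect_eq)
    moreover have "real b - a \<le> (\<Sum>i\<in>J. of_bool (x i \<noteq> y i))"
      if "real (R (kept_edges n y)) \<le> a" for y using that J(3)[of y] by linarith
    ultimately show "\<exists>J\<subseteq>Knn_vertices n. real (card J) \<le> 2 * real b \<and>
      (\<forall>y\<in>{\<sigma>. real (R (kept_edges n \<sigma>)) \<le> a}. real b - a \<le> (\<Sum>i\<in>J. of_bool (x i \<noteq> y i)))"
      by (intro exI[of _ J]) auto
  qed (use assms False in \<open>auto simp: Knn_vertices_def\<close>)
  then show ?thesis by simp
qed

section \<open>Last-passage growth with boundary sources\<close>

text \<open>Longest path that first collects sources \<open>x\<close> along the horizontal axis or
  sinks \<open>y\<close> along the vertical one, and then points increasing strictly in both
  coordinates. The cell (i, j) carries the weight \<open>w j i\<close>, row index first, so that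
  \<open>w j\<close> is a row.\<close>

fun lpp :: "(nat \<Rightarrow> bool) \<Rightarrow> (nat \<Rightarrow> bool) \<Rightarrow> (nat \<Rightarrow> nat \<Rightarrow> bool) \<Rightarrow> nat \<Rightarrow> nat \<Rightarrow> nat" where
  "lpp x y w 0 j = (\<Sum>l<j. of_bool (y l))"
| "lpp x y w (Suc i) 0 = (\<Sum>l<Suc i. of_bool (x l))"
| "lpp x y w (Suc i) (Suc j) =
     max (max (lpp x y w i (Suc j)) (lpp x y w (Suc i) j)) (lpp x y w i j + of_bool (w j i))"

definition points :: "(nat \<Rightarrow> nat \<Rightarrow> bool) \<Rightarrow> nat \<Rightarrow> nat \<Rightarrow> (nat \<times> nat) set" where
  "points w m n = {(i, j). i < m \<and> j < n \<and> w j i}"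

lemma lpp_bottom: "lpp x y w i 0 = (\<Sum>l<i. of_bool (x l))"
  by (cases i) auto

lemma points_mono: "m \<le> m' \<Longrightarrow> n \<le> n' \<Longrightarrow> points w m n \<subseteq> points w m' n'"
  by (auto simp: points_def)

lemma finite_points [simp]: "finite (points w m n)"
  by (rule finite_subset[of _ "{..<m} \<times> {..<n}"]) (auto simp: points_def)

lemma noncrossing_insert:
  assumes "noncrossing C" "\<And>e. e \<in> C \<Longrightarrow> fst e < i \<and> snd e < j"
  shows "noncrossing (insert (i, j) C)"
proof (rule noncrossingI)
  fix e e' assume "e \<in> insert (i, j) C" "e' \<in> insert (i, j) C" "e \<noteq> e'"
  then show "(fst e < fst e' \<and> snd e < snd e') \<or> (fst e' < fst e \<and> snd e' < snd e)"
    using noncrossingD[OF assms(1), of e e'] assms(2)[of e] assms(2)[of e'] by auto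
qed

text \<open>Reading the recursion backwards yields an optimal path. Its exit point \<open>z\<close>
  from the axis is recorded because the lower bound for chains depends on where optimal paths leave
  the boundary.\<close>

lemma lpp_path:
  "\<exists>C z. C \<subseteq> points w i j \<and> noncrossing C \<and>
     (z \<le> i \<and> (\<forall>e\<in>C. z \<le> fst e) \<and> lpp x y w i j = (\<Sum>l<z. of_bool (x l)) + card C \<or>
      z \<le> j \<and> (\<forall>e\<in>C. z \<le> snd e) \<and> lpp x y w i j = (\<Sum>l<z. of_bool (y l)) + card C)"
proof (induction x y w i j rule: lpp.induct)
  case (1 x y w j)
  show ?case by (rule exI[of _ "{}"], rule exI[of _ j]) (auto simp: noncrossing_def)
next
  case (2 x y w i)
  show ?case by (rule exI[of _ "{}"], rule exI[of _ "Suc i"]) (auto simp: noncrossing_def)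
next
  case (3 x y w i j)
  have "lpp x y w (Suc i) (Suc j) = lpp x y w i (Suc j) \<or>
      lpp x y w (Suc i) (Suc j) = lpp x y w (Suc i) j \<or>
      lpp x y w (Suc i) (Suc j) = lpp x y w i j \<or>
      lpp x y w (Suc i) (Suc j) = Suc (lpp x y w i j) \<and> w j i"
    by (cases "w j i") (simp_all add: max_def)
  then consider "lpp x y w (Suc i) (Suc j) = lpp x y w i (Suc j)"
    | "lpp x y w (Suc i) (Suc j) = lpp x y w (Suc i) j"
    | "lpp x y w (Suc i) (Suc j) = lpp x y w i j"
    | "lpp x y w (Suc i) (Suc j) = Suc (lpp x y w i j)" "w j i"
    by blast
  then show ?case
  proof cases
    case 1
    from 3(1) obtain C z where "C \<subseteq> points w i (Suc j)" "noncrossing C"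
      "z \<le> i \<and> (\<forall>e\<in>C. z \<le> fst e) \<and> lpp x y w i (Suc j) = (\<Sum>l<z. of_bool (x l)) + card C \<or>
      z \<le> Suc j \<and> (\<forall>e\<in>C. z \<le> snd e) \<and> lpp x y w i (Suc j) = (\<Sum>l<z. of_bool (y l)) + card C"
      by blast
    then show ?thesis unfolding 1 using points_mono[of i "Suc i" "Suc j" "Suc j" w]
      by (intro exI[of _ C] exI[of _ z]) auto
  next
    case 2
    from 3(2) obtain C z where "C \<subseteq> points w (Suc i) j" "noncrossing C"
      "z \<le> Suc i \<and> (\<forall>e\<in>C. z \<le> fst e) \<and> lpp x y w (Suc i) j = (\<Sum>l<z. of_bool (x l)) + card C \<or>
      z \<le> j \<and> (\<forall>e\<in>C. z \<le> snd e) \<and> lpp x y w (Suc i) j = (\<Sum>l<z. of_bool (y l)) + card C"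
      by blast
    then show ?thesis unfolding 2 using points_mono[of "Suc i" "Suc i" j "Suc j" w]
      by (intro exI[of _ C] exI[of _ z]) auto
  next
    case c3: 3
    from 3(3) obtain C z where "C \<subseteq> points w i j" "noncrossing C"
      "z \<le> i \<and> (\<forall>e\<in>C. z \<le> fst e) \<and> lpp x y w i j = (\<Sum>l<z. of_bool (x l)) + card C \<or>
      z \<le> j \<and> (\<forall>e\<in>C. z \<le> snd e) \<and> lpp x y w i j = (\<Sum>l<z. of_bool (y l)) + card C"
      by blast
    then show ?thesis unfolding c3 using points_mono[of i "Suc i" j "Suc j" w]
      by (intro exI[of _ C] exI[of _ z]) auto
  next
    case 4
    from 3(3) obtain C z where C: "C \<subseteq> points w i j" "noncrossing C"
      "z \<le> i \<and> (\<forall>e\<in>C. z \<le> fst e) \<and> lpp x y w i j = (\<Sum>l<z. of_bool (x l)) + card C \<or>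
      z \<le> j \<and> (\<forall>e\<in>C. z \<le> snd e) \<and> lpp x y w i j = (\<Sum>l<z. of_bool (y l)) + card C"
      by blast
    have "(i, j) \<notin> C" using C(1) by (auto simp: points_def)
    moreover have "finite C" using C(1) finite_points by (rule finite_subset)
    ultimately have "card (insert (i, j) C) = Suc (card C)" by simp
    moreover have "noncrossing (insert (i, j) C)"
      using C(1,2) by (intro noncrossing_insert) (auto simp: points_def)
    moreover have "insert (i, j) C \<subseteq> points w (Suc i) (Suc j)"
      using C(1) 4(2) by (auto simp: points_def)
    ultimately show ?thesis unfolding 4(1) using C(3)
      by (intro exI[of _ "insert (i, j) C"] exI[of _ z]) auto
  qed
qed

text \<open>The converse of \<open>lpp_path\<close> for the source axis; paths along the sink axis
  are later reduced to it by transposing the weights.\<close>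

lemma lpp_ge_path:
  assumes "C \<subseteq> points w i j" "noncrossing C" "z \<le> i" "\<And>e. e \<in> C \<Longrightarrow> z \<le> fst e"
  shows "(\<Sum>l<z. of_bool (x l)) + card C \<le> lpp x y w i j"
  using assms
proof (induction x y w i j arbitrary: C z rule: lpp.induct)
  case (1 x y w j)
  then have "C = {}" by (auto simp: points_def)
  then show ?case using 1 by simp
next
  case (2 x y w i)
  then have "C = {}" by (auto simp: points_def)
  moreover have "(\<Sum>l<z. of_bool (x l)) \<le> (\<Sum>l<Suc i. of_bool (x l) :: nat)"
    using 2 by (intro sum_mono2) auto
  ultimately show ?case by simp
next
  case (3 x y w i j)
  show ?case
  \<comment> \<open>A path that stays on the axis to the end, or has no point in the last row,
    avoids that row. Otherwise the last column is dropped if it is empty too; if it is not, its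
    point and that of the last row coincide by \<open>noncrossing\<close>, and a diagonal step
    collects it.\<close>
  proof (cases "z = Suc i \<or> (\<forall>e\<in>C. snd e \<noteq> j)")
    case True
    then have "C \<subseteq> points w (Suc i) j" using 3(4,7) by (fastforce simp: points_def less_Suc_eq)
    from 3(2)[OF this 3(5,6,7)] show ?thesis by simp
  next
    case False
    then have zi: "z \<le> i" using 3(6) by simp
    show ?thesis
    proof (cases "\<forall>e\<in>C. fst e \<noteq> i")
      case True
      then have "C \<subseteq> points w i (Suc j)" using 3(4) by (fastforce simp: points_def less_Suc_eq)
      from 3(1)[OF this 3(5) zi 3(7)] show ?thesis by simp
    next
      case F2: False
      then obtain e where e: "e \<in> C" "fst e = i" by blast
      obtain e' where e': "e' \<in> C" "snd e' = j" using False by blast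
      have bound: "fst d < Suc i \<and> snd d < Suc j \<and> w (snd d) (fst d)" if "d \<in> C" for d
        using that 3(4) by (auto simp: points_def)
      have "e = e'"
        using noncrossingD[OF 3(5) e(1) e'(1)] bound[OF e(1)] bound[OF e'(1)] e e' by fastforce
      then have eij: "(i, j) \<in> C" using e e' by (metis prod.collapse)
      have sub: "C - {(i, j)} \<subseteq> points w i j"
      proof
        fix d assume d: "d \<in> C - {(i, j)}"
        then have "fst d < i \<and> snd d < j"
          using noncrossingD[OF 3(5), of d "(i, j)"] eij bound[of d] by auto
        then show "d \<in> points w i j" using bound[of d] d by (auto simp: points_def)
      qed
      have "(\<Sum>l<z. of_bool (x l)) + card (C - {(i, j)}) \<le> lpp x y w i j"
        by (rule 3(3)[OF sub noncrossing_subset[OF 3(5)] zi]) (use 3(7) in auto)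
      moreover have "finite C" using 3(4) finite_points by (rule finite_subset)
      then have "card C = Suc (card (C - {(i, j)}))" using eij by (rule card.remove)
      moreover have "w j i" using bound[OF eij] by simp
      ultimately show ?thesis by simp
    qed
  qed
qed

lemma lpp_mono: "lpp x y w i j \<le> lpp x y w (Suc i) j" "lpp x y w i j \<le> lpp x y w i (Suc j)"
  subgoal by (cases j) (auto simp: lpp_bottom simp del: lpp.simps(2))
  subgoal by (cases i) auto
  done

lemma lpp_Suc_le:
  "lpp x y w (Suc i) j \<le> Suc (lpp x y w i j)" "lpp x y w i (Suc j) \<le> Suc (lpp x y w i j)"
proof -
  show "lpp x y w (Suc i) j \<le> Suc (lpp x y w i j)"
  proof (induction j)
    case 0
    show ?case by (simp add: lpp_bottom del: lpp.simps(2))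
  next
    case (Suc j)
    then show ?case using lpp_mono[of x y w i j] by (auto simp: of_bool_def)
  qed
  show "lpp x y w i (Suc j) \<le> Suc (lpp x y w i j)"
  proof (induction i)
    case (Suc i)
    then show ?case using lpp_mono[of x y w i j] by (auto simp: of_bool_def)
  qed simp
qed

text \<open>By \<open>lpp_Suc_le\<close> a unit step raises the passage time by 0 or 1, so a Boolean
  records it. The increments at height \<open>j\<close> act as sources for the rows above.\<close>

definition hinc :: "(nat \<Rightarrow> bool) \<Rightarrow> (nat \<Rightarrow> bool) \<Rightarrow> (nat \<Rightarrow> nat \<Rightarrow> bool) \<Rightarrow> nat \<Rightarrow> nat \<Rightarrow> bool" where
  "hinc x y w j i \<longleftrightarrow> lpp x y w (Suc i) j = Suc (lpp x y w i j)"

lemma lpp_hinc: "lpp x y w (Suc i) j = lpp x y w i j + of_bool (hinc x y w j i)"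
  using lpp_mono(1)[of x y w i j] lpp_Suc_le(1)[of x y w i j] by (auto simp: hinc_def)

text \<open>Go up the vertical axis, then across at height \<open>j\<close>. Under stationarity both
  sums have known laws, and \<open>lpp_deviation\<close> combines them by a union bound, whatever
  their dependence.\<close>

lemma lpp_eq_sum: "lpp x y w i j = (\<Sum>l<j. of_bool (y l)) + (\<Sum>l<i. of_bool (hinc x y w j l))"
  by (induction i) (simp_all add: lpp_hinc del: lpp.simps(2,3))

lemma hinc_0: "hinc x y w 0 i = x i"
  by (simp add: hinc_def lpp_bottom del: lpp.simps(2))

text \<open>One row of the growth: \<open>vrow\<close> and \<open>hrow\<close> compute the vertical and the upper horizontal
  increments from the lower horizontal ones \<open>X\<close>, the sink \<open>b\<close> of the row and its weights \<open>r\<close>.\<close>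

primrec vrow :: "(nat \<Rightarrow> bool) \<Rightarrow> bool \<Rightarrow> (nat \<Rightarrow> bool) \<Rightarrow> nat \<Rightarrow> bool" where
  "vrow X b r 0 = b"
| "vrow X b r (Suc i) = (\<not> X i \<and> (vrow X b r i \<or> r i))"

definition hrow :: "(nat \<Rightarrow> bool) \<Rightarrow> bool \<Rightarrow> (nat \<Rightarrow> bool) \<Rightarrow> nat \<Rightarrow> bool" where
  "hrow X b r i = ((X i \<or> r i) \<and> \<not> vrow X b r i)"

lemma lpp_vrow: "lpp x y w i (Suc j) = lpp x y w i j + of_bool (vrow (hinc x y w j) (y j) (w j) i)"
proof (induction i)
  case (Suc i)
  show ?case using Suc lpp_hinc[of x y w i j] by (auto simp: of_bool_def max_def)
qed simp

lemma hinc_Suc: "hinc x y w (Suc j) i = hrow (hinc x y w j) (y j) (w j) i"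
proof -
  have "lpp x y w (Suc i) (Suc j) = Suc (lpp x y w i (Suc j)) \<longleftrightarrow> hrow (hinc x y w j) (y j) (w j) i"
    using lpp_vrow[of x y w i j] lpp_hinc[of x y w i j] by (auto simp: of_bool_def max_def hrow_def)
  then show ?thesis by (simp add: hinc_def del: lpp.simps)
qed

lemma vrow_cong:
  assumes "\<And>l. l < i \<Longrightarrow> X l = X' l" "\<And>l. l < i \<Longrightarrow> r l = r' l"
  shows "vrow X b r i = vrow X' b r' i"
  using assms by (induction i) auto

lemma hrow_cong:
  assumes "\<And>l. l \<le> i \<Longrightarrow> X l = X' l" "\<And>l. l \<le> i \<Longrightarrow> r l = r' l"
  shows "hrow X b r i = hrow X' b r' i"
  using assms vrow_cong[of i X X' r r' b] by (simp add: hrow_def)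

lemma hinc_cong:
  assumes "\<And>l. l < j \<Longrightarrow> y l = y' l" "\<And>l. l < j \<Longrightarrow> w l = w' l"
  shows "hinc x y w j = hinc x y' w' j"
  using assms
proof (induction j)
  case (Suc j)
  have "hinc x y w j = hinc x y' w' j" "w j = w' j" "y j = y' j" using Suc by auto
  then show ?case by (intro ext) (simp only: hinc_Suc)
qed (simp add: hinc_0 fun_eq_iff)

section \<open>The stationary growth process\<close>

abbreviation bern :: "nat \<Rightarrow> real \<Rightarrow> (nat \<Rightarrow> bool) pmf" where
  "bern N u \<equiv> Pi_pmf {..<N} False (\<lambda>_. bernoulli_pmf u)"

abbreviation weights :: "nat \<Rightarrow> nat \<Rightarrow> real \<Rightarrow> (nat \<Rightarrow> nat \<Rightarrow> bool) pmf" where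
  "weights N M p \<equiv> Pi_pmf {..<M} (\<lambda>_. False) (\<lambda>_. bern N p)"

text \<open>In one cell a source \<open>c\<close> and a sink \<open>z\<close> that meet annihilate
  each other, a single one passes through, and a point \<open>d\<close> in a cell with neither
  creates both. The hypothesis balances annihilation, \<open>u * v\<close>, against creation,
  \<open>p * (1 - u) * (1 - v)\<close>.\<close>

lemma local_stationarity:
  assumes "0 \<le> u" "u \<le> 1" "0 \<le> v" "v \<le> 1" "0 \<le> p" "p \<le> 1" "u * v = p * (1 - u) * (1 - v)"
  shows "do {c \<leftarrow> bernoulli_pmf u; z \<leftarrow> bernoulli_pmf v; d \<leftarrow> bernoulli_pmf p;
      return_pmf ((c \<or> d) \<and> \<not> z, \<not> c \<and> (z \<or> d))} = pair_pmf (bernoulli_pmf u) (bernoulli_pmf v)"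
    (is "?L = _")
proof (rule pmf_eqI)
  fix q :: "bool \<times> bool"
  obtain s t where q: "q = (s, t)" by fastforce
  show "pmf ?L q = pmf (pair_pmf (bernoulli_pmf u) (bernoulli_pmf v)) q"
    unfolding q pmf_pair using assms(1-6)
    by (cases s; cases t; simp add: pmf_bind indicator_def) (use assms(7) in algebra)+
qed

text \<open>A Burke type property: the upper increments are again independent with density
  \<open>u\<close>, and independent of the vertical increment leaving at the right end. That
  independence is what lets the induction feed the next cell.\<close>

lemma row_stationarity:
  assumes "0 \<le> u" "u \<le> 1" "0 \<le> v" "v \<le> 1" "0 \<le> p" "p \<le> 1" "u * v = p * (1 - u) * (1 - v)"
  shows "do {X \<leftarrow> bern N u; b \<leftarrow> bernoulli_pmf v; r \<leftarrow> bern N p;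
      return_pmf (\<lambda>i. i < N \<and> hrow X b r i, vrow X b r N)} = pair_pmf (bern N u) (bernoulli_pmf v)"
proof (induction N)
  case 0
  show ?case by (simp add: bind_return_pmf pair_pmf_def)
next
  case (Suc N)
  have ins: "bern (Suc N) q = do {c \<leftarrow> bernoulli_pmf q; X \<leftarrow> bern N q; return_pmf (X(N := c))}" for q
    by (simp add: lessThan_Suc Pi_pmf_insert')
  have step: "(\<lambda>i. i < Suc N \<and> hrow (X(N := c)) b (r(N := d)) i, vrow (X(N := c)) b (r(N := d)) (Suc N)) =
     ((\<lambda>i. i < N \<and> hrow X b r i)(N := (c \<or> d) \<and> \<not> vrow X b r N), \<not> c \<and> (vrow X b r N \<or> d))" for X b r c d
  proof -
    have v: "vrow (X(N := c)) b (r(N := d)) i = vrow X b r i" if "i \<le> N" for i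
      using that by (intro vrow_cong) auto
    show ?thesis using v by (auto simp: hrow_def fun_eq_iff less_Suc_eq)
  qed
  have "do {X \<leftarrow> bern (Suc N) u; b \<leftarrow> bernoulli_pmf v; r \<leftarrow> bern (Suc N) p;
      return_pmf (\<lambda>i. i < Suc N \<and> hrow X b r i, vrow X b r (Suc N))} =
    do {c \<leftarrow> bernoulli_pmf u; X \<leftarrow> bern N u; b \<leftarrow> bernoulli_pmf v; d \<leftarrow> bernoulli_pmf p; r \<leftarrow> bern N p;
      return_pmf ((\<lambda>i. i < N \<and> hrow X b r i)(N := (c \<or> d) \<and> \<not> vrow X b r N), \<not> c \<and> (vrow X b r N \<or> d))}"
    by (simp only: ins bind_assoc_pmf bind_return_pmf step)
  \<comment> \<open>Independent draws commute, so the first \<open>N\<close> cells can be grouped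
    for the induction hypothesis.\<close>
  also have "\<dots> = do {c \<leftarrow> bernoulli_pmf u; d \<leftarrow> bernoulli_pmf p; 
      (X', z) \<leftarrow> do {X \<leftarrow> bern N u; b \<leftarrow> bernoulli_pmf v; r \<leftarrow> bern N p;
         return_pmf (\<lambda>i. i < N \<and> hrow X b r i, vrow X b r N)};
      return_pmf (X'(N := (c \<or> d) \<and> \<not> z), \<not> c \<and> (z \<or> d))}"
    unfolding bind_assoc_pmf bind_return_pmf case_prod_conv
    by (rule bind_pmf_cong[OF refl], rule sym, rule trans[OF bind_commute_pmf],
        rule bind_pmf_cong[OF refl], rule bind_commute_pmf)
  also have "\<dots> = do {c \<leftarrow> bernoulli_pmf u; d \<leftarrow> bernoulli_pmf p; X' \<leftarrow> bern N u; z \<leftarrow> bernoulli_pmf v;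
      return_pmf (X'(N := (c \<or> d) \<and> \<not> z), \<not> c \<and> (z \<or> d))}"
    unfolding Suc.IH pair_pmf_def bind_assoc_pmf bind_return_pmf case_prod_conv ..
  \<comment> \<open>Now the draws of the last cell are grouped for
    \<open>local_stationarity\<close>.\<close>
  also have "\<dots> = do {X' \<leftarrow> bern N u; 
      (g, h) \<leftarrow> do {c \<leftarrow> bernoulli_pmf u; z \<leftarrow> bernoulli_pmf v; d \<leftarrow> bernoulli_pmf p; 
         return_pmf ((c \<or> d) \<and> \<not> z, \<not> c \<and> (z \<or> d))};
      return_pmf (X'(N := g), h)}"
    unfolding bind_assoc_pmf bind_return_pmf case_prod_conv
    by (rule trans[OF bind_pmf_cong[OF refl bind_commute_pmf]], rule trans[OF bind_commute_pmf],
        rule bind_pmf_cong[OF refl], rule bind_pmf_cong[OF refl], rule bind_commute_pmf)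
  also have "\<dots> = do {X' \<leftarrow> bern N u; g \<leftarrow> bernoulli_pmf u; h \<leftarrow> bernoulli_pmf v; return_pmf (X'(N := g), h)}"
    unfolding local_stationarity[OF assms] pair_pmf_def bind_assoc_pmf bind_return_pmf case_prod_conv ..
  also have "\<dots> = pair_pmf (bern (Suc N) u) (bernoulli_pmf v)"
    unfolding ins pair_pmf_def bind_assoc_pmf bind_return_pmf by (subst bind_commute_pmf) simp
  finally show ?case .
qed

definition boundary_law :: "nat \<Rightarrow> nat \<Rightarrow> real \<Rightarrow> real \<Rightarrow> real \<Rightarrow>
    ((nat \<Rightarrow> bool) \<times> (nat \<Rightarrow> bool) \<times> (nat \<Rightarrow> nat \<Rightarrow> bool)) pmf" where
  "boundary_law N M u v p = do {x \<leftarrow> bern N u; y \<leftarrow> bern M v; w \<leftarrow> weights N M p; return_pmf (x, y, w)}"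

text \<open>Row by row: the increments above a row are fresh sources for the next one, independent
  of its sink and weights. Cutting at \<open>N\<close> supplies the default value
  \<open>False\<close> of \<open>bern N u\<close>.\<close>

lemma top_row_stationarity:
  assumes "0 \<le> u" "u \<le> 1" "0 \<le> v" "v \<le> 1" "0 \<le> p" "p \<le> 1" "u * v = p * (1 - u) * (1 - v)"
  shows "map_pmf (\<lambda>(x, y, w) i. i < N \<and> hinc x y w M i) (boundary_law N M u v p) = bern N u"
proof (induction M)
  case 0
  have "bern N u = map_pmf (\<lambda>x i. i < N \<and> x i) (bern N u)"
    by (subst map_pmf_cong[OF refl, of _ _ "\<lambda>x. x"]) (auto simp: set_Pi_pmf PiE_dflt_def fun_eq_iff)
  then show ?case by (simp add: boundary_law_def map_pmf_def bind_assoc_pmf bind_return_pmf hinc_0)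
next
  case (Suc M)
  have ins: "bern (Suc M) v = do {b \<leftarrow> bernoulli_pmf v; y \<leftarrow> bern M v; return_pmf (y(M := b))}"
    "weights N (Suc M) p = do {r \<leftarrow> bern N p; w \<leftarrow> weights N M p; return_pmf (w(M := r))}"
    by (simp_all add: lessThan_Suc Pi_pmf_insert')
  have step: "(\<lambda>i. i < N \<and> hinc x (y(M := b)) (w(M := r)) (Suc M) i) =
      (\<lambda>i. i < N \<and> hrow (\<lambda>i. i < N \<and> hinc x y w M i) b r i)" for x y w b r
  proof -
    have "hinc x (y(M := b)) (w(M := r)) M = hinc x y w M" by (rule hinc_cong) auto
    then have "hinc x (y(M := b)) (w(M := r)) (Suc M) i = hrow (hinc x y w M) b r i" for i
      by (simp only: hinc_Suc fun_upd_same)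
    moreover have "hrow (hinc x y w M) b r i = hrow (\<lambda>i. i < N \<and> hinc x y w M i) b r i" if "i < N" for i
      using that by (intro hrow_cong) auto
    ultimately show ?thesis by (intro ext conj_cong refl) (simp only:)
  qed
  have "map_pmf (\<lambda>(x, y, w) i. i < N \<and> hinc x y w (Suc M) i) (boundary_law N (Suc M) u v p) =
    do {x \<leftarrow> bern N u; b \<leftarrow> bernoulli_pmf v; y \<leftarrow> bern M v; r \<leftarrow> bern N p; w \<leftarrow> weights N M p;
      return_pmf (\<lambda>i. i < N \<and> hrow (\<lambda>i. i < N \<and> hinc x y w M i) b r i)}"
    by (simp only: boundary_law_def map_pmf_def ins bind_assoc_pmf bind_return_pmf case_prod_conv step)
  also have "\<dots> = do {X \<leftarrow> map_pmf (\<lambda>(x, y, w) i. i < N \<and> hinc x y w M i) (boundary_law N M u v p);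
      b \<leftarrow> bernoulli_pmf v; r \<leftarrow> bern N p; return_pmf (\<lambda>i. i < N \<and> hrow X b r i)}"
    unfolding boundary_law_def map_pmf_def bind_assoc_pmf bind_return_pmf case_prod_conv
    by (rule bind_pmf_cong[OF refl], rule trans[OF bind_commute_pmf], rule bind_pmf_cong[OF refl],
        rule trans[OF bind_pmf_cong[OF refl bind_commute_pmf]], rule bind_commute_pmf)
  also have "\<dots> = map_pmf fst (do {X \<leftarrow> bern N u; b \<leftarrow> bernoulli_pmf v; r \<leftarrow> bern N p;
      return_pmf (\<lambda>i. i < N \<and> hrow X b r i, vrow X b r N)})"
    unfolding Suc.IH by (simp only: map_pmf_def bind_assoc_pmf bind_return_pmf fst_conv)
  also have "\<dots> = bern N u" unfolding row_stationarity[OF assms] by (rule map_fst_pair_pmf)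
  finally show ?case .
qed

section \<open>The longest chain of a Bernoulli matrix\<close>

lemma bern_second_moment:
  assumes "finite I" "0 \<le> u" "u \<le> 1"
  shows "measure_pmf.expectation (Pi_pmf I False (\<lambda>_. bernoulli_pmf u)) (\<lambda>x. (\<Sum>i\<in>I. of_bool (x i) - u)\<^sup>2)
    = real (card I) * (u * (1 - u))"
  using assms(1)
proof (induction I rule: finite_induct)
  case (insert j I)
  define Q where "Q = Pi_pmf I False (\<lambda>_. bernoulli_pmf u)"
  define S where "S x = (\<Sum>i\<in>I. of_bool (x i) - u)" for x
  have finQ: "finite (set_pmf Q)" unfolding Q_def using insert by (intro finite_set_Pi_pmf) auto
  have int: "integrable (measure_pmf Q) h" for h :: "_ \<Rightarrow> real"
    using finQ by (rule integrable_measure_pmf_finite)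
  have ES: "measure_pmf.expectation Q S = 0"
  proof -
    have "measure_pmf.expectation Q (\<lambda>x. of_bool (x i) - u) = 0" if "i \<in> I" for i
    proof -
      have "measure_pmf.expectation Q (\<lambda>x. of_bool (x i) - u) =
          measure_pmf.expectation (map_pmf (\<lambda>x. x i) Q) (\<lambda>c. of_bool c - u)"
        by simp
      also have "map_pmf (\<lambda>x. x i) Q = bernoulli_pmf u"
        unfolding Q_def using insert(1) that by (simp add: Pi_pmf_component)
      finally show ?thesis using assms(2,3) by (simp add: algebra_simps)
    qed
    then show ?thesis unfolding S_def by (subst Bochner_Integration.integral_sum[OF int]) simp
  qed
  have P: "Pi_pmf (insert j I) False (\<lambda>_. bernoulli_pmf u) =
      bind_pmf (bernoulli_pmf u) (\<lambda>c. map_pmf (\<lambda>f. f(j := c)) Q)"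
    unfolding Q_def using insert by (simp add: Pi_pmf_insert' map_pmf_def)
  have sum: "(\<Sum>i\<in>insert j I. of_bool ((x(j := c)) i) - u) = (of_bool c - u) + S x" for x c
    using insert(1,2) by (auto simp: S_def intro!: sum.cong)
  have E: "measure_pmf.expectation Q (\<lambda>x. (d + S x)\<^sup>2) = d\<^sup>2 + real (card I) * (u * (1 - u))" for d
  proof -
    have "(\<lambda>x. (d + S x)\<^sup>2) = (\<lambda>x. (d\<^sup>2 + 2 * d * S x) + (S x)\<^sup>2)"
      by (simp add: power2_eq_square algebra_simps)
    then have "measure_pmf.expectation Q (\<lambda>x. (d + S x)\<^sup>2) =
        measure_pmf.expectation Q (\<lambda>x. (d\<^sup>2 + 2 * d * S x) + (S x)\<^sup>2)"
      by (simp only:)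
    also have "\<dots> = measure_pmf.expectation Q (\<lambda>x. d\<^sup>2 + 2 * d * S x) + measure_pmf.expectation Q (\<lambda>x. (S x)\<^sup>2)"
      by (rule Bochner_Integration.integral_add[OF int int])
    also have "measure_pmf.expectation Q (\<lambda>x. (S x)\<^sup>2) = real (card I) * (u * (1 - u))"
      using insert.IH by (simp only: Q_def S_def)
    also have "measure_pmf.expectation Q (\<lambda>x. d\<^sup>2 + 2 * d * S x) =
        measure_pmf.expectation Q (\<lambda>x. d\<^sup>2) + measure_pmf.expectation Q (\<lambda>x. 2 * d * S x)"
      by (rule Bochner_Integration.integral_add[OF int int])
    also have "\<dots> = d\<^sup>2" using ES by simp
    finally show ?thesis .
  qed
  have "measure_pmf.expectation (Pi_pmf (insert j I) False (\<lambda>_. bernoulli_pmf u))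
      (\<lambda>x. (\<Sum>i\<in>insert j I. of_bool (x i) - u)\<^sup>2) =
    measure_pmf.expectation (bernoulli_pmf u) (\<lambda>c. measure_pmf.expectation Q (\<lambda>x. ((of_bool c - u) + S x)\<^sup>2))"
    unfolding P by (rule trans[OF expectation_bind_finite]) (use finQ in simp, use finQ in simp, simp only: integral_map_pmf sum)
  also have "\<dots> = real (card (insert j I)) * (u * (1 - u))"
    unfolding E using assms insert(1,2) by (simp add: power2_eq_square algebra_simps)
  finally show ?case .
qed simp

text \<open>Chebyshev's inequality with the variance bounded by the mean, which is sharp enough
  because the densities used are small.\<close>

lemma bern_deviation:
  assumes "z \<le> N" "0 \<le> u" "u \<le> 1" "0 < s"
  shows "measure_pmf.prob (bern N u) {x. s \<le> \<bar>real (\<Sum>l<z. of_bool (x l)) - real z * u\<bar>} \<le> real z * u / s\<^sup>2"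
proof -
  define E where "E = {x. s \<le> \<bar>real (\<Sum>l<z. of_bool (x l)) - real z * u\<bar>}"
  have sum: "(\<Sum>l<z. of_bool (x l) - u) = real (\<Sum>l<z. of_bool (x l)) - real z * u" for x
    by (simp add: sum_subtractf)
  have fin: "finite (set_pmf (bern z u))" by (intro finite_set_Pi_pmf) auto
  have "bern z u = map_pmf (\<lambda>f x. if x \<in> {..<z} then f x else False) (bern N u)"
    using assms(1) by (intro Pi_pmf_subset) auto
  moreover have "(\<lambda>f x. if x \<in> {..<z} then f x else False) -` E = E"
  proof -
    have "(\<Sum>l<z. of_bool (if l \<in> {..<z} then x l else False)) = (\<Sum>l<z. of_bool (x l) :: nat)" for x
      by (rule sum.cong) auto
    then show ?thesis unfolding vimage_def E_def by (simp only: mem_Collect_eq)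
  qed
  ultimately have "measure_pmf.prob (bern z u) E = measure_pmf.prob (bern N u) E" by (simp only: measure_map_pmf)
  moreover have "s\<^sup>2 * measure_pmf.prob (bern z u) E = measure_pmf.expectation (bern z u) (\<lambda>x. s\<^sup>2 * indicator E x)"
    by simp
  moreover have "\<dots> \<le> measure_pmf.expectation (bern z u) (\<lambda>x. (\<Sum>l<z. of_bool (x l) - u)\<^sup>2)"
    using assms(4) unfolding sum E_def
    by (intro expectation_mono_finite[OF fin]) (auto simp: indicator_def intro: abs_le_square_iff[THEN iffD1])
  moreover have "\<dots> = real z * (u * (1 - u))" using assms by (subst bern_second_moment) auto
  moreover have "\<dots> \<le> real z * u" using assms by (intro mult_left_mono) (auto simp: mult_left_le)
  ultimately have "s\<^sup>2 * measure_pmf.prob (bern N u) E \<le> real z * u" by simp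
  then show ?thesis using assms(4) by (simp add: E_def field_simps)
qed

lemma prob_le_add:
  assumes "S \<subseteq> S1 \<union> S2" "measure_pmf.prob M S1 \<le> a" "measure_pmf.prob M S2 \<le> b"
  shows "measure_pmf.prob M S \<le> a + b"
proof -
  have "measure_pmf.prob M S \<le> measure_pmf.prob M (S1 \<union> S2)"
    using assms(1) by (intro measure_pmf.finite_measure_mono) auto
  also have "\<dots> \<le> measure_pmf.prob M S1 + measure_pmf.prob M S2"
    by (rule measure_Un_le) auto
  finally show ?thesis using assms by simp
qed

lemma prob_map_le:
  assumes "map_pmf f M = M'" "measure_pmf.prob M' S \<le> a"
  shows "measure_pmf.prob M (f -` S) \<le> a"
proof -
  have "measure_pmf.prob M (f -` S) = measure_pmf.prob (map_pmf f M) S" by simp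
  then show ?thesis using assms by simp
qed

lemma lpp_deviation:
  assumes "0 \<le> u" "u \<le> 1" "0 \<le> v" "v \<le> 1" "0 \<le> p" "p \<le> 1" "u * v = p * (1 - u) * (1 - v)" "0 < s"
  shows "measure_pmf.prob (boundary_law N N u v p)
     {(x, y, w). 2 * s \<le> \<bar>real (lpp x y w N N) - real N * (u + v)\<bar>} \<le> real N * u / s\<^sup>2 + real N * v / s\<^sup>2"
proof (rule prob_le_add)
  let ?D = "\<lambda>u. {x. s \<le> \<bar>real (\<Sum>l<N. of_bool (x l)) - real N * u\<bar>}"
  show "{(x, y, w). 2 * s \<le> \<bar>real (lpp x y w N N) - real N * (u + v)\<bar>} \<subseteq>
     (\<lambda>(x, y, w) i. i < N \<and> hinc x y w N i) -` ?D u \<union> (\<lambda>(x, y, w). y) -` ?D v"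
  proof clarify
    fix x y w
    assume dev: "2 * s \<le> \<bar>real (lpp x y w N N) - real N * (u + v)\<bar>"
      and y: "(x, y, w) \<notin> (\<lambda>(x, y, w). y) -` ?D v"
    have "real (lpp x y w N N) = real (\<Sum>l<N. of_bool (y l)) + real (\<Sum>l<N. of_bool (hinc x y w N l))"
      unfolding lpp_eq_sum[of x y w N N] by (rule of_nat_add)
    moreover have "(\<Sum>l<N. of_bool (hinc x y w N l)) = (\<Sum>l<N. of_bool (l < N \<and> hinc x y w N l) :: nat)"
      by (rule sum.cong) auto
    moreover have "\<not> s \<le> \<bar>real (\<Sum>l<N. of_bool (y l)) - real N * v\<bar>"
      using y by (simp only: vimage_eq mem_Collect_eq case_prod_conv not_False_eq_True)
    ultimately have "s \<le> \<bar>real (\<Sum>l<N. of_bool (l < N \<and> hinc x y w N l)) - real N * u\<bar>"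
      using dev unfolding distrib_left by linarith
    then show "(x, y, w) \<in> (\<lambda>(x, y, w) i. i < N \<and> hinc x y w N i) -` ?D u"
      by (simp only: vimage_eq mem_Collect_eq case_prod_conv)
  qed
  show "measure_pmf.prob (boundary_law N N u v p) ((\<lambda>(x, y, w) i. i < N \<and> hinc x y w N i) -` ?D u) \<le> real N * u / s\<^sup>2"
    using assms by (intro prob_map_le[OF top_row_stationarity] bern_deviation) auto
  have "map_pmf (\<lambda>(x, y, w). y) (boundary_law N N u v p) = bern N v"
    by (simp add: boundary_law_def map_pmf_def bind_assoc_pmf bind_return_pmf bind_return_pmf')
  then show "measure_pmf.prob (boundary_law N N u v p) ((\<lambda>(x, y, w). y) -` ?D v) \<le> real N * v / s\<^sup>2"
    by (rule prob_map_le) (use assms in \<open>intro bern_deviation, auto\<close>)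
qed

text \<open>For coupling two densities of sources: disjunction raises the density, and the
  difference counts the sources that were added.\<close>

lemma bern_combine:
  assumes "do {a \<leftarrow> bernoulli_pmf u; b \<leftarrow> bernoulli_pmf v; return_pmf (f a b)} = bernoulli_pmf r"
  shows "do {x \<leftarrow> bern N u; y \<leftarrow> bern N v; return_pmf (\<lambda>i. i < N \<and> f (x i) (y i))} = bern N r"
proof -
  have "bern N r = Pi_pmf {..<N} False
      (\<lambda>_. bind_pmf (bernoulli_pmf u) (\<lambda>a. bind_pmf (bernoulli_pmf v) (\<lambda>b. return_pmf (f a b))))"
    by (simp only: assms)
  also have "\<dots> = do {x \<leftarrow> bern N u; Pi_pmf {..<N} False (\<lambda>i. bind_pmf (bernoulli_pmf v) (\<lambda>b. return_pmf (f (x i) b)))}"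
    by (rule Pi_pmf_bind) simp
  also have "\<dots> = do {x \<leftarrow> bern N u; y \<leftarrow> bern N v; return_pmf (\<lambda>i. i < N \<and> f (x i) (y i))}"
    by (subst Pi_pmf_bind[where d' = False]) (auto intro!: bind_pmf_cong simp: fun_eq_iff)
  finally show ?thesis ..
qed

text \<open>Any path counts here, optimal or not, and sinks do not occur. So the event depends on
  sources and weights alone, and the sinks can be given any density when it is estimated.\<close>

definition late_exit :: "nat \<Rightarrow> nat \<Rightarrow> real \<Rightarrow> (nat \<Rightarrow> bool) \<Rightarrow> (nat \<Rightarrow> nat \<Rightarrow> bool) \<Rightarrow> bool" where
  "late_exit N z0 l x w \<longleftrightarrow> (\<exists>z C. z0 \<le> z \<and> z \<le> N \<and> C \<subseteq> points w N N \<and> noncrossing C \<and>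
     (\<forall>e\<in>C. z \<le> fst e) \<and> l \<le> real ((\<Sum>i<z. of_bool (x i)) + card C))"

text \<open>Raising the density of the sources from \<open>u1\<close> to \<open>u\<close> raises every path that uses at least
  \<open>z0\<close> of them, by about \<open>z0 * (u - u1)\<close>, but the passage time only by a second order term.\<close>

lemma late_exit_prob:
  assumes "0 \<le> u1" "u1 < 1" "u1 \<le> u" "u \<le> 1" "0 \<le> v" "v \<le> 1" "0 \<le> p" "p \<le> 1"
    and uv: "u * v = p * (1 - u) * (1 - v)" and "0 < s" "z0 \<le> N"
    and l: "real N * (u + v) + 3 * s - real z0 * (u - u1) \<le> l"
  shows "measure_pmf.prob (pair_pmf (bern N u1) (weights N N p)) {(x, w). late_exit N z0 l x w}
    \<le> (real N * u / s\<^sup>2 + real N * v / s\<^sup>2) + real z0 * (u - u1) / s\<^sup>2"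
proof -
  \<comment> \<open>Adding a source at an empty site with probability \<open>h\<close> gives density
    \<open>u1 + (1 - u1) * h = u\<close>.\<close>
  define h where "h = (u - u1) / (1 - u1)"
  have h: "0 \<le> h" "h \<le> 1" using assms by (auto simp: h_def field_simps)
  have hu: "(1 - u1) * h = u - u1" using assms by (simp add: h_def)
  define K where "K = do {x \<leftarrow> bern N u1; g \<leftarrow> bern N h; y \<leftarrow> bern N v; w \<leftarrow> weights N N p; return_pmf (x, g, y, w)}"
  have law_or: "do {a \<leftarrow> bernoulli_pmf u1; b \<leftarrow> bernoulli_pmf h; return_pmf (a \<or> b)} = bernoulli_pmf u"
  proof (rule pmf_eqI)
    fix c show "pmf (do {a \<leftarrow> bernoulli_pmf u1; b \<leftarrow> bernoulli_pmf h; return_pmf (a \<or> b)}) c = pmf (bernoulli_pmf u) c"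
      using assms h hu by (cases c) (simp_all add: pmf_bind indicator_def algebra_simps)
  qed
  have law_diff: "do {a \<leftarrow> bernoulli_pmf u1; b \<leftarrow> bernoulli_pmf h; return_pmf (\<not> a \<and> b)} = bernoulli_pmf (u - u1)"
  proof (rule pmf_eqI)
    fix c show "pmf (do {a \<leftarrow> bernoulli_pmf u1; b \<leftarrow> bernoulli_pmf h; return_pmf (\<not> a \<and> b)}) c = pmf (bernoulli_pmf (u - u1)) c"
      using assms h hu by (cases c) (simp_all add: pmf_bind indicator_def algebra_simps)
  qed
  define fa where "fa = (\<lambda>(x, g, y :: nat \<Rightarrow> bool, w :: nat \<Rightarrow> nat \<Rightarrow> bool). (\<lambda>i::nat. i < N \<and> (x i \<or> g i), y, w))"
  define fd where "fd = (\<lambda>(x, g, y :: nat \<Rightarrow> bool, w :: nat \<Rightarrow> nat \<Rightarrow> bool) i::nat. i < N \<and> (\<not> x i \<and> g i))"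
  define fw where "fw = (\<lambda>(x :: nat \<Rightarrow> bool, g :: nat \<Rightarrow> bool, y :: nat \<Rightarrow> bool, w :: nat \<Rightarrow> nat \<Rightarrow> bool). (x, w))"
  have Ka: "map_pmf fa K = boundary_law N N u v p"
    unfolding K_def boundary_law_def fa_def bern_combine[OF law_or, symmetric]
    by (simp add: map_pmf_def bind_assoc_pmf bind_return_pmf)
  have Kd: "map_pmf fd K = bern N (u - u1)"
    unfolding K_def fd_def bern_combine[OF law_diff, symmetric]
    by (simp add: map_pmf_def bind_assoc_pmf bind_return_pmf)
  have Kw: "map_pmf fw K = pair_pmf (bern N u1) (weights N N p)"
    unfolding K_def fw_def pair_pmf_def
    by (simp add: map_pmf_def bind_assoc_pmf bind_return_pmf)
  let ?A = "{(x, y, w). 2 * s \<le> \<bar>real (lpp x y w N N) - real N * (u + v)\<bar>}"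
  let ?D = "{x. s \<le> \<bar>real (\<Sum>l<z0. of_bool (x l)) - real z0 * (u - u1)\<bar>}"
  have "measure_pmf.prob K (fw -` {(x, w). late_exit N z0 l x w})
      \<le> (real N * u / s\<^sup>2 + real N * v / s\<^sup>2) + real z0 * (u - u1) / s\<^sup>2"
  proof (rule prob_le_add)
    show "measure_pmf.prob K (fa -` ?A) \<le> real N * u / s\<^sup>2 + real N * v / s\<^sup>2"
      using assms by (intro prob_map_le[OF Ka] lpp_deviation) auto
    show "measure_pmf.prob K (fd -` ?D) \<le> real z0 * (u - u1) / s\<^sup>2"
      using assms by (intro prob_map_le[OF Kd] bern_deviation) auto
    show "fw -` {(x, w). late_exit N z0 l x w} \<subseteq> fa -` ?A \<union> fd -` ?D"
    proof
      fix \<omega> assume "\<omega> \<in> fw -` {(x, w). late_exit N z0 l x w}"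
      moreover obtain x g y w where \<omega>: "\<omega> = (x, g, y, w)" by (metis prod.collapse)
      ultimately have "late_exit N z0 l x w" by (simp add: fw_def)
      then obtain z C where C: "z0 \<le> z" "z \<le> N" "C \<subseteq> points w N N" "noncrossing C" "\<And>e. e \<in> C \<Longrightarrow> z \<le> fst e"
        "l \<le> real ((\<Sum>i<z. of_bool (x i)) + card C)"
        unfolding late_exit_def by blast
      define xa where "xa i = (i < N \<and> (x i \<or> g i))" for i
      define D where "D i = (i < N \<and> (\<not> x i \<and> g i))" for i
      have "(\<Sum>i<z. of_bool (xa i)) + card C \<le> lpp xa y w N N"
        using C(3,4,2,5) by (rule lpp_ge_path)
      moreover have "(\<Sum>i<z. of_bool (xa i)) = (\<Sum>i<z. of_bool (x i)) + (\<Sum>i<z. of_bool (D i) :: nat)"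
        unfolding sum.distrib[symmetric] using C(2) by (intro sum.cong) (auto simp: xa_def D_def)
      moreover have "(\<Sum>i<z0. of_bool (D i)) \<le> (\<Sum>i<z. of_bool (D i) :: nat)"
        using C(1) by (intro sum_mono2) auto
      ultimately have "(\<Sum>i<z. of_bool (x i)) + card C + (\<Sum>i<z0. of_bool (D i)) \<le> lpp xa y w N N"
        by linarith
      then have "l + real (\<Sum>i<z0. of_bool (D i)) \<le> real (lpp xa y w N N)"
        using C(6) by linarith
      \<comment> \<open>Of the margin \<open>3 * s\<close>, two parts cover the passage time and one
        covers the number of added sources.\<close>
      then have "2 * s \<le> \<bar>real (lpp xa y w N N) - real N * (u + v)\<bar> \<or>
          s \<le> \<bar>real (\<Sum>i<z0. of_bool (D i)) - real z0 * (u - u1)\<bar>"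
        using l by argo
      then show "\<omega> \<in> fa -` ?A \<union> fd -` ?D"
        by (simp add: \<omega> fa_def fd_def xa_def[abs_def] D_def[abs_def])
    qed
  qed
  then show ?thesis unfolding Kw[symmetric] by simp
qed

text \<open>The matrix is drawn row by row to suit the stationarity argument. This product over
  cells is symmetric in the two indices and forgets the rows, as transposition and
  \<open>weights_random_cells\<close> require.\<close>

lemma pmf_weights:
  "pmf (weights N M p) w = (if \<forall>j i. M \<le> j \<or> N \<le> i \<longrightarrow> \<not> w j i
     then \<Prod>j<M. \<Prod>i<N. pmf (bernoulli_pmf p) (w j i) else 0)"
proof (cases "\<forall>j i. M \<le> j \<or> N \<le> i \<longrightarrow> \<not> w j i")
  case True
  then show ?thesis by (auto simp: pmf_Pi fun_eq_iff intro!: prod.cong)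
next
  case False
  then obtain j i where ji: "M \<le> j \<or> N \<le> i" "w j i" by blast
  have "pmf (weights N M p) w = 0"
  proof (cases "M \<le> j")
    case True
    moreover have "w j \<noteq> (\<lambda>_. False)" using ji(2) by (metis (full_types))
    ultimately show ?thesis using True by (intro pmf_Pi_outside conjI exI[of _ j]) auto
  next
    case F: False
    then have "pmf (bern N p) (w j) = 0" using ji by (intro pmf_Pi_outside conjI exI[of _ i]) auto
    then have "(\<Prod>j<M. pmf (bern N p) (w j)) = 0" using F by (intro prod_zero bexI[of _ j]) auto
    then show ?thesis by (subst pmf_Pi) (simp_all only: finite_lessThan if_cancel)
  qed
  then show ?thesis by (simp only: if_not_P[OF False])
qed

text \<open>Turns late exits from the sink axis into late exits from the source axis.\<close>

lemma weights_transpose: "map_pmf (\<lambda>w i j. w j i) (weights N N p) = weights N N p"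
proof (rule pmf_eqI)
  fix w :: "nat \<Rightarrow> nat \<Rightarrow> bool"
  have "inj (\<lambda>(w :: nat \<Rightarrow> nat \<Rightarrow> bool) i j. w j i)" by (auto simp: inj_def fun_eq_iff)
  from pmf_map_inj'[OF this, of "weights N N p" "\<lambda>i j. w j i"]
  have "pmf (map_pmf (\<lambda>w i j. w j i) (weights N N p)) w = pmf (weights N N p) (\<lambda>i j. w j i)" by simp
  also have "\<dots> = pmf (weights N N p) w"
    unfolding pmf_weights by (subst prod.swap) (auto intro!: if_cong)
  finally show "pmf (map_pmf (\<lambda>w i j. w j i) (weights N N p)) w = pmf (weights N N p) w" .
qed

lemma noncrossing_swap: "noncrossing C \<Longrightarrow> noncrossing (prod.swap ` C)"
proof (rule noncrossingI)
  fix e e' assume C: "noncrossing C" and e: "e \<in> prod.swap ` C" "e' \<in> prod.swap ` C" "e \<noteq> e'"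
  then have "prod.swap e \<in> C" "prod.swap e' \<in> C" "prod.swap e \<noteq> prod.swap e'" by auto
  from noncrossingD[OF C this] show "(fst e < fst e' \<and> snd e < snd e') \<or> (fst e' < fst e \<and> snd e' < snd e)"
    by auto
qed

text \<open>An optimal path leaves its axis no later than \<open>z0\<close>, so its boundary part is
  shorter than \<open>d\<close>; the rest is a chain inside the matrix.\<close>

lemma lpp_early_exit:
  assumes "\<not> late_exit N z0 l x w" "\<not> late_exit N z0 l y (\<lambda>i j. w j i)" "l \<le> real (lpp x y w N N)"
    and "real (\<Sum>i<z0. of_bool (x i)) < d" "real (\<Sum>i<z0. of_bool (y i)) < d"
  shows "\<exists>C\<subseteq>points w N N. noncrossing C \<and> l - d \<le> real (card C)"
proof -
  obtain C z where C: "C \<subseteq> points w N N" "noncrossing C" and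
     disj: "z \<le> N \<and> (\<forall>e\<in>C. z \<le> fst e) \<and> lpp x y w N N = (\<Sum>l<z. of_bool (x l)) + card C \<or>
      z \<le> N \<and> (\<forall>e\<in>C. z \<le> snd e) \<and> lpp x y w N N = (\<Sum>l<z. of_bool (y l)) + card C"
    using lpp_path[of w N N x y] by blast
  have bound: "real (\<Sum>i<z. of_bool (b i)) < d" if "z \<le> z0" "real (\<Sum>i<z0. of_bool (b i)) < d" for b :: "nat \<Rightarrow> bool"
  proof -
    have "(\<Sum>i<z. of_bool (b i)) \<le> (\<Sum>i<z0. of_bool (b i) :: nat)" using that by (intro sum_mono2) auto
    then show ?thesis using that(2) by linarith
  qed
  from disj show ?thesis
  proof (elim disjE conjE)
    assume z: "z \<le> N" "\<forall>e\<in>C. z \<le> fst e" "lpp x y w N N = (\<Sum>l<z. of_bool (x l)) + card C"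
    have "z \<le> z0" using assms(1,3) z C unfolding late_exit_def by (metis nat_le_linear)
    then have "real (\<Sum>i<z. of_bool (x i)) < d" using assms(4) by (rule bound)
    then have "l - d \<le> real (card C)" using z(3) assms(3) by linarith
    then show ?thesis using C by blast
  next
    assume z: "z \<le> N" "\<forall>e\<in>C. z \<le> snd e" "lpp x y w N N = (\<Sum>l<z. of_bool (y l)) + card C"
    have "prod.swap ` C \<subseteq> points (\<lambda>i j. w j i) N N" using C(1) by (auto simp: points_def)
    moreover have "noncrossing (prod.swap ` C)" using C(2) by (rule noncrossing_swap)
    moreover have "\<forall>e\<in>prod.swap ` C. z \<le> fst e" using z(2) by auto
    moreover have "card (prod.swap ` C) = card C" by (intro card_image) auto
    ultimately have "z \<le> z0" using assms(2,3) z unfolding late_exit_def by (metis nat_le_linear)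
    then have "real (\<Sum>i<z. of_bool (y i)) < d" using assms(5) by (rule bound)
    then have "l - d \<le> real (card C)" using z(3) assms(3) by linarith
    then show ?thesis using C by blast
  qed
qed

text \<open>The balance condition of \<open>local_stationarity\<close> says that the odds of
  \<open>u\<close> and \<open>v\<close> multiply to \<open>p\<close>. Here p = q^2 and the odds are
  a q and q / a; the tilt \<open>a\<close> trades sinks for sources.\<close>

lemma stationary_density:
  fixes a q :: real
  assumes "0 < a" "0 < q"
  defines "u \<equiv> a * q / (1 + a * q)" and "v \<equiv> q / a / (1 + q / a)"
  shows "u * v = q\<^sup>2 * (1 - u) * (1 - v)" "0 \<le> u" "u < 1" "0 \<le> v" "v < 1" "u \<le> a * q" "v \<le> q / a"
    "a * q - (a * q)\<^sup>2 \<le> u"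
proof -
  have pos: "0 < 1 + a * q" "0 < 1 + q / a" using assms by (auto simp: add_pos_pos)
  have gen: "1 - t / (1 + t) = 1 / (1 + t)" if "0 < 1 + t" for t :: real
    using that by (simp add: field_simps)
  have uu: "1 - u = 1 / (1 + a * q)" unfolding u_def using pos(1) by (rule gen)
  have vv: "1 - v = 1 / (1 + q / a)" unfolding v_def using pos(2) by (rule gen)
  show "u * v = q\<^sup>2 * (1 - u) * (1 - v)"
    unfolding uu vv unfolding u_def v_def using assms by (simp add: power2_eq_square)
  show "0 \<le> u" "0 \<le> v" using assms by (auto simp: u_def v_def)
  have "0 < 1 - u" "0 < 1 - v" unfolding uu vv using pos by auto
  then show "u < 1" "v < 1" by auto
  show "u \<le> a * q" unfolding u_def using assms pos by (simp add: field_simps)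
  show "v \<le> q / a" unfolding v_def using assms pos by (intro divide_le_eq[THEN iffD2]) (auto simp: algebra_simps)
  have "(a * q - (a * q)\<^sup>2) * (1 + a * q) \<le> a * q"
    using assms by (simp add: algebra_simps power2_eq_square)
  then show "a * q - (a * q)\<^sup>2 \<le> u" unfolding u_def using pos by (simp add: pos_le_divide_eq)
qed

text \<open>Tilting by \<open>a = 1 + \<epsilon>\<close> raises the mean passage time from about 2 T
  to at most about (2 + \<epsilon>^2) T, because the sum of \<open>a\<close> and its inverse has no
  linear term in \<epsilon>. A path that uses 2 \<epsilon> N sources gains about 2 \<epsilon>^2 T.
  The difference pays for five deviations \<open>s\<close> and for the terms quadratic in
  \<open>q\<close>, so such paths are unlikely to be optimal at the symmetric density
  \<open>u1\<close>. An early exit costs only about 2 \<epsilon> T.\<close>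

lemma lpp_lower:
  fixes \<epsilon> q :: real
  assumes \<epsilon>: "0 < \<epsilon>" "\<epsilon> \<le> 1/4" and q: "0 < q" "q \<le> \<epsilon>\<^sup>2 / 8" and T: "2000 / \<epsilon>^5 \<le> real N * q"
  shows "1 - \<epsilon> \<le> measure_pmf.prob (weights N N (q\<^sup>2))
     {w. \<exists>C\<subseteq>points w N N. noncrossing C \<and> 2 * (real N * q) * (1 - 2 * \<epsilon>) \<le> real (card C)}"
proof -
  define T where "T = real N * q"
  define a where "a = 1 + \<epsilon>"
  define u1 where "u1 = q / (1 + q)"
  define u where "u = a * q / (1 + a * q)"
  define v where "v = q / a / (1 + q / a)"
  define s where "s = \<epsilon>\<^sup>2 * T / 10"
  define z0 where "z0 = nat \<lceil>2 * \<epsilon> * real N\<rceil>"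
  define l where "l = 2 * (real N * u1) - 2 * s"
  define d where "d = real z0 * u1 + s"
  have a: "1 \<le> a" "a \<le> 5/4" using \<epsilon> by (auto simp: a_def)
  have st: "u * v = q\<^sup>2 * (1 - u) * (1 - v)" "0 \<le> u" "u < 1" "0 \<le> v" "v < 1" "u \<le> a * q" "v \<le> q / a"
    "a * q - (a * q)\<^sup>2 \<le> u"
    unfolding u_def v_def using a q(1) by (intro stationary_density; simp)+
  have st1: "u1 * u1 = q\<^sup>2 * (1 - u1) * (1 - u1)" "0 \<le> u1" "u1 < 1" "u1 \<le> q" "q - q\<^sup>2 \<le> u1"
    unfolding u1_def using stationary_density[of 1 q] q(1) by simp_all
  have \<epsilon>2: "0 < \<epsilon>\<^sup>2" "\<epsilon>\<^sup>2 \<le> \<epsilon> / 4" "\<epsilon>\<^sup>2 \<le> 1 / 16"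
  proof -
    show "0 < \<epsilon>\<^sup>2" using \<epsilon> by simp
    have "\<epsilon> * \<epsilon> \<le> \<epsilon> * (1/4)" using \<epsilon> by (intro mult_left_mono) auto
    then show *: "\<epsilon>\<^sup>2 \<le> \<epsilon> / 4" by (simp add: power2_eq_square)
    show "\<epsilon>\<^sup>2 \<le> 1 / 16" using * \<epsilon> by linarith
  qed
  have q1: "q \<le> 1 / 128" using q \<epsilon>2 by linarith
  have "\<epsilon>^5 \<le> 1" using \<epsilon> by (intro power_le_one) auto
  then have "2000 \<le> 2000 / \<epsilon>^5" using \<epsilon> by (simp add: le_divide_eq)
  then have T1: "2000 \<le> T" using T by (simp add: T_def)
  have s0: "0 < s" using \<epsilon>2 T1 by (simp add: s_def)
  have Tq: "T * q \<le> \<epsilon>\<^sup>2 * T / 8" using mult_left_mono[OF q(2), of T] T1 by (simp add: mult.commute)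
  have Nu1: "real N * u1 \<le> T" "T - T * q \<le> real N * u1"
    using mult_left_mono[OF st1(4), of "real N"] mult_left_mono[OF st1(5), of "real N"]
    by (simp_all add: T_def algebra_simps power2_eq_square)
  have Nu: "real N * u \<le> a * T" using mult_left_mono[OF st(6), of "real N"] by (simp add: T_def algebra_simps)
  have Nv: "real N * v \<le> T / a" using mult_left_mono[OF st(7), of "real N"] by (simp add: T_def)
  have a_inv: "T / a \<le> T - \<epsilon> * T + \<epsilon>\<^sup>2 * T"
  proof -
    have "1 / a \<le> 1 - \<epsilon> + \<epsilon>\<^sup>2" using \<epsilon> by (simp add: a_def field_simps power2_eq_square)
    from mult_left_mono[OF this, of T] T1 show ?thesis by (simp add: algebra_simps)
  qed
  have aT: "a * T = T + \<epsilon> * T" by (simp add: a_def algebra_simps)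
  have u_diff: "\<epsilon> * q - 2 * q\<^sup>2 \<le> u - u1"
  proof -
    have "a\<^sup>2 \<le> (5/4)\<^sup>2" using a by (intro power_mono) auto
    then have "(a * q)\<^sup>2 \<le> 2 * q\<^sup>2" unfolding power_mult_distrib by (intro mult_right_mono) (auto simp: power2_eq_square)
    then show ?thesis using st(8) st1(4) by (simp add: a_def algebra_simps)
  qed
  have "q * (2 * q) \<le> q * \<epsilon>" using q \<epsilon>2 \<epsilon> by (intro mult_left_mono) linarith+
  then have diff0: "0 \<le> \<epsilon> * q - 2 * q\<^sup>2" by (simp add: power2_eq_square mult_ac)
  then have u1u: "u1 \<le> u" using u_diff by linarith
  have z0: "2 * \<epsilon> * real N \<le> real z0" "real z0 \<le> 2 * \<epsilon> * real N + 1" "z0 \<le> N"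
  proof -
    have nn: "0 \<le> 2 * \<epsilon> * real N" using \<epsilon> by simp
    show "2 * \<epsilon> * real N \<le> real z0" unfolding z0_def by (rule of_nat_ceiling)
    show "real z0 \<le> 2 * \<epsilon> * real N + 1" unfolding z0_def using nn by linarith
    have "2 * \<epsilon> * real N \<le> 1 * real N" using \<epsilon> by (intro mult_right_mono) auto
    then show "z0 \<le> N" unfolding z0_def by (simp add: ceiling_le_iff nat_le_iff)
  qed
  have z0u: "2 * (\<epsilon>\<^sup>2 * T) - 4 * (\<epsilon> * (T * q)) \<le> real z0 * (u - u1)"
  proof -
    have "2 * \<epsilon> * real N * (\<epsilon> * q - 2 * q\<^sup>2) \<le> real z0 * (u - u1)"
      using z0 u_diff diff0 \<epsilon> by (intro mult_mono) auto
    then show ?thesis by (simp add: T_def algebra_simps power2_eq_square)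
  qed
  \<comment> \<open>Available is a surplus of \<epsilon>^2 T. The deviations take 5 s, half of it,
    and the quadratic terms take 3 T q, at most 3/8 of it.\<close>
  have l_large: "real N * (u + v) + 3 * s - real z0 * (u - u1) \<le> l"
  proof -
    have "\<epsilon> * (T * q) \<le> 1/4 * (T * q)" using \<epsilon> T1 q by (intro mult_right_mono) auto
    then show ?thesis unfolding l_def s_def distrib_left using Nu Nv Nu1 a_inv aT z0u Tq by linarith
  qed
  have ld: "2 * T * (1 - 2 * \<epsilon>) \<le> l - d"
  proof -
    have "real z0 * u1 \<le> (2 * \<epsilon> * real N + 1) * q" using z0 st1 \<epsilon> by (intro mult_mono) auto
    then have "real z0 * u1 \<le> 2 * (\<epsilon> * T) + q" by (simp add: T_def algebra_simps)
    moreover have "1 * q \<le> T * q" using T1 q by (intro mult_right_mono) auto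
    moreover have "\<epsilon>\<^sup>2 * T \<le> (\<epsilon> * T) / 4" using mult_right_mono[OF \<epsilon>2(2), of T] T1 by simp
    moreover have "2 * T * (1 - 2 * \<epsilon>) = 2 * T - 4 * (\<epsilon> * T)" by (simp add: algebra_simps)
    moreover have "0 \<le> \<epsilon> * T" using \<epsilon> T1 by simp
    ultimately show ?thesis unfolding l_def d_def s_def using Nu1 Tq by linarith
  qed
  define K where "K = boundary_law N N u1 u1 (q\<^sup>2)"
  define good where "good = {w. \<exists>C\<subseteq>points w N N. noncrossing C \<and> 2 * T * (1 - 2 * \<epsilon>) \<le> real (card C)}"
  let ?c = "(real N * u / s\<^sup>2 + real N * v / s\<^sup>2) + real z0 * (u - u1) / s\<^sup>2"
  let ?A = "{(x, y, w). 2 * s \<le> \<bar>real (lpp x y w N N) - real N * (u1 + u1)\<bar>}"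
  let ?L = "{(x, w). late_exit N z0 l x w}"
  let ?D = "{x. s \<le> \<bar>real (\<Sum>l<z0. of_bool (x l)) - real z0 * u1\<bar>}"
  define fx where "fx = (\<lambda>(x :: nat \<Rightarrow> bool, y :: nat \<Rightarrow> bool, w :: nat \<Rightarrow> nat \<Rightarrow> bool). (x, w))"
  define fy where "fy = (\<lambda>(x :: nat \<Rightarrow> bool, y :: nat \<Rightarrow> bool, w :: nat \<Rightarrow> nat \<Rightarrow> bool). (y, \<lambda>i j. w j i))"
  define gx where "gx = (\<lambda>(x :: nat \<Rightarrow> bool, y :: nat \<Rightarrow> bool, w :: nat \<Rightarrow> nat \<Rightarrow> bool). x)"
  define gy where "gy = (\<lambda>(x :: nat \<Rightarrow> bool, y :: nat \<Rightarrow> bool, w :: nat \<Rightarrow> nat \<Rightarrow> bool). y)"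
  define gw where "gw = (\<lambda>(x :: nat \<Rightarrow> bool, y :: nat \<Rightarrow> bool, w :: nat \<Rightarrow> nat \<Rightarrow> bool). w)"
  note law_simps = boundary_law_def map_pmf_def bind_assoc_pmf bind_return_pmf bind_return_pmf' pair_pmf_def
  have Kfx: "map_pmf fx K = pair_pmf (bern N u1) (weights N N (q\<^sup>2))"
    unfolding K_def fx_def by (simp add: law_simps)
  \<comment> \<open>Sources and sinks have the same density \<open>u1\<close>, so exchanging the
    axes preserves the law.\<close>
  have Kfy: "map_pmf fy K = pair_pmf (bern N u1) (weights N N (q\<^sup>2))"
  proof -
    have "map_pmf fy K = bind_pmf (bern N u1) (\<lambda>y.
        bind_pmf (map_pmf (\<lambda>w i j. w j i) (weights N N (q\<^sup>2))) (\<lambda>w. return_pmf (y, w)))"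
      by (simp add: K_def fy_def law_simps)
    then show ?thesis unfolding weights_transpose pair_pmf_def .
  qed
  have Kgx: "map_pmf gx K = bern N u1" unfolding K_def gx_def by (simp add: law_simps)
  have Kgy: "map_pmf gy K = bern N u1" unfolding K_def gy_def by (simp add: law_simps)
  have Kgw: "map_pmf gw K = weights N N (q\<^sup>2)" unfolding K_def gw_def by (simp add: law_simps)
  have q2: "0 \<le> q\<^sup>2" "q\<^sup>2 \<le> 1" using q q1 by (auto intro: power_le_one)
  have pL: "measure_pmf.prob (pair_pmf (bern N u1) (weights N N (q\<^sup>2))) ?L \<le> ?c"
    using st st1 u1u q2 s0 z0 l_large by (intro late_exit_prob) auto
  have pD: "measure_pmf.prob (bern N u1) ?D \<le> real z0 * u1 / s\<^sup>2"
    using st1 s0 z0 by (intro bern_deviation) auto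
  have "measure_pmf.prob K (gw -` (- good)) \<le>
     (((real N * u1 / s\<^sup>2 + real N * u1 / s\<^sup>2) + ?c) + ?c) + real z0 * u1 / s\<^sup>2 + real z0 * u1 / s\<^sup>2"
  proof (rule prob_le_add[OF _ prob_le_add[OF _ prob_le_add[OF _ prob_le_add]]])
    show "measure_pmf.prob K ?A \<le> real N * u1 / s\<^sup>2 + real N * u1 / s\<^sup>2"
      unfolding K_def using st1 q2 s0 by (intro lpp_deviation) auto
    show "measure_pmf.prob K (fx -` ?L) \<le> ?c" using Kfx pL by (rule prob_map_le)
    show "measure_pmf.prob K (fy -` ?L) \<le> ?c" using Kfy pL by (rule prob_map_le)
    show "measure_pmf.prob K (gx -` ?D) \<le> real z0 * u1 / s\<^sup>2" using Kgx pD by (rule prob_map_le)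
    show "measure_pmf.prob K (gy -` ?D) \<le> real z0 * u1 / s\<^sup>2" using Kgy pD by (rule prob_map_le)
    show "gw -` (- good) \<subseteq> (((?A \<union> fx -` ?L) \<union> fy -` ?L) \<union> gx -` ?D) \<union> gy -` ?D"
    proof (rule subsetI, rule ccontr)
      fix \<omega> assume bad: "\<omega> \<in> gw -` (- good)"
        and n: "\<omega> \<notin> (((?A \<union> fx -` ?L) \<union> fy -` ?L) \<union> gx -` ?D) \<union> gy -` ?D"
      obtain x y w where \<omega>: "\<omega> = (x, y, w)" by (metis prod.collapse)
      have n': "\<not> 2 * s \<le> \<bar>real (lpp x y w N N) - real N * (u1 + u1)\<bar>"
        "\<not> late_exit N z0 l x w" "\<not> late_exit N z0 l y (\<lambda>i j. w j i)"
        "\<not> s \<le> \<bar>real (\<Sum>l<z0. of_bool (x l)) - real z0 * u1\<bar>"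
        "\<not> s \<le> \<bar>real (\<Sum>l<z0. of_bool (y l)) - real z0 * u1\<bar>"
        using n unfolding \<omega> fx_def fy_def gx_def gy_def
        by (simp_all only: Un_iff vimage_eq mem_Collect_eq case_prod_conv de_Morgan_disj not_False_eq_True)
      have "l \<le> real (lpp x y w N N)" using n'(1) unfolding l_def distrib_left by linarith
      moreover have "real (\<Sum>i<z0. of_bool (x i)) < d" "real (\<Sum>i<z0. of_bool (y i)) < d"
        using n'(4,5) unfolding d_def by linarith+
      ultimately obtain C where C: "C \<subseteq> points w N N" "noncrossing C" "l - d \<le> real (card C)"
        using lpp_early_exit[OF n'(2,3)] by blast
      from C(3) ld have "2 * T * (1 - 2 * \<epsilon>) \<le> real (card C)" by linarith
      then have "w \<in> good" unfolding good_def using C(1,2) by blast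
      then show False using bad by (simp add: \<omega> gw_def)
    qed
  qed blast+
  also have "\<dots> = (2 * (real N * u1) + 2 * (real N * u + real N * v + real z0 * (u - u1)) + 2 * (real z0 * u1)) / s\<^sup>2"
    by (simp only: divide_inverse) algebra
  \<comment> \<open>2 + 2 (5/4 + 1 + 5/4) + 2 = 11, with \<open>z0 \<le> N\<close> for the two terms
    in \<open>z0\<close>. The quotient is 1100 / (\<epsilon>^4 T), which explains the fifth power in
    the bound on \<open>T\<close>.\<close>
  also have "\<dots> \<le> 11 * T / s\<^sup>2"
  proof (rule divide_right_mono)
    have "real z0 * (u - u1) \<le> real N * u" using z0(3) st1 u1u st by (intro mult_mono) auto
    moreover have "real z0 * u1 \<le> real N * u1" using z0(3) st1 by (intro mult_right_mono) auto
    moreover have "a * T \<le> 5 / 4 * T" using a T1 by (intro mult_right_mono) auto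
    moreover have "T / a \<le> T" using a T1 by (simp add: divide_le_eq mult_le_cancel_left1)
    moreover have "2 * x1 + 2 * (x2 + x3 + x4) + 2 * x5 \<le> 11 * t"
      if "x1 \<le> t" "x2 \<le> 5 / 4 * t" "x3 \<le> t" "x4 \<le> x2" "x5 \<le> x1" for x1 x2 x3 x4 x5 t :: real
      using that by argo
    ultimately show "2 * (real N * u1) + 2 * (real N * u + real N * v + real z0 * (u - u1)) + 2 * (real z0 * u1) \<le> 11 * T"
      using Nu Nv Nu1(1) by (meson order_trans)
  qed simp
  also have "\<dots> \<le> \<epsilon>"
  proof -
    have "2000 \<le> T * \<epsilon>^5" using T \<epsilon> unfolding T_def by (simp add: divide_le_eq)
    then have "1100 * T \<le> (T * \<epsilon>^5) * T" using T1 by (intro mult_right_mono) auto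
    also have "\<dots> = \<epsilon> * (s\<^sup>2 * 100)" by (simp add: s_def power2_eq_square power_def eval_nat_numeral)
    finally show ?thesis using s0 by (simp add: divide_le_eq)
  qed
  finally have "measure_pmf.prob (weights N N (q\<^sup>2)) (- good) \<le> \<epsilon>"
    unfolding Kgw[symmetric] by simp
  then have "1 - \<epsilon> \<le> measure_pmf.prob (weights N N (q\<^sup>2)) good"
    using measure_pmf.prob_compl[of good "weights N N (q\<^sup>2)"] by (simp add: Compl_eq_Diff_UNIV)
  then show ?thesis unfolding good_def T_def by simp
qed

section \<open>Blocks of two random words\<close>

lemma Pi_pmf_two_equal:
  assumes "finite V" "v \<in> V" "v' \<in> V" "v \<noteq> v'" "k > 0"
  shows "measure_pmf.prob (Pi_pmf V 0 (\<lambda>_. pmf_of_set {1..k})) {f. f v' = f v} \<le> 1 / real k"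
proof -
  have V: "V = insert v' (V - {v'})" using assms by auto
  have fin: "finite (set_pmf (Pi_pmf (V - {v'}) 0 (\<lambda>_. pmf_of_set {1..k})))"
    using assms by (intro finite_set_Pi_pmf) auto
  have "Pi_pmf V 0 (\<lambda>_. pmf_of_set {1..k}) =
    bind_pmf (Pi_pmf (V - {v'}) 0 (\<lambda>_. pmf_of_set {1..k})) (\<lambda>f. map_pmf (\<lambda>y. f(v' := y)) (pmf_of_set {1..k}))"
    by (subst V, subst Pi_pmf_insert') (use assms in \<open>auto simp: map_pmf_def intro: bind_commute_pmf\<close>)
  note split = this
  have "(\<lambda>y. f(v' := y)) -` {f. f v' = f v} = {f v}" for f :: "'a \<Rightarrow> nat"
    using assms(4) by (intro set_eqI) simp
  then have "measure_pmf.prob (Pi_pmf V 0 (\<lambda>_. pmf_of_set {1..k})) {f. f v' = f v} =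
    measure_pmf.expectation (Pi_pmf (V - {v'}) 0 (\<lambda>_. pmf_of_set {1..k}))
      (\<lambda>f. measure_pmf.prob (pmf_of_set {1..k}) {f v})"
    unfolding split prob_bind_finite[OF fin] measure_map_pmf by (simp only:)
  also have "\<dots> \<le> measure_pmf.expectation (Pi_pmf (V - {v'}) 0 (\<lambda>_. pmf_of_set {1..k})) (\<lambda>f. 1 / real k)"
    using assms by (intro expectation_mono_finite[OF fin]) (auto simp: measure_pmf_single indicator_def)
  finally show ?thesis by simp
qed

lemma Pi_pmf_in_set:
  assumes "finite V" "v \<in> V" "k > 0" "finite U"
  shows "measure_pmf.prob (Pi_pmf V 0 (\<lambda>_. pmf_of_set {1..k})) {f. f v \<in> U} \<le> real (card U) / real k"
proof -
  have "measure_pmf.prob (Pi_pmf V 0 (\<lambda>_. pmf_of_set {1..k})) {f. f v \<in> U} =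
    measure_pmf.prob (map_pmf (\<lambda>f. f v) (Pi_pmf V 0 (\<lambda>_. pmf_of_set {1..k}))) U"
    by (simp add: vimage_def)
  also have "\<dots> = real (card ({1..k} \<inter> U)) / real k"
    using assms by (simp add: Pi_pmf_component measure_pmf_of_set)
  also have "\<dots> \<le> real (card U) / real k"
    using assms by (intro divide_right_mono) (auto intro: card_mono)
  finally show ?thesis .
qed

text \<open>The whole equality pattern is prescribed, which makes the events for different
  \<open>E\<close> disjoint, so that their probabilities add up.\<close>

definition block_graph :: "(nat \<Rightarrow> vertex) \<Rightarrow> (nat \<Rightarrow> vertex) \<Rightarrow> nat \<Rightarrow> nat set \<Rightarrow> (nat \<times> nat) set \<Rightarrow> (vertex \<Rightarrow> nat) set" where
  "block_graph a b N U E = {\<sigma>. (\<forall>i<N. \<forall>j<N. \<sigma> (a i) = \<sigma> (b j) \<longleftrightarrow> (i, j) \<in> E) \<and> (\<forall>(i, j)\<in>E. \<sigma> (a i) \<notin> U)}"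

text \<open>Draw the first word. It is \<open>good\<close> if the symbols at the rows of
  \<open>E\<close> avoid \<open>U\<close> and occur nowhere else in the word. Given that, each
  matched letter of the second word must equal one symbol, and each unmatched one must avoid the at
  most \<open>N\<close> symbols of the first word.\<close>

lemma block_graph_prob:
  assumes inj: "inj a" "inj b" "range a \<inter> range b = {}" and "k > 0" "N \<le> k" "finite U"
    and E: "E \<subseteq> {..<N} \<times> {..<N}" "matching E"
  shows "(1 - real (card E) * (real (card U) + real N) / real k) *
      ((1 / real k) ^ card E * (1 - real N / real k) ^ N)
    \<le> measure_pmf.prob (words k (a ` {..<N} \<union> b ` {..<N})) (block_graph a b N U E)"
proof -
  define VA where "VA = a ` {..<N}"
  define VB where "VB = b ` {..<N}"
  define x where "x = (1 / real k) ^ card E * (1 - real N / real k) ^ N"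
  define merge where "merge f g = (\<lambda>v. if v \<in> VA then f v else g v)" for f g :: "vertex \<Rightarrow> nat"
  have finE: "finite E" using E(1) by (rule finite_subset) simp
  have x0: "0 \<le> x" using assms(4,5) by (simp add: x_def divide_le_eq)
  have fin: "finite (set_pmf (words k VA))" using assms by (intro finite_set_Pi_pmf) (auto simp: VA_def)
  define good where "good = {\<alpha>. \<forall>(i, j)\<in>E. \<alpha> (a i) \<notin> U \<and> (\<forall>i'<N. i' \<noteq> i \<longrightarrow> \<alpha> (a i') \<noteq> \<alpha> (a i))}"
  have inner: "indicator good \<alpha> * x \<le> measure_pmf.prob (map_pmf (merge \<alpha>) (words k VB)) (block_graph a b N U E)"
    if \<alpha>: "\<alpha> \<in> set_pmf (words k VA)" for \<alpha>
  proof (cases "\<alpha> \<in> good")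
    case True
    have \<alpha>k: "\<alpha> (a i) \<in> {1..k}" if "i < N" for i
      using \<alpha> that assms(4) by (auto simp: set_Pi_pmf VA_def PiE_dflt_def)
    \<comment> \<open>The symbols allowed at each position of the second word; the description is
      unique because \<open>E\<close> is a matching and \<open>b\<close> is injective.\<close>
    define S where "S v = (if \<exists>(i, j)\<in>E. v = b j then {\<alpha> (a (THE i. \<exists>j. (i, j) \<in> E \<and> v = b j))}
       else {1..k} - \<alpha> ` VA)" for v
    have S1: "S (b j) = {\<alpha> (a i)}" if "(i, j) \<in> E" for i j
    proof -
      have "(THE i. \<exists>j'. (i, j') \<in> E \<and> b j = b j') = i"
      proof (rule the_equality)
        show "\<exists>j'. (i, j') \<in> E \<and> b j = b j'" using that by blast
        fix i' assume "\<exists>j'. (i', j') \<in> E \<and> b j = b j'"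
        then have "(i', j) \<in> E" using inj(2) by (auto dest: injD)
        then show "i' = i" using E(2) that unfolding matching_def by (force dest: pairwiseD)
      qed
      then show ?thesis using that unfolding S_def by auto
    qed
    have S2: "S (b j) = {1..k} - \<alpha> ` VA" if "\<And>i. (i, j) \<notin> E" for j
      using that inj(2) unfolding S_def by (auto dest: injD)
    have sub: "merge \<alpha> \<beta> \<in> block_graph a b N U E" if \<beta>: "\<beta> \<in> Pi VB S" for \<beta>
    proof -
      have ma: "merge \<alpha> \<beta> (a i) = \<alpha> (a i)" if "i < N" for i using that by (simp add: merge_def VA_def)
      have mb: "merge \<alpha> \<beta> (b j) = \<beta> (b j)" for j using inj(3) by (auto simp: merge_def VA_def)
      have \<beta>S: "\<beta> (b j) \<in> S (b j)" if "j < N" for j using \<beta> that by (auto simp: VB_def)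
      have "(\<alpha> (a i) = \<beta> (b j)) \<longleftrightarrow> (i, j) \<in> E" if ij: "i < N" "j < N" for i j
      proof
        assume "(i, j) \<in> E"
        then show "\<alpha> (a i) = \<beta> (b j)" using \<beta>S[OF ij(2)] S1 by simp
      next
        assume eq: "\<alpha> (a i) = \<beta> (b j)"
        show "(i, j) \<in> E"
        proof (cases "\<exists>i0. (i0, j) \<in> E")
          case True
          then obtain i0 where i0: "(i0, j) \<in> E" by blast
          then have "\<alpha> (a i) = \<alpha> (a i0)" using \<beta>S[OF ij(2)] S1[OF i0] eq by simp
          then have "i = i0" using \<open>\<alpha> \<in> good\<close> i0 ij(1) unfolding good_def by blast
          then show ?thesis using i0 by simp
        next
          case False
          then have "\<beta> (b j) \<notin> \<alpha> ` VA" using \<beta>S[OF ij(2)] S2 by auto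
          moreover have "\<alpha> (a i) \<in> \<alpha> ` VA" using ij(1) by (simp add: VA_def)
          ultimately show ?thesis using eq by simp
        qed
      qed
      moreover have "merge \<alpha> \<beta> (a i) \<notin> U" if "(i, j) \<in> E" for i j
      proof -
        have "i < N" using that E(1) by auto
        then show ?thesis using True that unfolding good_def by (auto simp: ma)
      qed
      ultimately show ?thesis using ma mb unfolding block_graph_def by auto
    qed
    have card\<alpha>: "card (\<alpha> ` VA) \<le> N"
      unfolding VA_def image_image using card_image_le[of "{..<N}" "\<lambda>i. \<alpha> (a i)"] by simp
    have "x \<le> (\<Prod>v\<in>VB. measure_pmf.prob (pmf_of_set {1..k}) (S v))"
    proof -
      define J where "J = snd ` E"
      have injE: "inj_on snd E" using E(2) unfolding matching_def inj_on_def pairwise_def by blast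
      have cardJ: "card J = card E" unfolding J_def using injE by (rule card_image)
      have JN: "J \<subseteq> {..<N}" using E(1) by (auto simp: J_def)
      have "(\<Prod>v\<in>VB. measure_pmf.prob (pmf_of_set {1..k}) (S v)) =
          (\<Prod>j<N. measure_pmf.prob (pmf_of_set {1..k}) (S (b j)))"
        unfolding VB_def using inj(2) by (subst prod.reindex) (auto intro: inj_on_subset)
      also have "\<dots> = (\<Prod>j\<in>J. measure_pmf.prob (pmf_of_set {1..k}) (S (b j))) *
           (\<Prod>j\<in>{..<N} - J. measure_pmf.prob (pmf_of_set {1..k}) (S (b j)))"
        using JN by (subst prod.subset_diff[of J "{..<N}"]) (auto simp: mult.commute)
      also have "(\<Prod>j\<in>J. measure_pmf.prob (pmf_of_set {1..k}) (S (b j))) = (\<Prod>j\<in>J. 1 / real k)"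
      proof (rule prod.cong[OF refl])
        fix j assume "j \<in> J"
        then obtain i where i: "(i, j) \<in> E" by (auto simp: J_def)
        then have "\<alpha> (a i) \<in> {1..k}" using E(1) \<alpha>k by auto
        then show "measure_pmf.prob (pmf_of_set {1..k}) (S (b j)) = 1 / real k"
          using assms(4) by (simp add: S1[OF i] measure_pmf_single)
      qed
      also have "\<dots> = (1 / real k) ^ card E" by (simp add: cardJ)
      finally have prod_eq: "(\<Prod>v\<in>VB. measure_pmf.prob (pmf_of_set {1..k}) (S v)) = (1 / real k) ^ card E *
          (\<Prod>j\<in>{..<N} - J. measure_pmf.prob (pmf_of_set {1..k}) (S (b j)))" .
      have rest: "(1 - real N / real k) ^ card ({..<N} - J) \<le>
          (\<Prod>j\<in>{..<N} - J. measure_pmf.prob (pmf_of_set {1..k}) (S (b j)))"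
      proof -
        have "1 - real N / real k \<le> measure_pmf.prob (pmf_of_set {1..k}) (S (b j))" if "j \<in> {..<N} - J" for j
        proof -
          have Sj: "S (b j) = {1..k} - \<alpha> ` VA" using that by (intro S2) (force simp: J_def)
          have "finite (\<alpha> ` VA)" by (simp add: VA_def)
          then have "k - card (\<alpha> ` VA) \<le> card ({1..k} - \<alpha> ` VA)"
            using diff_card_le_card_Diff[of "\<alpha> ` VA" "{1..k}"] by simp
          then have "real k - real N \<le> real (card ({1..k} - \<alpha> ` VA))" using card\<alpha> by linarith
          then have "(real k - real N) / real k \<le> real (card ({1..k} - \<alpha> ` VA)) / real k"
            by (rule divide_right_mono) simp
          moreover have "{1..k} \<inter> ({1..k} - \<alpha> ` VA) = {1..k} - \<alpha> ` VA" by blast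
          ultimately show ?thesis
            unfolding Sj using assms(4) by (simp add: measure_pmf_of_set diff_divide_distrib)
        qed
        then have "(\<Prod>j\<in>{..<N} - J. 1 - real N / real k) \<le>
            (\<Prod>j\<in>{..<N} - J. measure_pmf.prob (pmf_of_set {1..k}) (S (b j)))"
          using assms(4,5) by (intro prod_mono) (auto simp: divide_le_eq)
        then show ?thesis by simp
      qed
      have prod_ge: "(1 / real k) ^ card E * (1 - real N / real k) ^ card ({..<N} - J) \<le>
          (\<Prod>v\<in>VB. measure_pmf.prob (pmf_of_set {1..k}) (S v))"
        unfolding prod_eq using rest by (rule mult_left_mono) simp
      \<comment> \<open>Only \<open>N - card E\<close> positions are unmatched; the larger exponent
        gives the form that \<open>one_minus_power_compare\<close> bounds from below.\<close>
      have "(1 - real N / real k) ^ N \<le> (1 - real N / real k) ^ card ({..<N} - J)"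
        using assms(4,5) card_mono[of "{..<N}" "{..<N} - J"] by (intro power_decreasing) (auto simp: divide_le_eq)
      then have "x \<le> (1 / real k) ^ card E * (1 - real N / real k) ^ card ({..<N} - J)"
        unfolding x_def by (rule mult_left_mono) simp
      then show ?thesis using prod_ge by (rule order_trans)
    qed
    also have "\<dots> = measure_pmf.prob (words k VB) (Pi VB S)"
      by (rule measure_Pi_pmf_Pi[symmetric]) (simp add: VB_def)
    also have "\<dots> \<le> measure_pmf.prob (words k VB) (merge \<alpha> -` block_graph a b N U E)"
      using sub by (intro measure_pmf.finite_measure_mono) auto
    finally show ?thesis using True by simp
  qed simp
  have bad: "measure_pmf.prob (words k VA) (- good) \<le> real (card E) * (real (card U) + real N) / real k"
  proof -
    \<comment> \<open>The two ways an edge spoils the first word: its symbol is forbidden, or it is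
      repeated at another position.\<close>
    define F where "F e = {\<alpha>. \<alpha> (a (fst e)) \<in> U} \<union> (\<Union>i'\<in>{..<N} - {fst e}. {\<alpha>. \<alpha> (a i') = \<alpha> (a (fst e))})" for e :: "nat \<times> nat"
    have Fe: "measure_pmf.prob (words k VA) (F e) \<le> (real (card U) + real N) / real k" if "e \<in> E" for e
    proof -
      have e: "fst e < N" using that E(1) by auto
      have "measure_pmf.prob (words k VA) (F e) \<le> measure_pmf.prob (words k VA) {\<alpha>. \<alpha> (a (fst e)) \<in> U} +
         measure_pmf.prob (words k VA) (\<Union>i'\<in>{..<N} - {fst e}. {\<alpha>. \<alpha> (a i') = \<alpha> (a (fst e))})"
        unfolding F_def by (rule measure_Un_le) auto
      also have "measure_pmf.prob (words k VA) {\<alpha>. \<alpha> (a (fst e)) \<in> U} \<le> real (card U) / real k"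
        using e assms by (intro Pi_pmf_in_set) (auto simp: VA_def)
      also have "measure_pmf.prob (words k VA) (\<Union>i'\<in>{..<N} - {fst e}. {\<alpha>. \<alpha> (a i') = \<alpha> (a (fst e))})
          \<le> (\<Sum>i'\<in>{..<N} - {fst e}. measure_pmf.prob (words k VA) {\<alpha>. \<alpha> (a i') = \<alpha> (a (fst e))})"
        by (rule measure_UNION_le) auto
      also have "\<dots> \<le> (\<Sum>i'\<in>{..<N} - {fst e}. 1 / real k)"
        using e assms(4) inj(1) by (intro sum_mono Pi_pmf_two_equal) (auto simp: VA_def dest: injD)
      also have "\<dots> \<le> real N * (1 / real k)"
        using e by (simp add: divide_right_mono)
      finally show ?thesis by (simp add: add_divide_distrib)
    qed
    have "- good \<subseteq> (\<Union>e\<in>E. F e)" unfolding good_def F_def by fastforce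
    then have "measure_pmf.prob (words k VA) (- good) \<le> measure_pmf.prob (words k VA) (\<Union>e\<in>E. F e)"
      by (intro measure_pmf.finite_measure_mono) auto
    also have "\<dots> \<le> (\<Sum>e\<in>E. measure_pmf.prob (words k VA) (F e))"
      using finE by (intro measure_UNION_le) auto
    also have "\<dots> \<le> (\<Sum>e\<in>E. (real (card U) + real N) / real k)" using Fe by (rule sum_mono)
    finally show ?thesis by simp
  qed
  have union: "words k (VA \<union> VB) = bind_pmf (words k VA) (\<lambda>\<alpha>. map_pmf (merge \<alpha>) (words k VB))"
  proof -
    have "words k (VA \<union> VB) = map_pmf (\<lambda>(f, g) v. if v \<in> VA then f v else g v) (pair_pmf (words k VA) (words k VB))"
      using inj(3) by (intro Pi_pmf_union) (auto simp: VA_def VB_def)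
    then show ?thesis by (simp add: merge_def[abs_def] pair_pmf_def map_pmf_def bind_assoc_pmf bind_return_pmf)
  qed
  have "(1 - real (card E) * (real (card U) + real N) / real k) * x \<le> measure_pmf.prob (words k VA) good * x"
    using bad measure_pmf.prob_compl[of good "words k VA"] x0
    by (intro mult_right_mono) (auto simp: Compl_eq_Diff_UNIV)
  also have "\<dots> = measure_pmf.expectation (words k VA) (\<lambda>\<alpha>. indicator good \<alpha> * x)" by simp
  also have "\<dots> \<le> measure_pmf.expectation (words k VA)
      (\<lambda>\<alpha>. measure_pmf.prob (map_pmf (merge \<alpha>) (words k VB)) (block_graph a b N U E))"
    using fin inner by (rule expectation_mono_finite)
  also have "\<dots> = measure_pmf.prob (words k (VA \<union> VB)) (block_graph a b N U E)"
    unfolding union by (rule prob_bind_finite[OF fin, symmetric])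
  finally show ?thesis by (simp add: x_def VA_def VB_def)
qed

section \<open>Independent cells compared with random words\<close>

abbreviation grid :: "nat \<Rightarrow> (nat \<times> nat) set" where
  "grid N \<equiv> {..<N} \<times> {..<N}"

definition random_cells :: "nat \<Rightarrow> real \<Rightarrow> (nat \<times> nat) set pmf" where
  "random_cells N p = map_pmf (\<lambda>f. {e \<in> grid N. f e}) (Pi_pmf (grid N) False (\<lambda>_. bernoulli_pmf p))"

text \<open>Both laws are products over the same cells, drawn by rows on one side and all at once on
  the other.\<close>

lemma weights_random_cells: "map_pmf (\<lambda>w. points w N N) (weights N N p) = random_cells N p"
proof -
  define flat where "flat = Pi_pmf (grid N) False (\<lambda>_. bernoulli_pmf p)"
  have "weights N N p = map_pmf (\<lambda>f j i. f (i, j)) flat"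
  proof (rule pmf_eqI)
    fix w :: "nat \<Rightarrow> nat \<Rightarrow> bool"
    have "inj (\<lambda>(f :: nat \<times> nat \<Rightarrow> bool) j i. f (i, j))" by (auto simp: inj_def fun_eq_iff)
    from pmf_map_inj'[OF this, of flat "\<lambda>(i, j). w j i"]
    have "pmf (map_pmf (\<lambda>f j i. f (i, j)) flat) w = pmf flat (\<lambda>(i, j). w j i)" by simp
    also have "\<dots> = (if \<forall>e. e \<notin> grid N \<longrightarrow> (case e of (i, j) \<Rightarrow> w j i) = False
        then \<Prod>e\<in>grid N. pmf (bernoulli_pmf p) (case e of (i, j) \<Rightarrow> w j i) else 0)"
      unfolding flat_def by (rule pmf_Pi) simp
    also have "(\<forall>e. e \<notin> grid N \<longrightarrow> (case e of (i, j) \<Rightarrow> w j i) = False) \<longleftrightarrow> (\<forall>j i. N \<le> j \<or> N \<le> i \<longrightarrow> \<not> w j i)"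
      by (auto simp: not_less)
    also have "(\<Prod>e\<in>grid N. pmf (bernoulli_pmf p) (case e of (i, j) \<Rightarrow> w j i)) =
        (\<Prod>i<N. \<Prod>j<N. pmf (bernoulli_pmf p) (w j i))"
      by (subst prod.cartesian_product) (auto intro!: prod.cong)
    also have "\<dots> = (\<Prod>j<N. \<Prod>i<N. pmf (bernoulli_pmf p) (w j i))" by (rule prod.swap)
    finally show "pmf (weights N N p) w = pmf (map_pmf (\<lambda>f j i. f (i, j)) flat) w"
      unfolding pmf_weights by simp
  qed
  then show ?thesis unfolding random_cells_def flat_def[symmetric]
    by (simp add: pmf.map_comp o_def) (auto intro!: map_pmf_cong simp: points_def)
qed

lemma random_cells_on:
  assumes "0 \<le> p" "p \<le> 1" "D \<subseteq> grid N"
  shows "measure_pmf.prob (random_cells N p) {E. D \<subseteq> E} = p ^ card D"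
proof -
  have eq: "(\<lambda>f. {e \<in> grid N. f e}) -` {E. D \<subseteq> E} = Pi (grid N) (\<lambda>e. if e \<in> D then {True} else UNIV)"
    using assms(3) by (auto simp: Pi_def split: if_splits)
  have "measure_pmf.prob (random_cells N p) {E. D \<subseteq> E} =
      (\<Prod>e\<in>grid N. measure_pmf.prob (bernoulli_pmf p) (if e \<in> D then {True} else UNIV))"
    unfolding random_cells_def measure_map_pmf eq by (rule measure_Pi_pmf_Pi) simp
  also have "\<dots> = (\<Prod>e\<in>grid N. if e \<in> D then p else 1)"
    using assms by (intro prod.cong) (auto simp: measure_pmf_single)
  also have "\<dots> = (\<Prod>e\<in>{e \<in> grid N. e \<in> D}. p)" by (rule prod.inter_filter[symmetric]) simp
  also have "{e \<in> grid N. e \<in> D} = D" using assms(3) by blast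
  finally show ?thesis by simp
qed

lemma pmf_random_cells:
  assumes "0 \<le> p" "p \<le> 1" "E \<subseteq> grid N"
  shows "pmf (random_cells N p) E = p ^ card E * (1 - p) ^ (N * N - card E)"
proof -
  have fin: "finite E" using assms(3) by (rule finite_subset) simp
  have eq: "(\<lambda>f. {e \<in> grid N. f e}) -` {E} = Pi (grid N) (\<lambda>e. {e \<in> E})"
    using assms(3) by (auto simp: Pi_def)
  have "pmf (random_cells N p) E = (\<Prod>e\<in>grid N. measure_pmf.prob (bernoulli_pmf p) {e \<in> E})"
    unfolding random_cells_def pmf_map eq by (rule measure_Pi_pmf_Pi) simp
  also have "\<dots> = (\<Prod>e\<in>grid N. if e \<in> E then p else 1 - p)"
    using assms by (intro prod.cong) (auto simp: measure_pmf_single)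
  also have "\<dots> = (\<Prod>e\<in>E. if e \<in> E then p else 1 - p) * (\<Prod>e\<in>grid N - E. if e \<in> E then p else 1 - p)"
    using assms(3) by (subst prod.subset_diff[of E "grid N"]) (auto simp: mult.commute)
  also have "(\<Prod>e\<in>E. if e \<in> E then p else 1 - p) = p ^ card E" by simp
  also have "(\<Prod>e\<in>grid N - E. if e \<in> E then p else 1 - p) = (\<Prod>e\<in>grid N - E. 1 - p)"
    by (rule prod.cong) auto
  also have "\<dots> = (1 - p) ^ (N * N - card E)"
    using assms(3) fin by (simp add: card_Diff_subset)
  finally show ?thesis .
qed

lemma set_random_cells: "set_pmf (random_cells N p) \<subseteq> Pow (grid N)"
  by (auto simp: random_cells_def)

lemma expectation_card_random_cells:
  assumes "0 \<le> p" "p \<le> 1"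
  shows "measure_pmf.expectation (random_cells N p) (\<lambda>E. real (card E)) = real (N * N) * p"
proof -
  have fin: "finite (set_pmf (random_cells N p))"
    using set_random_cells by (rule finite_subset) simp
  have "measure_pmf.expectation (random_cells N p) (\<lambda>E. real (card E)) =
      measure_pmf.expectation (random_cells N p) (\<lambda>E. \<Sum>e\<in>grid N. indicator {E. {e} \<subseteq> E} E)"
  proof (rule integral_cong_AE)
    show "AE E in random_cells N p. real (card E) = (\<Sum>e\<in>grid N. indicator {E. {e} \<subseteq> E} E)"
    proof (subst AE_measure_pmf_iff, rule ballI)
      fix E assume "E \<in> set_pmf (random_cells N p)"
      then have E: "E \<subseteq> grid N" using set_random_cells by blast
      have "(\<Sum>e\<in>grid N. indicator {E. {e} \<subseteq> E} E) = (\<Sum>e\<in>grid N. if e \<in> E then 1 else 0 :: real)"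
        by (rule sum.cong) (auto simp: indicator_def)
      also have "\<dots> = real (card E)"
        using E by (subst sum.inter_restrict[symmetric]) (auto simp: Int_absorb1)
      finally show "real (card E) = (\<Sum>e\<in>grid N. indicator {E. {e} \<subseteq> E} E)" ..
    qed
  qed auto
  also have "\<dots> = (\<Sum>e\<in>grid N. measure_pmf.expectation (random_cells N p) (indicator {E. {e} \<subseteq> E}))"
    by (rule Bochner_Integration.integral_sum) (rule integrable_measure_pmf_finite[OF fin])
  also have "\<dots> = (\<Sum>e\<in>grid N. measure_pmf.prob (random_cells N p) {E. {e} \<subseteq> E})" by simp
  also have "\<dots> = (\<Sum>e\<in>grid N. p)"
    using assms by (intro sum.cong refl) (subst random_cells_on, auto)
  finally show ?thesis by simp
qed

text \<open>Union bound over a cell and one of at most \<open>2 * N\<close> other cells in its row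
  or column.\<close>

lemma random_cells_not_matching:
  assumes "0 \<le> p" "p \<le> 1"
  shows "measure_pmf.prob (random_cells N p) {E. E \<subseteq> grid N \<and> \<not> matching E} \<le> 2 * real N ^ 3 * p\<^sup>2"
proof -
  define W where "W e = ({fst e} \<times> {..<N} \<union> {..<N} \<times> {snd e}) - {e}" for e :: "nat \<times> nat"
  have finW: "finite (W e)" for e by (simp add: W_def)
  have cardW: "card (W e) \<le> 2 * N" for e
  proof -
    have "card (W e) \<le> card ({fst e} \<times> {..<N} \<union> {..<N} \<times> {snd e})" unfolding W_def by (intro card_mono) auto
    also have "\<dots> \<le> card ({fst e} \<times> {..<N}) + card ({..<N} \<times> {snd e})" by (rule card_Un_le)
    finally show ?thesis by simp
  qed
  have "{E. E \<subseteq> grid N \<and> \<not> matching E} \<subseteq> (\<Union>e\<in>grid N. \<Union>e'\<in>W e. {E. E \<subseteq> grid N \<and> {e, e'} \<subseteq> E})"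
  proof
    fix E assume "E \<in> {E. E \<subseteq> grid N \<and> \<not> matching E}"
    then obtain e e' where E: "E \<subseteq> grid N" "e \<in> E" "e' \<in> E" "e \<noteq> e'" "fst e = fst e' \<or> snd e = snd e'"
      unfolding matching_def pairwise_def by blast
    then have "e' \<in> W e" unfolding W_def by (cases e; cases e') auto
    then show "E \<in> (\<Union>e\<in>grid N. \<Union>e'\<in>W e. {E. E \<subseteq> grid N \<and> {e, e'} \<subseteq> E})" using E by blast
  qed
  then have "measure_pmf.prob (random_cells N p) {E. E \<subseteq> grid N \<and> \<not> matching E} \<le>
      measure_pmf.prob (random_cells N p) (\<Union>e\<in>grid N. \<Union>e'\<in>W e. {E. E \<subseteq> grid N \<and> {e, e'} \<subseteq> E})"
    by (intro measure_pmf.finite_measure_mono) auto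
  also have "\<dots> \<le> (\<Sum>e\<in>grid N. measure_pmf.prob (random_cells N p) (\<Union>e'\<in>W e. {E. E \<subseteq> grid N \<and> {e, e'} \<subseteq> E}))"
    by (rule measure_UNION_le) auto
  also have "\<dots> \<le> (\<Sum>e\<in>grid N. 2 * real N * p\<^sup>2)"
  proof (rule sum_mono)
    fix e
    have "measure_pmf.prob (random_cells N p) (\<Union>e'\<in>W e. {E. E \<subseteq> grid N \<and> {e, e'} \<subseteq> E}) \<le>
       (\<Sum>e'\<in>W e. measure_pmf.prob (random_cells N p) {E. E \<subseteq> grid N \<and> {e, e'} \<subseteq> E})"
      using finW by (intro measure_UNION_le) auto
    also have "\<dots> \<le> (\<Sum>e'\<in>W e. p\<^sup>2)"
    proof (rule sum_mono)
      fix e' assume e': "e' \<in> W e"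
      show "measure_pmf.prob (random_cells N p) {E. E \<subseteq> grid N \<and> {e, e'} \<subseteq> E} \<le> p\<^sup>2"
      proof (cases "{e, e'} \<subseteq> grid N")
        case True
        have "measure_pmf.prob (random_cells N p) {E. E \<subseteq> grid N \<and> {e, e'} \<subseteq> E} \<le>
            measure_pmf.prob (random_cells N p) {E. {e, e'} \<subseteq> E}"
          by (intro measure_pmf.finite_measure_mono) auto
        also have "\<dots> = p ^ card {e, e'}" using assms True by (rule random_cells_on)
        also have "card {e, e'} = 2" using e' by (auto simp: W_def)
        finally show ?thesis .
      next
        case False
        then have empty: "{E. E \<subseteq> grid N \<and> {e, e'} \<subseteq> E} = {}" by blast
        show ?thesis unfolding empty by simp
      qed
    qed
    also have "\<dots> \<le> 2 * real N * p\<^sup>2"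
    proof -
      have "real (card (W e)) \<le> 2 * real N" using cardW[of e] by linarith
      then show ?thesis by (simp add: mult_right_mono)
    qed
    finally show "measure_pmf.prob (random_cells N p) (\<Union>e'\<in>W e. {E. E \<subseteq> grid N \<and> {e, e'} \<subseteq> E}) \<le> 2 * real N * p\<^sup>2" .
  qed
  also have "\<dots> = 2 * real N ^ 3 * p\<^sup>2" by (simp add: power3_eq_cube)
  finally show ?thesis .
qed

lemma one_minus_prod_le:
  fixes x y z :: real
  assumes "0 \<le> x" "x \<le> 1" "0 \<le> y" "y \<le> 1" "0 \<le> z" "z \<le> 1"
  shows "1 - x - y - z \<le> (1 - x) * (1 - y) * (1 - z)"
proof -
  have "(1 - x - y) * (1 - z) \<le> (1 - x) * (1 - y) * (1 - z)"
    using assms by (intro mult_right_mono) (auto simp: algebra_simps)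
  moreover have "(x + y) * z \<ge> 0" using assms by simp
  ultimately show ?thesis by (simp add: algebra_simps)
qed

text \<open>The absent edges contribute (1 - p)^(N N) for independent cells and (1 - N p)^N for
  words; the latter is hardly smaller. Bernoulli's inequality bounds the relative loss in one row by
  (N p)^2, and a second use over \<open>N\<close> rows by N^3 p^2.\<close>

lemma one_minus_power_compare:
  fixes p :: real
  assumes "0 \<le> p" "p \<le> 1" "real N * p \<le> 1"
  shows "(1 - p) ^ (N * N) * (1 - real N ^ 3 * p\<^sup>2) \<le> (1 - real N * p) ^ N"
proof -
  have base: "(1 - p) ^ N * (1 - (real N * p)\<^sup>2) \<le> 1 - real N * p"
  proof -
    have "(1 - p) ^ N * (1 + real N * p) \<le> (1 - p) ^ N * (1 + p) ^ N"
      using assms Bernoulli_inequality[of p N] by (intro mult_left_mono) auto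
    also have "\<dots> = (1 - p\<^sup>2) ^ N" by (simp add: power_mult_distrib[symmetric] power2_eq_square algebra_simps)
    also have "\<dots> \<le> 1" using assms by (intro power_le_one) (auto simp: power_le_one)
    finally have "(1 - p) ^ N * (1 + real N * p) * (1 - real N * p) \<le> 1 * (1 - real N * p)"
      using assms by (intro mult_right_mono) auto
    then show ?thesis by (simp add: power2_eq_square algebra_simps)
  qed
  have sq: "(real N * p)\<^sup>2 \<le> 1" using assms by (intro power_le_one) auto
  have "1 + real N * (- (real N * p)\<^sup>2) \<le> (1 + (- (real N * p)\<^sup>2)) ^ N"
    using sq by (intro Bernoulli_inequality) auto
  then have "(1 - p) ^ (N * N) * (1 - real N ^ 3 * p\<^sup>2) \<le> (1 - p) ^ (N * N) * (1 - (real N * p)\<^sup>2) ^ N"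
    using assms by (intro mult_left_mono) (auto simp: power2_eq_square power3_eq_cube algebra_simps)
  also have "\<dots> = ((1 - p) ^ N * (1 - (real N * p)\<^sup>2)) ^ N" by (simp add: power_mult_distrib power_mult)
  also have "\<dots> \<le> (1 - real N * p) ^ N" using base sq assms by (intro power_mono) auto
  finally show ?thesis .
qed

text \<open>Of the error terms, \<open>x\<close> accounts for a bad first word, \<open>y\<close> for
  completing the exponent \<open>N * N - M\<close> to \<open>N * N\<close>, and \<open>z\<close> for
  \<open>one_minus_power_compare\<close>. If one of them exceeds 1, the left-hand side is at most
  0.\<close>

lemma block_graph_prob_ge:
  assumes inj: "inj a" "inj b" "range a \<inter> range b = {}" and "k > 0" "N \<le> k" "finite U"
    and E: "E \<subseteq> grid N" "matching E"
  shows "pmf (random_cells N (1 / real k)) E *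
      (1 - real N ^ 3 * (1 / real k)\<^sup>2 - real (card E) * (real (card U) + real N + 1) / real k)
    \<le> measure_pmf.prob (words k (a ` {..<N} \<union> b ` {..<N})) (block_graph a b N U E)"
proof -
  define p where "p = 1 / real k"
  define M where "M = card E"
  define x where "x = real M * (real (card U) + real N) * p"
  define y where "y = real M * p"
  define z where "z = real N ^ 3 * p\<^sup>2"
  define P where "P = measure_pmf.prob (words k (a ` {..<N} \<union> b ` {..<N})) (block_graph a b N U E)"
  have p: "0 \<le> p" "p \<le> 1" "real N * p \<le> 1" using assms(4,5) by (auto simp: p_def divide_le_eq)
  have xyz: "0 \<le> x" "0 \<le> y" "0 \<le> z" using p by (auto simp: x_def y_def z_def)
  have M: "M \<le> N * N" using card_mono[OF _ E(1)] by (simp add: M_def)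
  have eq: "1 - real N ^ 3 * (1 / real k)\<^sup>2 - real (card E) * (real (card U) + real N + 1) / real k = 1 - x - y - z"
    by (simp add: x_def y_def z_def p_def M_def algebra_simps add_divide_distrib)
  have Q: "pmf (random_cells N p) E = p ^ M * (1 - p) ^ (N * N - M)"
    unfolding M_def using p(1,2) E(1) by (rule pmf_random_cells)
  have "pmf (random_cells N p) E * (1 - x - y - z) \<le> P"
  proof (cases "x \<le> 1 \<and> y \<le> 1 \<and> z \<le> 1")
    case False
    then have "1 - x - y - z \<le> 0" using xyz by linarith
    then have "pmf (random_cells N p) E * (1 - x - y - z) \<le> 0" by (simp add: mult_nonneg_nonpos)
    also have "0 \<le> P" by (simp add: P_def)
    finally show ?thesis .
  next
    case True
    have "1 - y \<le> (1 - p) ^ M" using Bernoulli_inequality[of "- p" M] p by (simp add: y_def)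
    then have "(1 - p) ^ (N * N - M) * (1 - y) \<le> (1 - p) ^ (N * N - M) * (1 - p) ^ M"
      using p by (intro mult_left_mono) auto
    also have "\<dots> = (1 - p) ^ (N * N)" using M by (simp add: power_add[symmetric])
    finally have "(1 - p) ^ (N * N - M) * (1 - y) * (1 - z) \<le> (1 - p) ^ (N * N) * (1 - z)"
      using True by (intro mult_right_mono) auto
    also have "\<dots> \<le> (1 - real N * p) ^ N" unfolding z_def using p by (rule one_minus_power_compare)
    finally have step: "(1 - p) ^ (N * N - M) * (1 - y) * (1 - z) \<le> (1 - real N * p) ^ N" .
    have "pmf (random_cells N p) E * (1 - x - y - z) \<le> pmf (random_cells N p) E * ((1 - x) * (1 - y) * (1 - z))"
      using True xyz by (intro mult_left_mono one_minus_prod_le) auto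
    also have "\<dots> = (1 - x) * (p ^ M * ((1 - p) ^ (N * N - M) * (1 - y) * (1 - z)))"
      unfolding Q by (simp add: mult_ac)
    also have "\<dots> \<le> (1 - x) * (p ^ M * (1 - real N * p) ^ N)"
      using True step p by (intro mult_left_mono) auto
    also have "\<dots> \<le> P"
      using block_graph_prob[OF assms] unfolding P_def x_def p_def M_def by simp
    finally show ?thesis .
  qed
  then show ?thesis unfolding eq unfolding P_def p_def .
qed

text \<open>Exactly \<open>h\<close> edges are required, so that every successful block adds exactly
  \<open>h\<close> symbols to the forbidden ones.\<close>

definition block_success :: "(nat \<Rightarrow> vertex) \<Rightarrow> (nat \<Rightarrow> vertex) \<Rightarrow> nat \<Rightarrow> nat \<Rightarrow> nat set \<Rightarrow> (vertex \<Rightarrow> nat) set" where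
  "block_success a b N h U = {\<sigma>. \<exists>C\<subseteq>grid N. noncrossing C \<and> card C = h \<and>
     (\<forall>e\<in>C. \<sigma> (a (fst e)) = \<sigma> (b (snd e)) \<and> \<sigma> (a (fst e)) \<notin> U) \<and> inj_on (\<lambda>e. \<sigma> (a (fst e))) C}"

text \<open>Absence of repetitions comes for free: two edges with the same symbol would produce the
  edge from the row of one to the column of the other, contradicting that the pattern is a
  matching.\<close>

lemma block_graph_success:
  assumes "E \<subseteq> grid N" "matching E" "C \<subseteq> E" "noncrossing C" "h \<le> card C"
  shows "block_graph a b N U E \<subseteq> block_success a b N h U"
proof
  fix \<sigma> assume \<sigma>: "\<sigma> \<in> block_graph a b N U E"
  obtain C' where C': "C' \<subseteq> C" "card C' = h" using assms(5) obtain_subset_with_card_n by metis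
  have eq: "\<sigma> (a i) = \<sigma> (b j) \<longleftrightarrow> (i, j) \<in> E" if "i < N" "j < N" for i j
    using \<sigma> that by (simp add: block_graph_def)
  have E: "fst e < N" "snd e < N" "\<sigma> (a (fst e)) = \<sigma> (b (snd e))" "\<sigma> (a (fst e)) \<notin> U" if "e \<in> E" for e
  proof -
    show lt: "fst e < N" "snd e < N" using that assms(1) by auto
    show "\<sigma> (a (fst e)) = \<sigma> (b (snd e))" using eq[OF lt] that by simp
    show "\<sigma> (a (fst e)) \<notin> U" using \<sigma> that by (auto simp: block_graph_def)
  qed
  have inj: "inj_on (\<lambda>e. \<sigma> (a (fst e))) E"
  proof (rule inj_onI)
    fix e e' assume e: "e \<in> E" "e' \<in> E" "\<sigma> (a (fst e)) = \<sigma> (a (fst e'))"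
    then have "\<sigma> (a (fst e)) = \<sigma> (b (snd e'))" using E(3)[of e'] by simp
    then have "(fst e, snd e') \<in> E" using eq[OF E(1)[OF e(1)] E(2)[OF e(2)]] by simp
    then have "(fst e, snd e') = e" "(fst e, snd e') = e'"
      using assms(2) e(1,2) unfolding matching_def pairwise_def by fastforce+
    then show "e = e'" by simp
  qed
  have "C' \<subseteq> E" using C' assms(3) by blast
  then show "\<sigma> \<in> block_success a b N h U"
    unfolding block_success_def using C' assms(1) noncrossing_subset[OF assms(4) C'(1)] E inj_on_subset[OF inj]
    by (auto intro!: exI[of _ C'])
qed

text \<open>Sum \<open>block_graph_prob_ge\<close> over all matchings with a long chain. The error
  is linear in the number of edges, whose mean is N^2 / k. The factor 3 has two parts from cell sets
  that are not matchings and one from \<open>block_graph_prob_ge\<close>.\<close>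

lemma block_success_prob_compare:
  assumes inj: "inj a" "inj b" "range a \<inter> range b = {}" and "k > 0" "N \<le> k" "finite U"
  shows "measure_pmf.prob (random_cells N (1 / real k)) {E. \<exists>C\<subseteq>E. noncrossing C \<and> h \<le> card C}
      - 3 * (real N ^ 3 * (1 / real k)\<^sup>2) - (real N * (1 / real k))\<^sup>2 * (real (card U) + real N + 1)
    \<le> measure_pmf.prob (words k (a ` {..<N} \<union> b ` {..<N})) (block_success a b N h U)"
proof -
  define p where "p = 1 / real k"
  have p: "0 \<le> p" "p \<le> 1" using assms(4) by (auto simp: p_def)
  define Q where "Q = random_cells N p"
  define W where "W = words k (a ` {..<N} \<union> b ` {..<N})"
  define G where "G = {E. E \<subseteq> grid N \<and> matching E \<and> (\<exists>C\<subseteq>E. noncrossing C \<and> h \<le> card C)}"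
  define z where "z = real N ^ 3 * p\<^sup>2"
  define t where "t = (real (card U) + real N + 1) * p"
  have zt: "0 \<le> z" "0 \<le> t" using p by (auto simp: z_def t_def)
  have finG: "finite G" by (rule finite_subset[of _ "Pow (grid N)"]) (auto simp: G_def)
  have finQ: "finite (set_pmf Q)" unfolding Q_def using set_random_cells by (rule finite_subset) simp
  have int: "integrable (measure_pmf Q) g" for g :: "_ \<Rightarrow> real" using finQ by (rule integrable_measure_pmf_finite)
  have sub: "block_graph a b N U E \<subseteq> block_success a b N h U" if "E \<in> G" for E
    using that block_graph_success[of E N _ h a b U] unfolding G_def by blast
  have disj: "disjoint_family_on (block_graph a b N U) G"
    unfolding disjoint_family_on_def
  proof (intro ballI impI)
    fix E E' assume E: "E \<in> G" "E' \<in> G" "E \<noteq> E'"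
    show "block_graph a b N U E \<inter> block_graph a b N U E' = {}"
    proof (rule ccontr)
      assume "block_graph a b N U E \<inter> block_graph a b N U E' \<noteq> {}"
      then obtain \<sigma> where "\<sigma> \<in> block_graph a b N U E" "\<sigma> \<in> block_graph a b N U E'" by blast
      then have iff: "(i, j) \<in> E \<longleftrightarrow> (i, j) \<in> E'" if "i < N" "j < N" for i j
        using that by (auto simp: block_graph_def)
      have "E \<subseteq> grid N" "E' \<subseteq> grid N" using E by (auto simp: G_def)
      then have "E = E'" using iff by (intro set_eqI) auto
      then show False using E by simp
    qed
  qed
  have "measure_pmf.prob Q G - z - t * (real (N * N) * p) =
      measure_pmf.expectation Q (\<lambda>E. indicator G E) - measure_pmf.expectation Q (\<lambda>E. z + t * real (card E))"
    using expectation_card_random_cells[OF p, of N]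
    by (subst Bochner_Integration.integral_add[OF int int]) (simp add: Q_def)
  also have "\<dots> = measure_pmf.expectation Q (\<lambda>E. indicator G E - (z + t * real (card E)))"
    by (rule Bochner_Integration.integral_diff[OF int int, symmetric])
  also have "\<dots> \<le> measure_pmf.expectation Q (\<lambda>E. indicator G E * (1 - z - real (card E) * t))"
    using zt by (intro expectation_mono_finite[OF finQ]) (auto simp: indicator_def algebra_simps)
  also have "\<dots> = (\<Sum>E\<in>G. indicator G E * (1 - z - real (card E) * t) * pmf Q E)"
    by (rule integral_measure_pmf_real[OF finG]) (auto simp: indicator_def split: if_splits)
  also have "\<dots> \<le> (\<Sum>E\<in>G. measure_pmf.prob W (block_graph a b N U E))"
  proof (rule sum_mono)
    fix E assume E: "E \<in> G"
    then have "E \<subseteq> grid N" "matching E" by (auto simp: G_def)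
    from block_graph_prob_ge[OF assms this] E
    show "indicator G E * (1 - z - real (card E) * t) * pmf Q E \<le> measure_pmf.prob W (block_graph a b N U E)"
      by (simp add: Q_def W_def z_def t_def p_def mult_ac)
  qed
  also have "\<dots> = measure_pmf.prob W (\<Union>E\<in>G. block_graph a b N U E)"
    using finG disj by (intro measure_pmf.finite_measure_finite_Union[symmetric]) auto
  also have "\<dots> \<le> measure_pmf.prob W (block_success a b N h U)"
    using sub by (intro measure_pmf.finite_measure_mono) auto
  finally have main: "measure_pmf.prob Q G - z - t * (real (N * N) * p) \<le> measure_pmf.prob W (block_success a b N h U)" .
  have AE: "measure_pmf.prob Q {E. \<exists>C\<subseteq>E. noncrossing C \<and> h \<le> card C} \<le> measure_pmf.prob Q G + 2 * real N ^ 3 * p\<^sup>2"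
  proof -
    have "measure_pmf.prob Q {E. \<exists>C\<subseteq>E. noncrossing C \<and> h \<le> card C} =
       measure_pmf.prob Q ({E. \<exists>C\<subseteq>E. noncrossing C \<and> h \<le> card C} \<inter> set_pmf Q)"
      by (simp add: measure_Int_set_pmf)
    also have "\<dots> \<le> measure_pmf.prob Q G + 2 * real N ^ 3 * p\<^sup>2"
    proof (rule prob_le_add)
      show "{E. \<exists>C\<subseteq>E. noncrossing C \<and> h \<le> card C} \<inter> set_pmf Q \<subseteq> G \<union> {E. E \<subseteq> grid N \<and> \<not> matching E}"
        using set_random_cells unfolding G_def Q_def by blast
      show "measure_pmf.prob Q {E. E \<subseteq> grid N \<and> \<not> matching E} \<le> 2 * real N ^ 3 * p\<^sup>2"
        unfolding Q_def using p by (rule random_cells_not_matching)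
    qed simp
    finally show ?thesis .
  qed
  have "t * (real (N * N) * p) = (real N * p)\<^sup>2 * (real (card U) + real N + 1)"
    by (simp add: t_def power2_eq_square)
  then show ?thesis using main AE unfolding p_def[symmetric] Q_def[symmetric] W_def[symmetric] z_def by linarith
qed

lemma block_success_prob:
  fixes \<epsilon> :: real
  assumes inj: "inj a" "inj b" "range a \<inter> range b = {}" and k: "k > 0" "N \<le> k" and U: "finite U"
    and \<epsilon>: "0 < \<epsilon>" "\<epsilon> \<le> 1/4" and q: "1 / sqrt (real k) \<le> \<epsilon>\<^sup>2 / 8"
    and T: "2000 / \<epsilon>^5 \<le> real N * (1 / sqrt (real k))"
    and h: "real h \<le> 2 * (real N * (1 / sqrt (real k))) * (1 - 2 * \<epsilon>)"
  shows "1 - \<epsilon> - 5 * (real N ^ 3 / real k ^ 2) - real N ^ 2 * real (card U) / real k ^ 2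
    \<le> measure_pmf.prob (words k (a ` {..<N} \<union> b ` {..<N})) (block_success a b N h U)"
proof -
  define q where "q = 1 / sqrt (real k)"
  have qk: "q\<^sup>2 = 1 / real k" using k by (simp add: q_def power_divide)
  have "1 - \<epsilon> \<le> measure_pmf.prob (weights N N (q\<^sup>2))
     {w. \<exists>C\<subseteq>points w N N. noncrossing C \<and> 2 * (real N * q) * (1 - 2 * \<epsilon>) \<le> real (card C)}"
    using \<epsilon> q T k by (intro lpp_lower) (auto simp: q_def)
  also have "\<dots> \<le> measure_pmf.prob (weights N N (q\<^sup>2))
      ((\<lambda>w. points w N N) -` {E. \<exists>C\<subseteq>E. noncrossing C \<and> h \<le> card C})"
  proof (rule measure_pmf.finite_measure_mono)
    have "h \<le> card C" if "2 * (real N * q) * (1 - 2 * \<epsilon>) \<le> real (card C)" for C :: "(nat \<times> nat) set"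
      using order_trans[OF h[folded q_def] that] by simp
    then show "{w. \<exists>C\<subseteq>points w N N. noncrossing C \<and> 2 * (real N * q) * (1 - 2 * \<epsilon>) \<le> real (card C)} \<subseteq>
       (\<lambda>w. points w N N) -` {E. \<exists>C\<subseteq>E. noncrossing C \<and> h \<le> card C}" by blast
  qed simp
  also have "\<dots> = measure_pmf.prob (random_cells N (q\<^sup>2)) {E. \<exists>C\<subseteq>E. noncrossing C \<and> h \<le> card C}"
    by (simp only: weights_random_cells[symmetric] measure_map_pmf)
  finally have chain: "1 - \<epsilon> \<le> measure_pmf.prob (random_cells N (1 / real k)) {E. \<exists>C\<subseteq>E. noncrossing C \<and> h \<le> card C}"
    unfolding qk .
  have "N > 0"
  proof (rule ccontr)
    assume "\<not> N > 0"
    then have "2000 / \<epsilon>^5 \<le> 0" using T by simp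
    moreover have "0 < 2000 / \<epsilon>^5" using \<epsilon> by simp
    ultimately show False by linarith
  qed
  \<comment> \<open>With \<open>N + 1 \<le> 2 * N\<close> the remaining error joins the cubic one,
    whose factor grows from 3 to 5.\<close>
  then have "(real N / real k)\<^sup>2 * (real N + 1) \<le> (real N / real k)\<^sup>2 * (2 * real N)"
    by (intro mult_left_mono) auto
  also have "\<dots> = 2 * (real N ^ 3 / real k ^ 2)" by (simp add: power2_eq_square power3_eq_cube)
  finally have N3: "(real N / real k)\<^sup>2 * (real N + 1) \<le> 2 * (real N ^ 3 / real k ^ 2)" .
  have "(real N * (1 / real k))\<^sup>2 * (real (card U) + real N + 1) =
      (real N / real k)\<^sup>2 * real (card U) + (real N / real k)\<^sup>2 * (real N + 1)"
    by (simp add: distrib_left)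
  also have "(real N / real k)\<^sup>2 * real (card U) = real N ^ 2 * real (card U) / real k ^ 2"
    by (simp add: power_divide)
  finally have "(real N * (1 / real k))\<^sup>2 * (real (card U) + real N + 1) \<le>
      real N ^ 2 * real (card U) / real k ^ 2 + 2 * (real N ^ 3 / real k ^ 2)"
    using N3 by linarith
  moreover have "real N ^ 3 * (1 / real k)\<^sup>2 = real N ^ 3 / real k ^ 2" by (simp add: power_divide)
  ultimately show ?thesis
    using block_success_prob_compare[OF inj k U, of h] chain by linarith
qed

section \<open>Concatenating blocks\<close>

text \<open>The cap \<open>l\<close> on the size bounds \<open>best\<close> from above, so that an
  expectation close to \<open>l\<close> says something about its median.\<close>

definition avoiding :: "nat \<Rightarrow> nat \<Rightarrow> nat set \<Rightarrow> (vertex \<Rightarrow> nat) \<Rightarrow> (nat \<times> nat) set \<Rightarrow> bool" where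
  "avoiding l n U \<sigma> M \<longleftrightarrow> rfm n \<sigma> M \<and> (\<forall>e\<in>M. \<sigma> (A (fst e)) \<notin> U) \<and> card M \<le> l"

definition best :: "nat \<Rightarrow> nat \<Rightarrow> nat set \<Rightarrow> (vertex \<Rightarrow> nat) \<Rightarrow> nat" where
  "best l n U \<sigma> = Max {card M | M. avoiding l n U \<sigma> M}"

lemma finite_avoiding: "finite {card M | M. avoiding l n U \<sigma> M}"
  by (rule finite_subset[of _ "{..l}"]) (auto simp: avoiding_def)

lemma best_ge: "avoiding l n U \<sigma> M \<Longrightarrow> card M \<le> best l n U \<sigma>"
  unfolding best_def by (intro Max_ge finite_avoiding) auto

lemma best_attained: "\<exists>M. avoiding l n U \<sigma> M \<and> card M = best l n U \<sigma>"
proof -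
  have "avoiding l n U \<sigma> {}" by (simp add: avoiding_def rfm_def noncrossing_def)
  then have "best l n U \<sigma> \<in> {card M | M. avoiding l n U \<sigma> M}"
    unfolding best_def by (intro Max_in finite_avoiding) auto
  then show ?thesis by force
qed

lemma best_le: "best l n U \<sigma> \<le> l"
  using best_attained[of l n U \<sigma>] by (auto simp: avoiding_def)

lemma best_le_R: "best l n U \<sigma> \<le> R (kept_edges n \<sigma>)"
proof -
  obtain M where "avoiding l n U \<sigma> M" "card M = best l n U \<sigma>" using best_attained by blast
  then show ?thesis using card_rfm_le[of n \<sigma> M] by (simp add: avoiding_def)
qed

lemma rfm_cong:
  assumes "\<And>i. i \<in> {1..n} \<Longrightarrow> \<sigma> (A i) = \<tau> (A i) \<and> \<sigma> (B i) = \<tau> (B i)" "rfm n \<sigma> M"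
  shows "rfm n \<tau> M"
proof -
  have M: "M \<subseteq> {1..n} \<times> {1..n}" using assms(2) by (simp add: rfm_def)
  have eq: "\<sigma> (A (fst e)) = \<tau> (A (fst e))" "\<sigma> (B (snd e)) = \<tau> (B (snd e))" if "e \<in> M" for e
    using that M assms(1) by force+
  have "inj_on (\<lambda>e. \<sigma> (A (fst e))) M \<longleftrightarrow> inj_on (\<lambda>e. \<tau> (A (fst e))) M"
    by (rule inj_on_cong) (rule eq(1))
  then show ?thesis using assms(2) eq by (auto simp: rfm_def)
qed

lemma avoiding_cong:
  assumes "\<And>i. i \<in> {1..n} \<Longrightarrow> \<sigma> (A i) = \<tau> (A i) \<and> \<sigma> (B i) = \<tau> (B i)" "avoiding l n U \<sigma> M"
  shows "avoiding l n U \<tau> M"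
proof -
  have r: "rfm n \<sigma> M" using assms(2) by (simp add: avoiding_def)
  then have M: "M \<subseteq> {1..n} \<times> {1..n}" by (simp add: rfm_def)
  have "\<tau> (A (fst e)) \<notin> U" if "e \<in> M" for e
  proof -
    have "fst e \<in> {1..n}" using that M by auto
    then show ?thesis using assms(1)[of "fst e"] assms(2) that by (auto simp: avoiding_def)
  qed
  moreover have "rfm n \<tau> M" using assms(1) r by (rule rfm_cong)
  ultimately show ?thesis using assms(2) by (simp add: avoiding_def)
qed

lemma rfm_mono:
  assumes "rfm n \<sigma> M" "n \<le> n'"
  shows "rfm n' \<sigma> M"
proof -
  have "{1..n} \<times> {1..n} \<subseteq> {1..n'} \<times> {1..n'}" using assms(2) by (intro Sigma_mono) auto
  then show ?thesis using assms(1) unfolding rfm_def by (meson order_trans)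
qed

text \<open>Positions within a block count from 0, positions in a word from 1.\<close>

abbreviation ablk :: "nat \<Rightarrow> nat \<Rightarrow> vertex" where "ablk c i \<equiv> A (Suc (c + i))"
abbreviation bblk :: "nat \<Rightarrow> nat \<Rightarrow> vertex" where "bblk c i \<equiv> B (Suc (c + i))"

lemma best_mono:
  assumes "\<And>i. i \<in> {1..n} \<Longrightarrow> \<sigma> (A i) = \<tau> (A i) \<and> \<sigma> (B i) = \<tau> (B i)" "n \<le> n'" "l \<le> l'"
  shows "best l n U \<sigma> \<le> best l' n' U \<tau>"
proof -
  obtain M where M: "avoiding l n U \<sigma> M" "card M = best l n U \<sigma>" using best_attained by blast
  have "avoiding l n U \<tau> M" using assms(1) M(1) by (rule avoiding_cong)
  then have "avoiding l' n' U \<tau> M" using assms(2,3) rfm_mono[of n \<tau> M n'] by (simp add: avoiding_def)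
  then show ?thesis using best_ge M(2) by metis
qed

text \<open>The symbols of a chain found in the last block become forbidden for the earlier blocks.\<close>

lemma best_append:
  assumes g: "g \<in> block_success (ablk n) (bblk n) N h U"
  shows "\<exists>S. card S = h \<and> finite S \<and> (\<forall>f \<sigma> l.
    (\<forall>i\<in>{1..n}. f (A i) = \<sigma> (A i) \<and> f (B i) = \<sigma> (B i)) \<longrightarrow>
    (\<forall>i<N. g (ablk n i) = \<sigma> (ablk n i) \<and> g (bblk n i) = \<sigma> (bblk n i)) \<longrightarrow>
    h + best l n (U \<union> S) f \<le> best (h + l) (n + N) U \<sigma>)"
proof -
  obtain C where C: "C \<subseteq> grid N" "noncrossing C" "card C = h"
    "\<And>e. e \<in> C \<Longrightarrow> g (ablk n (fst e)) = g (bblk n (snd e)) \<and> g (ablk n (fst e)) \<notin> U"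
    "inj_on (\<lambda>e. g (ablk n (fst e))) C"
    using g unfolding block_success_def by blast
  have finC: "finite C" using C(1) by (rule finite_subset) simp
  \<comment> \<open>\<open>S\<close> depends on \<open>g\<close> alone, so with the last block fixed
    the remaining letters can still be averaged over.\<close>
  define S where "S = (\<lambda>e. g (ablk n (fst e))) ` C"
  have S: "card S = h" "finite S" using C(3,5) finC by (auto simp: S_def card_image)
  define sh where "sh = (\<lambda>e :: nat \<times> nat. (Suc (n + fst e), Suc (n + snd e)))"
  have "h + best l n (U \<union> S) f \<le> best (h + l) (n + N) U \<sigma>"
    if eq: "\<And>i. i \<in> {1..n} \<Longrightarrow> f (A i) = \<sigma> (A i) \<and> f (B i) = \<sigma> (B i)"
    and eq': "\<And>i. i < N \<Longrightarrow> g (ablk n i) = \<sigma> (ablk n i) \<and> g (bblk n i) = \<sigma> (bblk n i)" for f \<sigma> l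
  proof -
    obtain M where M: "avoiding l n (U \<union> S) f M" "card M = best l n (U \<union> S) f" using best_attained by blast
    have M\<sigma>: "avoiding l n (U \<union> S) \<sigma> M" using eq M(1) by (rule avoiding_cong)
    then have rM: "rfm n \<sigma> M" by (simp add: avoiding_def)
    have Mn: "M \<subseteq> {1..n} \<times> {1..n}" using rM by (simp add: rfm_def)
    have finM: "finite M" using rM by (rule rfm_finite)
    have Mle: "fst e \<le> n \<and> snd e \<le> n" if "e \<in> M" for e using that Mn by auto
    have sh_gt: "n < fst (sh e) \<and> n < snd (sh e)" for e by (simp add: sh_def)
    have disj: "M \<inter> sh ` C = {}"
    proof (rule ccontr)
      assume "M \<inter> sh ` C \<noteq> {}"
      then obtain e where "e \<in> C" "sh e \<in> M" by blast
      then show False using Mle[of "sh e"] sh_gt[of e] by linarith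
    qed
    have inj_sh: "inj_on sh C" by (auto simp: inj_on_def sh_def prod_eq_iff)
    have symb: "\<sigma> (A (fst (sh e))) = g (ablk n (fst e)) \<and> \<sigma> (B (snd (sh e))) = g (bblk n (snd e))" if "e \<in> C" for e
    proof -
      have "fst e < N" "snd e < N" using that C(1) by auto
      then show ?thesis using eq'[of "fst e"] eq'[of "snd e"] by (simp add: sh_def)
    qed
    have nc: "noncrossing (M \<union> sh ` C)"
    proof (rule noncrossingI)
      fix e e' assume e: "e \<in> M \<union> sh ` C" "e' \<in> M \<union> sh ` C" "e \<noteq> e'"
      have ncM: "noncrossing M" using rM by (simp add: rfm_def)
      consider "e \<in> M" "e' \<in> M" | "e \<in> M" "e' \<in> sh ` C" | "e \<in> sh ` C" "e' \<in> M" | "e \<in> sh ` C" "e' \<in> sh ` C"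
        using e by blast
      then show "(fst e < fst e' \<and> snd e < snd e') \<or> (fst e' < fst e \<and> snd e' < snd e)"
      proof cases
        case 1 then show ?thesis using noncrossingD[OF ncM] e(3) by blast
      next
        case 2 then show ?thesis using Mle[of e] sh_gt by (auto simp: sh_def)
      next
        case 3 then show ?thesis using Mle[of e'] sh_gt by (auto simp: sh_def)
      next
        case 4
        then obtain d d' where d: "d \<in> C" "d' \<in> C" "e = sh d" "e' = sh d'" by blast
        then have "d \<noteq> d'" using e(3) by blast
        from noncrossingD[OF C(2) d(1,2) this] show ?thesis by (auto simp: d(3,4) sh_def)
      qed
    qed
    have sM: "\<sigma> (A (fst e)) \<notin> U \<union> S" if "e \<in> M" for e using M\<sigma> that by (auto simp: avoiding_def)
    have sC: "\<sigma> (A (fst (sh e))) \<in> S" if "e \<in> C" for e using symb[OF that] that by (auto simp: S_def)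
    have inj: "inj_on (\<lambda>e. \<sigma> (A (fst e))) (M \<union> sh ` C)"
    proof -
      have "inj_on (\<lambda>e. \<sigma> (A (fst e))) M" using rM by (simp add: rfm_def)
      moreover have "inj_on (\<lambda>e. \<sigma> (A (fst e))) (sh ` C)"
      proof (rule inj_onI)
        fix e e' assume "e \<in> sh ` C" "e' \<in> sh ` C" and eq: "\<sigma> (A (fst e)) = \<sigma> (A (fst e'))"
        then obtain d d' where d: "d \<in> C" "d' \<in> C" "e = sh d" "e' = sh d'" by blast
        then have "g (ablk n (fst d)) = g (ablk n (fst d'))" using eq symb by metis
        then have "d = d'" using inj_onD[OF C(5)] d by blast
        then show "e = e'" using d by simp
      qed
      moreover have "(\<lambda>e. \<sigma> (A (fst e))) ` M \<inter> (\<lambda>e. \<sigma> (A (fst e))) ` (sh ` C) = {}"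
        using sM sC by fastforce
      ultimately show ?thesis by (subst inj_on_Un) blast
    qed
    have "rfm (n + N) \<sigma> (M \<union> sh ` C)"
      unfolding rfm_def
    proof (intro conjI nc inj)
      show "M \<union> sh ` C \<subseteq> {1..n + N} \<times> {1..n + N}"
        using Mn C(1) by (auto simp: sh_def)
      show "\<forall>e\<in>M \<union> sh ` C. \<sigma> (A (fst e)) = \<sigma> (B (snd e))"
        using rM symb C(4) by (auto simp: rfm_def)
    qed
    moreover have card: "card (M \<union> sh ` C) = card M + h"
      using finM finC disj inj_sh C(3) by (simp add: card_Un_disjoint card_image)
    moreover have "card M \<le> l" using M(1) by (simp add: avoiding_def)
    moreover have "\<forall>e\<in>M \<union> sh ` C. \<sigma> (A (fst e)) \<notin> U"
    proof
      fix e assume "e \<in> M \<union> sh ` C"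
      then consider "e \<in> M" | d where "d \<in> C" "e = sh d" by blast
      then show "\<sigma> (A (fst e)) \<notin> U"
      proof cases
        case 1 then show ?thesis using sM[of e] by simp
      next
        case 2 then show ?thesis using symb[of d] C(4)[of d] by metis
      qed
    qed
    ultimately have "avoiding (h + l) (n + N) U \<sigma> (M \<union> sh ` C)" by (simp add: avoiding_def)
    then have "card M + h \<le> best (h + l) (n + N) U \<sigma>" using best_ge card by metis
    then show ?thesis using M(2) by simp
  qed
  then show ?thesis using S by (intro exI[of _ S]) blast
qed

text \<open>The last block is split off, so that the rest is again a pair of words of the same kind.
  Given its letters, success adds \<open>h\<close> edges and moves \<open>h\<close> symbols into
  \<open>U\<close>; failure leaves \<open>U\<close> as it is. The quantity
  \<open>card U + h * m\<close> never exceeds the budget \<open>D\<close>, so the success bound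
  holds for every block, whatever the later ones used.\<close>

lemma best_expectation:
  assumes k: "k > 0" and \<delta>: "0 \<le> \<delta>" "\<delta> \<le> 1"
    and succ: "\<And>c U. finite U \<Longrightarrow> card U \<le> D \<Longrightarrow> 1 - \<delta> \<le>
      measure_pmf.prob (words k (ablk c ` {..<N} \<union> bblk c ` {..<N})) (block_success (ablk c) (bblk c) N h U)"
    and U: "finite U" "card U + h * m \<le> D"
  shows "(1 - \<delta>) * real (h * m) \<le>
    measure_pmf.expectation (words k (Knn_vertices (m * N))) (\<lambda>\<sigma>. real (best (h * m) (m * N) U \<sigma>))"
  using U
proof (induction m arbitrary: U)
  case (Suc m)
  define n where "n = m * N"
  define Blk where "Blk = ablk n ` {..<N} \<union> bblk n ` {..<N}"
  define G where "G = block_success (ablk n) (bblk n) N h U"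
  define merge where "merge f g = (\<lambda>v. if v \<in> Knn_vertices n then f v else g v)" for f g :: "vertex \<Rightarrow> nat"
  have finV: "finite (Knn_vertices n)" "finite Blk" by (auto simp: Knn_vertices_def Blk_def)
  have disj: "Knn_vertices n \<inter> Blk = {}" by (auto simp: Knn_vertices_def Blk_def)
  have shift: "{1..n + N} = {1..n} \<union> (\<lambda>i. Suc (n + i)) ` {..<N}"
  proof (intro set_eqI iffI)
    fix i assume i: "i \<in> {1..n + N}"
    show "i \<in> {1..n} \<union> (\<lambda>i. Suc (n + i)) ` {..<N}"
    proof (cases "i \<le> n")
      case False
      then have "i = Suc (n + (i - Suc n))" "i - Suc n \<in> {..<N}" using i by auto
      then show ?thesis by blast
    qed (use i in auto)
  qed auto
  have V: "Knn_vertices (Suc m * N) = Knn_vertices n \<union> Blk"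
    using shift by (simp add: Knn_vertices_def Blk_def n_def image_Un image_image add.commute Un_ac)
  have fin: "finite (set_pmf (words k (Knn_vertices n)))" "finite (set_pmf (words k Blk))"
    using finV k by (auto intro!: finite_set_Pi_pmf)
  have int: "integrable (measure_pmf (words k (Knn_vertices n))) F"
    and int_blk: "integrable (measure_pmf (words k Blk)) F" for F :: "_ \<Rightarrow> real"
    using fin by (auto intro: integrable_measure_pmf_finite)
  have law: "words k (Knn_vertices (Suc m * N)) =
      bind_pmf (words k Blk) (\<lambda>g. map_pmf (\<lambda>f. merge f g) (words k (Knn_vertices n)))"
  proof -
    have "words k (Knn_vertices n \<union> Blk) =
        map_pmf (\<lambda>(f, g) v. if v \<in> Knn_vertices n then f v else g v)
          (pair_pmf (words k (Knn_vertices n)) (words k Blk))"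
      using finV disj by (rule Pi_pmf_union)
    also have "\<dots> = bind_pmf (words k (Knn_vertices n)) (\<lambda>f. bind_pmf (words k Blk) (\<lambda>g. return_pmf (merge f g)))"
      by (simp add: merge_def[abs_def] pair_pmf_def map_pmf_def bind_assoc_pmf bind_return_pmf)
    also have "\<dots> = bind_pmf (words k Blk) (\<lambda>g. bind_pmf (words k (Knn_vertices n)) (\<lambda>f. return_pmf (merge f g)))"
      by (rule bind_commute_pmf)
    finally show ?thesis unfolding V map_pmf_def .
  qed
  have m1: "f (A i) = merge f g (A i) \<and> f (B i) = merge f g (B i)" if "i \<in> {1..n}" for f g i
    using that by (auto simp: merge_def Knn_vertices_def)
  have m2: "g (ablk n i) = merge f g (ablk n i) \<and> g (bblk n i) = merge f g (bblk n i)" for f g i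
    by (auto simp: merge_def Knn_vertices_def)
  have IH: "(1 - \<delta>) * real (h * m) \<le>
      measure_pmf.expectation (words k (Knn_vertices n)) (\<lambda>\<sigma>. real (best (h * m) n U' \<sigma>))"
    if "finite U'" "card U' + h * m \<le> D" for U'
    unfolding n_def using that by (rule Suc.IH)
  have inner: "(1 - \<delta>) * real (h * m) + real h * indicator G g \<le>
      measure_pmf.expectation (map_pmf (\<lambda>f. merge f g) (words k (Knn_vertices n)))
        (\<lambda>\<sigma>. real (best (h * Suc m) (Suc m * N) U \<sigma>))" for g
  proof (cases "g \<in> G")
    case False
    have "(1 - \<delta>) * real (h * m) \<le> measure_pmf.expectation (words k (Knn_vertices n)) (\<lambda>\<sigma>. real (best (h * m) n U \<sigma>))"
      using Suc.prems by (intro IH) auto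
    also have "\<dots> \<le> measure_pmf.expectation (words k (Knn_vertices n)) (\<lambda>f. real (best (h * Suc m) (Suc m * N) U (merge f g)))"
      using m1 by (intro expectation_mono_finite[OF fin(1)]) (auto intro!: best_mono simp: n_def)
    finally show ?thesis using False by simp
  next
    case True
    obtain S where S: "card S = h" "finite S" and app: "\<And>f \<sigma> l.
        (\<forall>i\<in>{1..n}. f (A i) = \<sigma> (A i) \<and> f (B i) = \<sigma> (B i)) \<Longrightarrow>
        (\<forall>i<N. g (ablk n i) = \<sigma> (ablk n i) \<and> g (bblk n i) = \<sigma> (bblk n i)) \<Longrightarrow>
        h + best l n (U \<union> S) f \<le> best (h + l) (n + N) U \<sigma>"
      using best_append[OF True[unfolded G_def]] by blast
    have "card (U \<union> S) + h * m \<le> D" using Suc.prems(2) card_Un_le[of U S] S(1) by simp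
    then have "(1 - \<delta>) * real (h * m) \<le>
        measure_pmf.expectation (words k (Knn_vertices n)) (\<lambda>f. real (best (h * m) n (U \<union> S) f))"
      using Suc.prems(1) S(2) by (intro IH) auto
    then have "(1 - \<delta>) * real (h * m) + real h \<le>
        measure_pmf.expectation (words k (Knn_vertices n)) (\<lambda>f. real h + real (best (h * m) n (U \<union> S) f))"
      by (subst Bochner_Integration.integral_add[OF int int]) simp
    also have "\<dots> \<le> measure_pmf.expectation (words k (Knn_vertices n)) (\<lambda>f. real (best (h * Suc m) (Suc m * N) U (merge f g)))"
    proof (rule expectation_mono_finite[OF fin(1)])
      fix f
      have "h + best (h * m) n (U \<union> S) f \<le> best (h + h * m) (n + N) U (merge f g)"
        by (rule app) (use m1 m2 in blast)+
      moreover have "h * Suc m = h + h * m" "Suc m * N = n + N" by (auto simp: n_def)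
      ultimately show "real h + real (best (h * m) n (U \<union> S) f) \<le> real (best (h * Suc m) (Suc m * N) U (merge f g))"
        by (metis of_nat_add of_nat_le_iff)
    qed
    finally show ?thesis using True by simp
  qed
  have "1 - \<delta> \<le> measure_pmf.prob (words k Blk) G"
    unfolding Blk_def G_def using Suc.prems by (intro succ) auto
  then have "real h * (1 - \<delta>) \<le> real h * measure_pmf.prob (words k Blk) G" by (rule mult_left_mono) simp
  then have "(1 - \<delta>) * real (h * Suc m) \<le> (1 - \<delta>) * real (h * m) + real h * measure_pmf.prob (words k Blk) G"
    by (simp add: algebra_simps)
  also have "\<dots> = measure_pmf.expectation (words k Blk) (\<lambda>g. (1 - \<delta>) * real (h * m) + real h * indicator G g)"
    by (subst Bochner_Integration.integral_add[OF int_blk int_blk]) simp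
  also have "\<dots> \<le> measure_pmf.expectation (words k Blk) (\<lambda>g. measure_pmf.expectation
      (map_pmf (\<lambda>f. merge f g) (words k (Knn_vertices n))) (\<lambda>\<sigma>. real (best (h * Suc m) (Suc m * N) U \<sigma>)))"
    using fin(2) inner by (rule expectation_mono_finite)
  also have "\<dots> = measure_pmf.expectation (words k (Knn_vertices (Suc m * N)))
      (\<lambda>\<sigma>. real (best (h * Suc m) (Suc m * N) U \<sigma>))"
    unfolding law using fin by (intro expectation_bind_finite[symmetric]) auto
  finally show ?case .
qed simp

text \<open>A reverse Markov inequality: \<open>best\<close> is at most \<open>h * m\<close> and
  below (1 - 2 \<delta>) h m unless it reaches \<open>b\<close>, so a mean of at least (1 -
  \<delta>) h m needs probability at least one half for reaching \<open>b\<close>.\<close>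

lemma R_median:
  assumes k: "k > 0" and \<delta>: "0 < \<delta>" "\<delta> \<le> 1"
    and succ: "\<And>c U. finite U \<Longrightarrow> card U \<le> h * m \<Longrightarrow> 1 - \<delta> \<le>
      measure_pmf.prob (words k (ablk c ` {..<N} \<union> bblk c ` {..<N})) (block_success (ablk c) (bblk c) N h U)"
    and n: "m * N \<le> n" and hm: "0 < h * m" and b: "real b \<le> (1 - 2 * \<delta>) * real (h * m)"
  shows "1 / 2 \<le> measure_pmf.prob (words k (Knn_vertices n)) {\<sigma>. b \<le> R (kept_edges n \<sigma>)}"
proof -
  define n' where "n' = m * N"
  define W where "W = words k (Knn_vertices n')"
  have finV: "finite (Knn_vertices n)" "finite (Knn_vertices n')" by (auto simp: Knn_vertices_def)
  have sub: "Knn_vertices n' \<subseteq> Knn_vertices n" using n by (auto simp: Knn_vertices_def n'_def)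
  have finW: "finite (set_pmf W)" unfolding W_def using finV k by (intro finite_set_Pi_pmf) auto
  define l where "l = h * m"
  define S where "S = {\<sigma>. b \<le> best l n' {} \<sigma>}"
  define p where "p = measure_pmf.prob W S"
  have "(1 - \<delta>) * real l \<le> measure_pmf.expectation W (\<lambda>\<sigma>. real (best l n' {} \<sigma>))"
    unfolding l_def W_def n'_def using k \<delta> succ by (intro best_expectation[where D = "h * m"]) auto
  also have "\<dots> \<le> measure_pmf.expectation W (\<lambda>\<sigma>. (1 - 2 * \<delta>) * real l + 2 * \<delta> * real l * indicator S \<sigma>)"
  proof (rule expectation_mono_finite[OF finW])
    fix \<sigma>
    show "real (best l n' {} \<sigma>) \<le> (1 - 2 * \<delta>) * real l + 2 * \<delta> * real l * indicator S \<sigma>"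
    proof (cases "\<sigma> \<in> S")
      case True
      then show ?thesis using best_le[of l n' "{}" \<sigma>] by (simp add: algebra_simps)
    next
      case False
      then show ?thesis using b by (simp add: S_def l_def)
    qed
  qed
  also have "\<dots> = (1 - 2 * \<delta>) * real l + 2 * \<delta> * real l * p"
    by (subst Bochner_Integration.integral_add) (auto intro!: integrable_measure_pmf_finite finW simp: p_def)
  finally have "\<delta> * real l \<le> \<delta> * real l * (2 * p)" by (simp add: algebra_simps)
  then have "1 \<le> 2 * p" using \<delta> hm by (simp add: l_def)
  moreover have "p \<le> measure_pmf.prob (words k (Knn_vertices n)) {\<sigma>. b \<le> R (kept_edges n \<sigma>)}"
  proof -
    \<comment> \<open>Letters after the last complete block are ignored, which can only shorten the
      matching.\<close>
    define r where "r f = (\<lambda>v. if v \<in> Knn_vertices n' then f v else 0)" for f :: "vertex \<Rightarrow> nat"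
    have "W = map_pmf r (words k (Knn_vertices n))"
      unfolding W_def r_def[abs_def] using finV(1) sub by (rule Pi_pmf_subset)
    then have "p = measure_pmf.prob (words k (Knn_vertices n)) (r -` S)" by (simp add: p_def)
    also have "\<dots> \<le> measure_pmf.prob (words k (Knn_vertices n)) {\<sigma>. b \<le> R (kept_edges n \<sigma>)}"
    proof (intro measure_pmf.finite_measure_mono subsetI)
      fix \<sigma> assume "\<sigma> \<in> r -` S"
      then have "b \<le> best l n' {} (r \<sigma>)" by (simp add: S_def)
      also have "\<dots> \<le> best l n {} \<sigma>"
        using n by (intro best_mono) (auto simp: r_def Knn_vertices_def n'_def)
      also have "\<dots> \<le> R (kept_edges n \<sigma>)" by (rule best_le_R)
      finally show "\<sigma> \<in> {\<sigma>. b \<le> R (kept_edges n \<sigma>)}" by simp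
    qed simp
    finally show ?thesis .
  qed
  ultimately show ?thesis by linarith
qed

section \<open>The main theorem\<close>

text \<open>Since \<open>b\<close> may exceed \<open>L\<close>, the gap \<open>b - a\<close> is
  bounded below both by 9/10 \<xi> L and by 9/10 \<xi> b. Their product divided by 8 b is 81/800
  \<xi>^2 L, just above the required 1/10. The factor 2 in the conclusion is the inverse of the
  probability at the median.\<close>

lemma R_lower_tail:
  fixes \<xi> L :: real
  assumes "k > 0" and \<xi>: "0 < \<xi>" "\<xi> \<le> 1" and L: "0 < L" and b: "(1 - \<xi> / 10) * L \<le> real b"
    and med: "1 / 2 \<le> measure_pmf.prob (words k (Knn_vertices n)) {\<sigma>. b \<le> R (kept_edges n \<sigma>)}"
  shows "measure_pmf.prob (words k (Knn_vertices n)) {\<sigma>. real (R (kept_edges n \<sigma>)) \<le> (1 - \<xi>) * L}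
    \<le> 2 * exp (- (1 / 10) * \<xi>\<^sup>2 * L)"
proof -
  define a where "a = (1 - \<xi>) * L"
  define P where "P = measure_pmf.prob (words k (Knn_vertices n)) {\<sigma>. real (R (kept_edges n \<sigma>)) \<le> a}"
  have \<xi>L: "0 < \<xi> * L" using \<xi> L by simp
  have "0 < (1 - \<xi> / 10) * L" using \<xi> L by simp
  then have b0: "0 < real b" using b by linarith
  have gap: "9 / 10 * \<xi> * L \<le> real b - a" using b by (simp add: a_def algebra_simps)
  then have ab: "a < real b" using \<xi>L by (simp add: algebra_simps)
  have gap2: "9 / 10 * \<xi> * real b \<le> real b - a"
  proof -
    have "(1 - 9 / 10 * \<xi>) * ((1 - \<xi> / 10) * L) \<le> (1 - 9 / 10 * \<xi>) * real b"
      using b \<xi> by (intro mult_left_mono) auto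
    moreover have "(1 - 9 / 10 * \<xi>) * ((1 - \<xi> / 10) * L) = a + 9 / 100 * (\<xi>\<^sup>2 * L)"
      by (simp add: a_def field_simps power2_eq_square)
    moreover have "0 \<le> 9 / 100 * (\<xi>\<^sup>2 * L)" using L by simp
    moreover have "(1 - 9 / 10 * \<xi>) * real b = real b - 9 / 10 * \<xi> * real b" by (simp add: algebra_simps)
    ultimately show ?thesis by linarith
  qed
  have "(8 / 10 * \<xi>\<^sup>2 * L) * real b \<le> (9 / 10 * \<xi> * L) * (9 / 10 * \<xi> * real b)"
  proof -
    have "(9 / 10 * \<xi> * L) * (9 / 10 * \<xi> * real b) = 81 / 100 * (\<xi>\<^sup>2 * L * real b)"
      by (simp add: power2_eq_square)
    moreover have "(8 / 10 * \<xi>\<^sup>2 * L) * real b = 8 / 10 * (\<xi>\<^sup>2 * L * real b)" by simp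
    moreover have "0 \<le> \<xi>\<^sup>2 * L * real b" using L by simp
    ultimately show ?thesis by linarith
  qed
  also have "\<dots> \<le> (real b - a) * (real b - a)"
    using gap gap2 \<xi> L b0 ab by (intro mult_mono) auto
  finally have "1 / 10 * \<xi>\<^sup>2 * L \<le> (real b - a)\<^sup>2 / (8 * real b)"
    using b0 by (simp add: pos_le_divide_eq power2_eq_square algebra_simps)
  then have exp_le: "exp (- (real b - a)\<^sup>2 / (8 * real b)) \<le> exp (- (1 / 10) * \<xi>\<^sup>2 * L)"
    by simp
  have "1 / 2 * P \<le> measure_pmf.prob (words k (Knn_vertices n)) {\<sigma>. b \<le> R (kept_edges n \<sigma>)} * P"
    using med by (intro mult_right_mono) (auto simp: P_def)
  also have "\<dots> \<le> exp (- (real b - a)\<^sup>2 / (8 * real b))"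
    unfolding P_def using assms(1) ab by (rule R_concentration)
  finally have "P \<le> 2 * exp (- (1 / 10) * \<xi>\<^sup>2 * L)" using exp_le by linarith
  then show ?thesis by (simp add: P_def a_def)
qed

text \<open>The relative losses are 3 \<epsilon> in \<open>h\<close> (rounding included), \<epsilon>
  for letters outside complete blocks, 4 \<epsilon> in \<open>R_median\<close> with \<delta> = 2
  \<epsilon>, and \<epsilon> for rounding \<open>b\<close>. Conditions \<open>c2\<close> and
  \<open>c3\<close> bound the cubic error and that of the forbidden symbols by \<epsilon> / 2 each;
  \<open>c4\<close> makes a block a small part of the word.\<close>

lemma R_median_quantitative:
  fixes \<epsilon> :: real
  assumes k: "k > 0" and \<epsilon>: "0 < \<epsilon>" "\<epsilon> \<le> 1 / 100"
  defines "T \<equiv> 2000 / \<epsilon>^5"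
  assumes c1: "1 / sqrt (real k) \<le> \<epsilon>\<^sup>2 / 8"
    and c2: "40 * T ^ 3 / sqrt (real k) \<le> \<epsilon> / 2"
    and c3: "8 * T\<^sup>2 * real n \<le> \<epsilon> / 2 * (real k * sqrt (real k))"
    and c4: "2 * T / \<epsilon> \<le> real n / sqrt (real k)"
  shows "\<exists>b. (1 - 10 * \<epsilon>) * (2 * real n / sqrt (real k)) \<le> real b \<and>
    1 / 2 \<le> measure_pmf.prob (words k (Knn_vertices n)) {\<sigma>. b \<le> R (kept_edges n \<sigma>)}"
proof -
  define r where "r = sqrt (real k)"
  have r: "1 \<le> r" "r * r = real k" using k by (auto simp: r_def)
  define N where "N = nat \<lceil>T * r\<rceil>"
  define m where "m = n div N"
  define h where "h = nat \<lfloor>2 * (real N / r) * (1 - 2 * \<epsilon>)\<rfloor>"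
  have "\<epsilon>^5 \<le> 1" using \<epsilon> by (intro power_le_one) auto
  then have T1: "2000 \<le> T" using \<epsilon> by (simp add: T_def le_divide_eq)
  have T\<epsilon>: "2000 \<le> T * \<epsilon>"
  proof -
    have "\<epsilon> ^ 4 \<le> 1" using \<epsilon> by (intro power_le_one) auto
    moreover have "T * \<epsilon> = 2000 / \<epsilon> ^ 4" using \<epsilon> by (simp add: T_def power_def eval_nat_numeral)
    ultimately show ?thesis using \<epsilon> by (simp add: le_divide_eq)
  qed
  have Tr: "1 \<le> T * r" using mult_mono[of 1 T 1 r] T1 r by simp
  have N: "T * r \<le> real N" "real N \<le> 2 * T * r" "0 < N"
  proof -
    show "T * r \<le> real N" unfolding N_def by (rule of_nat_ceiling)
    then show "0 < N" using Tr by (cases N) auto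
    show "real N \<le> 2 * T * r" unfolding N_def using Tr by linarith
  qed
  have Nr: "T \<le> real N / r" "real N / r \<le> 2 * T" using N r by (auto simp: pos_le_divide_eq pos_divide_le_eq)
  have Nn: "real N \<le> \<epsilon> * real n"
  proof -
    have "2 * T / \<epsilon> * r \<le> real n" using c4 r by (simp add: r_def[symmetric] pos_le_divide_eq)
    then have "2 * T * r \<le> \<epsilon> * real n" using \<epsilon> by (simp add: field_simps)
    then show ?thesis using N by linarith
  qed
  have Nk: "N \<le> k"
  proof -
    have T3: "T \<le> T ^ 3" using T1 power_increasing[of 1 3 T] by simp
    have "40 * T ^ 3 \<le> \<epsilon> / 2 * r" using c2 r by (simp add: r_def[symmetric] pos_divide_le_eq)
    also have "\<dots> \<le> 1 * r" using \<epsilon> r by (intro mult_right_mono) auto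
    finally have "2 * T \<le> r" using T3 T1 by linarith
    then have "2 * T * r \<le> r * r" using r by (intro mult_right_mono) auto
    then show ?thesis using N(2) r(2) by linarith
  qed
  have mN: "m * N \<le> n" by (simp add: m_def)
  have mN': "(1 - \<epsilon>) * real n \<le> real (m * N)"
  proof -
    have "n = m * N + n mod N" by (simp add: m_def)
    moreover have "n mod N < N" using N(3) by simp
    ultimately have "real n \<le> real (m * N) + real N" by linarith
    then show ?thesis using Nn by (simp add: algebra_simps)
  qed
  have h_le: "real h \<le> 2 * (real N / r) * (1 - 2 * \<epsilon>)"
    unfolding h_def using \<epsilon> r by (intro of_nat_floor) auto
  have h_ge: "2 * (real N / r) * (1 - 3 * \<epsilon>) \<le> real h"
  proof -
    have "2 * (real N / r) * (1 - 2 * \<epsilon>) - 1 \<le> real h" unfolding h_def by linarith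
    moreover have "1 \<le> 2 * (real N / r) * \<epsilon>"
    proof -
      have "T * \<epsilon> \<le> (real N / r) * \<epsilon>" using Nr(1) \<epsilon> by (intro mult_right_mono) auto
      then have "1 \<le> 2 * ((real N / r) * \<epsilon>)" using T\<epsilon> by linarith
      then show ?thesis by (simp only: mult.assoc)
    qed
    moreover have "2 * x * (1 - 3 * \<epsilon>) = 2 * x * (1 - 2 * \<epsilon>) - 2 * x * \<epsilon>" for x :: real
      by (simp add: algebra_simps)
    ultimately show ?thesis by (smt (verit))
  qed
  have hm_ge: "(1 - 4 * \<epsilon>) * (2 * real n / r) \<le> real (h * m)"
  proof -
    have "(1 - 3 * \<epsilon>) * (1 - \<epsilon>) * (2 * real n / r) = 2 / r * (1 - 3 * \<epsilon>) * ((1 - \<epsilon>) * real n)" by simp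
    also have "\<dots> \<le> 2 / r * (1 - 3 * \<epsilon>) * real (m * N)"
      using mN' \<epsilon> r by (intro mult_left_mono) auto
    also have "\<dots> = 2 * (real N / r) * (1 - 3 * \<epsilon>) * real m" by simp
    also have "\<dots> \<le> real h * real m" using h_ge by (intro mult_right_mono) auto
    finally have "(1 - 3 * \<epsilon>) * (1 - \<epsilon>) * (2 * real n / r) \<le> real (h * m)" by simp
    moreover have "(1 - 4 * \<epsilon>) * (2 * real n / r) \<le> (1 - 3 * \<epsilon>) * (1 - \<epsilon>) * (2 * real n / r)"
      using r by (intro mult_right_mono) (auto simp: algebra_simps)
    ultimately show ?thesis by linarith
  qed
  have hm_le: "real (h * m) \<le> 2 * real n / r"
  proof -
    have "real h \<le> 2 * (real N / r) * 1"
      using h_le r \<epsilon> mult_left_mono[of "1 - 2 * \<epsilon>" 1 "2 * (real N / r)"] by simp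
    then have "real h * real m \<le> 2 * (real N / r) * real m" by (intro mult_right_mono) auto
    also have "\<dots> = 2 * real (m * N) / r" by simp
    also have "\<dots> \<le> 2 * real n / r"
    proof -
      have "real (m * N) \<le> real n" using mN by (simp only: of_nat_le_iff)
      then show ?thesis using r by (intro divide_right_mono mult_left_mono) auto
    qed
    finally show ?thesis by simp
  qed
  have n0: "0 < real n"
  proof -
    have "0 < T / \<epsilon>" using T1 \<epsilon> by simp
    then have "0 < real n / sqrt (real k)" using c4 by linarith
    then show ?thesis by (simp add: zero_less_divide_iff)
  qed
  have L0: "0 < 2 * real n / r" using n0 r by simp
  have hm0: "0 < h * m"
  proof -
    have "0 < (1 - 4 * \<epsilon>) * (2 * real n / r)" using \<epsilon> L0 by (intro mult_pos_pos) auto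
    then have "0 < real (h * m)" using hm_ge by linarith
    then show ?thesis by (simp only: of_nat_0_less_iff)
  qed
  have err1: "5 * (real N ^ 3 / real k ^ 2) \<le> \<epsilon> / 2"
  proof -
    have "real N ^ 3 \<le> (2 * T * r) ^ 3" using N by (intro power_mono) auto
    then have "real N ^ 3 / real k ^ 2 \<le> (2 * T * r) ^ 3 / real k ^ 2" by (rule divide_right_mono) simp
    also have "\<dots> = 8 * T ^ 3 / r"
      using r(1) unfolding r(2)[symmetric] by (simp add: power2_eq_square power3_eq_cube field_simps)
    finally show ?thesis using c2 by (simp add: r_def)
  qed
  have err2: "real N ^ 2 * real (card U) / real k ^ 2 \<le> \<epsilon> / 2" if "card U \<le> h * m" for U :: "nat set"
  proof -
    have "real (card U) \<le> 2 * real n / r" using that hm_le by linarith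
    moreover have "real N ^ 2 \<le> (2 * T * r) ^ 2" using N by (intro power_mono) auto
    ultimately have "real N ^ 2 * real (card U) \<le> (2 * T * r) ^ 2 * (2 * real n / r)"
      by (intro mult_mono) auto
    also have "\<dots> = 8 * T\<^sup>2 * real n * r" using r(1) by (simp add: power2_eq_square field_simps)
    also have "\<dots> \<le> \<epsilon> / 2 * (real k * r) * r"
      using c3 r(1) by (intro mult_right_mono) (auto simp: r_def)
    also have "\<dots> = \<epsilon> / 2 * real k ^ 2" unfolding r(2)[symmetric] by (simp add: power2_eq_square)
    finally show ?thesis using k by (simp add: pos_divide_le_eq)
  qed
  have med: "1 / 2 \<le> measure_pmf.prob (words k (Knn_vertices n)) {\<sigma>. nat \<lfloor>(1 - 2 * (2 * \<epsilon>)) * real (h * m)\<rfloor> \<le> R (kept_edges n \<sigma>)}"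
  proof (rule R_median[where \<delta> = "2 * \<epsilon>" and h = h and m = m and N = N, OF k])
    fix c and U :: "nat set" assume U: "finite U" "card U \<le> h * m"
    have "1 - \<epsilon> - 5 * (real N ^ 3 / real k ^ 2) - real N ^ 2 * real (card U) / real k ^ 2
      \<le> measure_pmf.prob (words k (ablk c ` {..<N} \<union> bblk c ` {..<N})) (block_success (ablk c) (bblk c) N h U)"
    proof (rule block_success_prob)
      show "inj (ablk c)" "inj (bblk c)" by (auto simp: inj_def)
      show "real h \<le> 2 * (real N * (1 / sqrt (real k))) * (1 - 2 * \<epsilon>)" using h_le by (simp add: r_def)
      show "2000 / \<epsilon> ^ 5 \<le> real N * (1 / sqrt (real k))" using Nr(1) by (simp add: r_def T_def)
    qed (use k Nk U \<epsilon> c1 in auto)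
    then show "1 - 2 * \<epsilon> \<le> measure_pmf.prob (words k (ablk c ` {..<N} \<union> bblk c ` {..<N}))
        (block_success (ablk c) (bblk c) N h U)"
      using err1 err2[OF U(2)] by linarith
  next
    show "real (nat \<lfloor>(1 - 2 * (2 * \<epsilon>)) * real (h * m)\<rfloor>) \<le> (1 - 2 * (2 * \<epsilon>)) * real (h * m)"
      using \<epsilon> by (intro of_nat_floor) auto
  qed (use \<epsilon> mN hm0 in auto)
  have "(1 - 10 * \<epsilon>) * (2 * real n / r) \<le> real (nat \<lfloor>(1 - 2 * (2 * \<epsilon>)) * real (h * m)\<rfloor>)"
  proof -
    have "(1 - 9 * \<epsilon>) * (2 * real n / r) \<le> (1 - 4 * \<epsilon>) * (1 - 4 * \<epsilon>) * (2 * real n / r)"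
      using L0 \<epsilon> by (intro mult_right_mono) (auto simp: algebra_simps)
    also have "\<dots> \<le> (1 - 4 * \<epsilon>) * real (h * m)"
      using hm_ge \<epsilon> by (simp only: mult.assoc) (intro mult_left_mono, auto)
    finally have "(1 - 9 * \<epsilon>) * (2 * real n / r) \<le> (1 - 2 * (2 * \<epsilon>)) * real (h * m)" by simp
    moreover have "1 \<le> \<epsilon> * (2 * real n / r)"
    proof -
      have "\<epsilon> * (2 * T / \<epsilon>) \<le> \<epsilon> * (real n / r)" using c4 \<epsilon> by (intro mult_left_mono) (auto simp: r_def)
      then have "2 * T \<le> \<epsilon> * (real n / r)" using \<epsilon> by simp
      then have "1 \<le> 2 * (\<epsilon> * (real n / r))" using T1 by argo
      then show ?thesis by (simp add: mult.left_commute)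
    qed
    moreover have "(1 - 10 * \<epsilon>) * x \<le> y - 1" if "(1 - 9 * \<epsilon>) * x \<le> y" "1 \<le> \<epsilon> * x" for x y :: real
      using that by (simp add: algebra_simps)
    ultimately have "(1 - 10 * \<epsilon>) * (2 * real n / r) \<le> (1 - 2 * (2 * \<epsilon>)) * real (h * m) - 1"
      by blast
    then show ?thesis by linarith
  qed
  then show ?thesis using med unfolding r_def by blast
qed

theorem theorem10:
  fixes n :: "nat \<Rightarrow> nat"
  assumes "\<And>k. k > 0 \<Longrightarrow> n k > 0"
    and "filterlim (\<lambda>k. real (n k) / sqrt (real k)) at_top sequentially"
    and "(\<lambda>k. real (n k)) \<in> o(\<lambda>k. real k * sqrt (real k))"
  shows "\<forall>\<xi>::real. 0 < \<xi> \<and> \<xi> \<le> 1 \<longrightarrow> (\<exists>k0::nat. \<forall>k>k0.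
      measure_pmf.prob (Sigma_Knn (n k) k)
        {G. real (R G) \<le> (1 - \<xi>) * (2 * real (n k) / sqrt (real k))}
      \<le> 2 * exp (- (1 / 10) * \<xi>\<^sup>2 * (2 * real (n k) / sqrt (real k))))"
proof (intro allI impI)
  fix \<xi> :: real assume \<xi>: "0 < \<xi> \<and> \<xi> \<le> 1"
  \<comment> \<open>Then the loss \<open>10 * \<epsilon>\<close> of
    \<open>R_median_quantitative\<close> is the slack \<open>\<xi> / 10\<close> of
    \<open>R_lower_tail\<close>.\<close>
  define \<epsilon> where "\<epsilon> = \<xi> / 100"
  have \<epsilon>: "0 < \<epsilon>" "\<epsilon> \<le> 1 / 100" using \<xi> by (auto simp: \<epsilon>_def)
  define T where "T = 2000 / \<epsilon>^5"
  have T0: "0 < T" using \<epsilon> by (simp add: T_def)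
  have "((\<lambda>k. c / sqrt (real k)) \<longlongrightarrow> 0) sequentially" for c :: real
    by (intro tendsto_divide_0[OF tendsto_const] filterlim_at_top_imp_at_infinity
        filterlim_compose[OF sqrt_at_top] filterlim_real_sequentially)
  then have small: "\<forall>\<^sub>F k in sequentially. c / sqrt (real k) < d" if "0 < d" for c d :: real
    using that by (rule order_tendstoD)
  have ev1: "\<forall>\<^sub>F k in sequentially. 1 / sqrt (real k) < \<epsilon>\<^sup>2 / 8"
    using \<epsilon> by (intro small) auto
  have ev2: "\<forall>\<^sub>F k in sequentially. 40 * T ^ 3 / sqrt (real k) < \<epsilon> / 2"
    using \<epsilon> by (intro small) auto
  have ev3: "\<forall>\<^sub>F k in sequentially. norm (real (n k)) \<le> \<epsilon> / (16 * T\<^sup>2) * norm (real k * sqrt (real k))"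
    using \<epsilon> T0 by (intro landau_o.smallD[OF assms(3)]) auto
  have ev4: "\<forall>\<^sub>F k in sequentially. 2 * T / \<epsilon> \<le> real (n k) / sqrt (real k)"
    using assms(2) by (simp add: filterlim_at_top)
  have "\<forall>\<^sub>F k in sequentially. measure_pmf.prob (Sigma_Knn (n k) k)
        {G. real (R G) \<le> (1 - \<xi>) * (2 * real (n k) / sqrt (real k))}
      \<le> 2 * exp (- (1 / 10) * \<xi>\<^sup>2 * (2 * real (n k) / sqrt (real k)))"
    using ev1 ev2 ev3 ev4 eventually_gt_at_top[of 0]
  proof eventually_elim
    case (elim k)
    have "8 * T\<^sup>2 * real (n k) \<le> 8 * T\<^sup>2 * (\<epsilon> / (16 * T\<^sup>2) * (real k * sqrt (real k)))"
      using elim(3) by (intro mult_left_mono) auto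
    also have "\<dots> = \<epsilon> / 2 * (real k * sqrt (real k))" using T0 by simp
    finally have c3: "8 * T\<^sup>2 * real (n k) \<le> \<epsilon> / 2 * (real k * sqrt (real k))" .
    obtain b where b: "(1 - 10 * \<epsilon>) * (2 * real (n k) / sqrt (real k)) \<le> real b"
      "1 / 2 \<le> measure_pmf.prob (words k (Knn_vertices (n k))) {\<sigma>. b \<le> R (kept_edges (n k) \<sigma>)}"
      using R_median_quantitative[of k \<epsilon> "n k"] elim c3 \<epsilon> unfolding T_def by auto
    have "measure_pmf.prob (words k (Knn_vertices (n k)))
        {\<sigma>. real (R (kept_edges (n k) \<sigma>)) \<le> (1 - \<xi>) * (2 * real (n k) / sqrt (real k))}
      \<le> 2 * exp (- (1 / 10) * \<xi>\<^sup>2 * (2 * real (n k) / sqrt (real k)))"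
      by (rule R_lower_tail[of k \<xi> _ b]) (use \<xi> b elim(5) assms(1)[OF elim(5)] in \<open>auto simp: \<epsilon>_def\<close>)
    then show ?case unfolding Sigma_Knn_def measure_map_pmf by (simp add: vimage_def)
  qed
  then obtain k0 where "\<And>k. k \<ge> k0 \<Longrightarrow> measure_pmf.prob (Sigma_Knn (n k) k)
        {G. real (R G) \<le> (1 - \<xi>) * (2 * real (n k) / sqrt (real k))}
      \<le> 2 * exp (- (1 / 10) * \<xi>\<^sup>2 * (2 * real (n k) / sqrt (real k)))"
    unfolding eventually_sequentially by blast
  then show "\<exists>k0::nat. \<forall>k>k0. measure_pmf.prob (Sigma_Knn (n k) k)
        {G. real (R G) \<le> (1 - \<xi>) * (2 * real (n k) / sqrt (real k))}
      \<le> 2 * exp (- (1 / 10) * \<xi>\<^sup>2 * (2 * real (n k) / sqrt (real k)))"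
    by (intro exI[of _ k0]) auto
qed

end
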